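(* Let $\lambda=\lambda_n>0$ and $\gamma=\gamma_n>0$, put $\check\kappa=\min\{\kappa,1\}$, $\check r=\min\{r,1/2\}$, and define $$\omega_n=\sqrt{v_{\check\kappa}\gamma^{1-\check\kappa}\frac{\mathcal N(\lambda)}{n}}+\lambda^{\check r+1/2}+v_{\check\kappa}\gamma^{-\check\kappa}.$$ (i) Suppose Assumptions (A), (B), (C), (D) (stated in the context) hold, and that $\gamma\ge 2(4v_{\check\kappa})^{\frac1{1+\check\kappa}}$, $\gamma\ge C_1\omega_n$ for a sufficiently large constant $C_1$, and $\frac{\mathcal N(\lambda)}{n\lambda}=o(1)$ as $n\to\infty$. Then $$\|(\Gamma+\lambda)^{1/2}(\widehat f-f_0)\|=O_p(\omega_n).$$ (ii) Suppose that, in addition to all the hypotheses of (i), Assumption (E) (stated in the context) holds, and that for $\delta\in(0,1)$ (possibly depending on $n$) one has $C_1\omega_n\log(\frac n\delta)\le\gamma\le C_2 n^{\frac1{1+\kappa}}$ for a sufficiently large constant $C_1$ and a constant $C_2$, and $\frac{\mathcal N(\lambda)}{n\lambda}\log^2(\frac n\delta)=o(1)$ as $n\to\infty$. Then there is a constant $C>0$, not depending on $n$ or $\delta$, such that for all sufficiently large $n$, with probability at least $1-\delta$, $$\|(\Gamma+\lambda)^{1/2}(\widehat f-f_0)\|\le C\,\omega_n\log\Big(\frac n\delta\Big).$$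
   Context: Let $\mathcal T=[0,1]$ with Lebesgue measure, and let $L^2(\mathcal T)$ have inner product $\langle\cdot,\cdot\rangle$ and norm $\|\cdot\|$. Let $(X_i,y_i)$, $i=1,\dots,n$, be an i.i.d. sample of copies of $(X,y)$, where $X$ is a random element of $L^2(\mathcal T)$ with $E[X]=0$, and $$y_i=\langle f_0,X_i\rangle+\epsilon_i,$$ with $f_0\in L^2(\mathcal T)$ the true function and $\epsilon_i$ the noise (the intercept is taken to be zero). Huber's loss with robustness parameter $\gamma>0$ is $H_\gamma(u)=u^2/2$ if $|u|\le\gamma$ and $H_\gamma(u)=\gamma|u|-\gamma^2/2$ if $|u|>\gamma$. The estimator is $$\widehat f=\arg\min_{f\in L^2(\mathcal T)}\frac1n\sum_{i=1}^nH_\gamma(y_i-\langle X_i,f\rangle)+\lambda\|f\|^2 .$$ For $u\in L^2(\mathcal T)$, $u\otimes u$ is the operator $(u\otimes u)f=\langle u,f\rangle u$. Let $\Gamma=E[X\otimes X]$, with spectral decomposition $\Gamma=\sum_{j\ge1}s_j(e_j\otimes e_j)$, $s_1\ge s_2\ge\cdots$; all $s_j>0$ and $(e_j)_{j\ge1}$ is an orthonormal basis of $L^2(\mathcal T)$. $\Gamma+\lambda$ means $\Gamma+\lambda I$. Put $\mathcal N(\lambda)=\mathrm{tr}((\Gamma+\lambda)^{-1}\Gamma)=\sum_j\frac{s_j}{s_j+\lambda}$. Assumptions ($C$ denotes positive constants, not depending on $n$, which may differ from place to place): (A) $E\|X\|^4<\infty$, $\Gamma$ is a positive-definite trace-class operator,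 and $(E\langle X,f\rangle^4)^{1/4}\le C(E\langle X,f\rangle^2)^{1/2}$ for all $f\in L^2(\mathcal T)$. (B) $f_0=\Gamma^r g_0$ for some $r\ge0$ and some $g_0\in L^2(\mathcal T)$ with $\|g_0\|\le C$. (C) For some $\beta\in(0,1]$, $\mathcal N(\lambda)\le C\lambda^{-\beta}$. (D) $E[\epsilon_i|X_i]=0$ and $E[|\epsilon_i|^{1+\kappa}|X_i]\le v_\kappa$ for some $\kappa>0$, $v_\kappa>0$. (E) $X=\sum_{j\ge1}\xi_je_j$, where $\xi_j=\langle X,e_j\rangle$ are independent of each other and $\xi_j$ is sub-Gaussian with parameter $s_j$ in the sense that $E[e^{t\xi_j/\sqrt{s_j}}]\le e^{Ct^2}$ for all $t\in\mathbb R$ and all $j\ge1$, with $C$ not depending on $j$. $v_{\check\kappa}>0$ denotes a constant with $E[|\epsilon_i|^{1+\check\kappa}|X_i]\le v_{\check\kappa}$: it is $v_\kappa$ if $\kappa\le1$; if $\kappa>1$ it is a bound on the conditional second moment (which exists by (D) and Jensen's inequality). For random variables $Z_n$ and positive numbers $r_n$, $Z_n=O_p(r_n)$ means: for any $\delta\in(0,1)$ there is $C>0$ with $P(|Z_n|>Cr_n)<\delta$ for all $n$. *)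

theory Defs
  imports "HOL-Probability.Probability"
begin

abbreviation unit_lebesgue :: "real measure" where
  "unit_lebesgue \<equiv> lebesgue_on {0..1}"

definition sq_int :: "(real \<Rightarrow> real) \<Rightarrow> bool" where
  "sq_int f \<longleftrightarrow> f \<in> borel_measurable unit_lebesgue \<and> integrable unit_lebesgue (\<lambda>t. (f t)\<^sup>2)"

lemma prob_space_unit_lebesgue: "prob_space unit_lebesgue"
  by (rule prob_spaceI) (simp add: emeasure_restrict_space space_restrict_space)

lemma sq_int_measurable [dest]: "sq_int f \<Longrightarrow> f \<in> borel_measurable unit_lebesgue"
  and sq_int_integrable: "sq_int f \<Longrightarrow> integrable unit_lebesgue (\<lambda>t. (f t)\<^sup>2)"
  by (auto simp: sq_int_def)

lemma finite_measure_unit_lebesgue [simp]: "emeasure unit_lebesgue A \<noteq> \<top>"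
proof -
  interpret prob_space unit_lebesgue by (rule prob_space_unit_lebesgue)
  show ?thesis by (simp add: emeasure_eq_measure)
qed

lemma sq_int_bound:
  assumes "sq_int g" "f \<in> borel_measurable unit_lebesgue"
    "AE t in unit_lebesgue. \<bar>f t\<bar> \<le> \<bar>g t\<bar>"
  shows "sq_int f"
  unfolding sq_int_def
proof (intro conjI)
  show "integrable unit_lebesgue (\<lambda>t. (f t)\<^sup>2)"
  proof (rule Bochner_Integration.integrable_bound[OF sq_int_integrable[OF assms(1)]])
    show "AE t in unit_lebesgue. norm ((f t)\<^sup>2) \<le> norm ((g t)\<^sup>2)"
      using assms(3) by eventually_elim (simp add: abs_le_square_iff)
  qed (use assms(2) in measurable)
qed (fact assms(2))

lemma sq_int_mult:
  assumes "sq_int f" "sq_int g"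
  shows "integrable unit_lebesgue (\<lambda>t. f t * g t)"
proof (rule Bochner_Integration.integrable_bound)
  show "integrable unit_lebesgue (\<lambda>t. (f t)\<^sup>2 + (g t)\<^sup>2)"
    using assms by (simp add: sq_int_def)
  have [measurable]: "f \<in> borel_measurable unit_lebesgue" "g \<in> borel_measurable unit_lebesgue"
    using assms by auto
  show "(\<lambda>t. f t * g t) \<in> borel_measurable unit_lebesgue" by measurable
  have "\<bar>a * b\<bar> \<le> a\<^sup>2 + b\<^sup>2" for a b :: real
    using sum_squares_bound[of "\<bar>a\<bar>" "\<bar>b\<bar>"] by (simp add: abs_mult mult.assoc)
      (smt (verit) abs_ge_zero mult_nonneg_nonneg zero_le_power2)
  then show "AE t in unit_lebesgue. norm (f t * g t) \<le> norm ((f t)\<^sup>2 + (g t)\<^sup>2)" by simp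
qed

lemma sq_int_add: "sq_int (\<lambda>t. f t + g t)" if f: "sq_int f" and g: "sq_int g"
proof -
  have "(\<lambda>t. (f t + g t)\<^sup>2) = (\<lambda>t. (f t)\<^sup>2 + (g t)\<^sup>2 + 2 * (f t * g t))"
    by (auto simp: power2_sum)
  then show ?thesis
    using f g sq_int_mult[OF f g] by (auto simp: sq_int_def)
qed

lemma sq_int_cmult: "sq_int (\<lambda>t. c * f t)" if "sq_int f"
  using that by (auto simp: sq_int_def power_mult_distrib)

lemma sq_int_minus: "sq_int (\<lambda>t. - f t)" if "sq_int f"
  using sq_int_cmult[OF that, of "-1"] by simp

lemma sq_int_diff: "sq_int (\<lambda>t. f t - g t)" if "sq_int f" "sq_int g"
  using sq_int_add[OF that(1) sq_int_minus[OF that(2)]] by simp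

lemma sq_int_const: "sq_int (\<lambda>_. c)"
  using finite_measure.integrable_const[OF prob_space.finite_measure[OF prob_space_unit_lebesgue]]
  by (simp add: sq_int_def)

lemma sq_int_indicator: "A \<in> sets unit_lebesgue \<Longrightarrow> sq_int (indicator A)"
  by (rule sq_int_bound[OF sq_int_const[of 1]]) (auto simp: indicator_def)

quotient_type L2 = "real \<Rightarrow> real" / partial:
  "\<lambda>f g. sq_int f \<and> sq_int g \<and> (AE t in unit_lebesgue. f t = g t)"
proof (rule part_equivpI)
  show "\<exists>f. sq_int f \<and> sq_int f \<and> (AE t in unit_lebesgue. f t = f t)"
    using sq_int_const[of 0] by auto
  show "symp (\<lambda>f g. sq_int f \<and> sq_int g \<and> (AE t in unit_lebesgue. f t = g t))"
    by (auto simp: symp_def elim: AE_mp)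
  show "transp (\<lambda>f g. sq_int f \<and> sq_int g \<and> (AE t in unit_lebesgue. f t = g t))"
  proof (rule transpI, elim conjE, intro conjI)
    fix f g h :: "real \<Rightarrow> real"
    assume "AE t in unit_lebesgue. f t = g t" "AE t in unit_lebesgue. g t = h t"
    then show "AE t in unit_lebesgue. f t = h t" by eventually_elim simp
  qed
qed

instantiation L2 :: real_vector
begin

lift_definition zero_L2 :: L2 is "\<lambda>_. 0" by (simp add: sq_int_const)

lift_definition plus_L2 :: "L2 \<Rightarrow> L2 \<Rightarrow> L2" is "\<lambda>f g t. f t + g t"
  by (auto intro: sq_int_add)

lift_definition uminus_L2 :: "L2 \<Rightarrow> L2" is "\<lambda>f t. - f t"
  by (auto intro: sq_int_minus)

lift_definition minus_L2 :: "L2 \<Rightarrow> L2 \<Rightarrow> L2" is "\<lambda>f g t. f t - g t"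
  by (auto intro: sq_int_diff)

lift_definition scaleR_L2 :: "real \<Rightarrow> L2 \<Rightarrow> L2" is "\<lambda>c f t. c * f t"
  by (auto intro: sq_int_cmult)

instance
  by standard
    (transfer, auto simp: algebra_simps intro: sq_int_add sq_int_cmult sq_int_minus sq_int_diff
       sq_int_const)+

end

instantiation L2 :: real_inner
begin

lift_definition inner_L2 :: "L2 \<Rightarrow> L2 \<Rightarrow> real" is "\<lambda>f g. \<integral>t. f t * g t \<partial>unit_lebesgue"
proof (elim conjE)
  fix f f' g g' :: "real \<Rightarrow> real"
  assume "sq_int f" "sq_int f'" "sq_int g" "sq_int g'"
  then have [measurable]: "f \<in> borel_measurable unit_lebesgue" "f' \<in> borel_measurable unit_lebesgue"
    "g \<in> borel_measurable unit_lebesgue" "g' \<in> borel_measurable unit_lebesgue"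
    by auto
  assume "AE t in unit_lebesgue. f t = f' t" "AE t in unit_lebesgue. g t = g' t"
  then have "AE t in unit_lebesgue. f t * g t = f' t * g' t" by eventually_elim simp
  then show "(\<integral>t. f t * g t \<partial>unit_lebesgue) = (\<integral>t. f' t * g' t \<partial>unit_lebesgue)"
    by (intro integral_cong_AE) auto
qed

definition norm_L2 :: "L2 \<Rightarrow> real" where "norm_L2 f = sqrt (inner f f)"

definition sgn_L2 :: "L2 \<Rightarrow> L2" where "sgn_L2 f = inverse (norm f) *\<^sub>R f"

definition dist_L2 :: "L2 \<Rightarrow> L2 \<Rightarrow> real" where "dist_L2 f g = norm (f - g)"

definition uniformity_L2 :: "(L2 \<times> L2) filter" where
  "uniformity_L2 = (INF d\<in>{0<..}. principal {(f, g). dist f g < d})"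

definition open_L2 :: "L2 set \<Rightarrow> bool" where
  "open_L2 U \<longleftrightarrow> (\<forall>f\<in>U. \<forall>\<^sub>F (f', g) in uniformity. f' = f \<longrightarrow> g \<in> U)"

instance
proof
  fix f g h :: L2 and c :: real
  show "inner f g = inner g f" by transfer (simp add: mult.commute)
  show "inner (f + g) h = inner f h + inner g h"
    by transfer (simp add: distrib_right sq_int_mult)
  show "inner (c *\<^sub>R f) g = c * inner f g" by transfer (simp add: mult.assoc)
  show "0 \<le> inner f f" by transfer simp
  show "inner f f = 0 \<longleftrightarrow> f = 0"
  proof transfer
    fix f :: "real \<Rightarrow> real"
    assume "sq_int f \<and> sq_int f \<and> (AE t in unit_lebesgue. f t = f t)"
    then have f: "sq_int f" by simp
    have "((\<integral>t. f t * f t \<partial>unit_lebesgue) = 0) \<longleftrightarrow> (AE t in unit_lebesgue. f t * f t = 0)"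
      by (rule integral_nonneg_eq_0_iff_AE) (use f in \<open>auto intro: sq_int_mult\<close>)
    then show "((\<integral>t. f t * f t \<partial>unit_lebesgue) = 0) =
        (sq_int f \<and> sq_int (\<lambda>_. 0) \<and> (AE t in unit_lebesgue. f t = 0))"
      using f by (simp add: sq_int_const)
  qed
qed (simp_all add: norm_L2_def sgn_L2_def dist_L2_def uniformity_L2_def open_L2_def)

end

lemma norm_abs_L2: "sq_int f \<Longrightarrow> (norm (abs_L2 f))\<^sup>2 = (\<integral>t. (f t)\<^sup>2 \<partial>unit_lebesgue)"
  unfolding power2_norm_eq_inner by (simp add: inner_L2.abs_eq power2_eq_square)

lemma abs_L2_diff: "sq_int f \<Longrightarrow> sq_int g \<Longrightarrow> abs_L2 f - abs_L2 g = abs_L2 (\<lambda>t. f t - g t)"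
  by (simp add: minus_L2.abs_eq)

lemma abs_L2_add: "sq_int f \<Longrightarrow> sq_int g \<Longrightarrow> abs_L2 f + abs_L2 g = abs_L2 (\<lambda>t. f t + g t)"
  by (simp add: plus_L2.abs_eq)

lemma abs_L2_scaleR: "sq_int f \<Longrightarrow> c *\<^sub>R abs_L2 f = abs_L2 (\<lambda>t. c * f t)"
  by (simp add: scaleR_L2.abs_eq)

lemma abs_L2_cong:
  "sq_int f \<Longrightarrow> sq_int g \<Longrightarrow> AE t in unit_lebesgue. f t = g t \<Longrightarrow> abs_L2 f = abs_L2 g"
  by (intro Quotient3_rel_abs[OF Quotient3_L2]) auto

lemma abs_L2_cases:
  obtains f where "sq_int f" "F = abs_L2 f"
proof -
  have "sq_int (rep_L2 F)" using Quotient3_rep_reflp[OF Quotient3_L2, of F] by simp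
  moreover have "F = abs_L2 (rep_L2 F)" by (simp add: Quotient3_abs_rep[OF Quotient3_L2])
  ultimately show ?thesis by (rule that)
qed

lemma sq_int_AE_cong:
  assumes "sq_int f" "g \<in> borel_measurable unit_lebesgue" "AE t in unit_lebesgue. f t = g t"
  shows "sq_int g"
  by (rule sq_int_bound[OF assms(1,2)]) (use assms(3) in \<open>eventually_elim, simp\<close>)

lemma abs_L2_tendsto_dominated:
  assumes s: "\<And>i. sq_int (s i)" and f: "sq_int f" and w: "sq_int w"
    and lim: "AE t in unit_lebesgue. (\<lambda>i. s i t) \<longlonglongrightarrow> f t"
    and le: "\<And>i. AE t in unit_lebesgue. \<bar>s i t - f t\<bar> \<le> \<bar>w t\<bar>"
  shows "(\<lambda>i. abs_L2 (s i)) \<longlonglongrightarrow> abs_L2 f"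
proof -
  have [measurable]: "\<And>i. s i \<in> borel_measurable unit_lebesgue" "f \<in> borel_measurable unit_lebesgue"
    using s f by auto
  have "(\<lambda>i. \<integral>t. (s i t - f t)\<^sup>2 \<partial>unit_lebesgue) \<longlonglongrightarrow> (\<integral>t. 0 \<partial>unit_lebesgue)"
  proof (rule integral_dominated_convergence[OF _ _ sq_int_integrable[OF w]])
    show "AE t in unit_lebesgue. (\<lambda>i. (s i t - f t)\<^sup>2) \<longlonglongrightarrow> 0"
      using lim
    proof eventually_elim
      case (elim t)
      have "(\<lambda>i. (s i t - f t)\<^sup>2) \<longlonglongrightarrow> (f t - f t)\<^sup>2" by (intro tendsto_intros elim)
      then show ?case by simp
    qed
    show "AE t in unit_lebesgue. norm ((s i t - f t)\<^sup>2) \<le> (w t)\<^sup>2" for i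
      using le[of i] by eventually_elim (simp add: abs_le_square_iff)
  qed measurable
  then have "(\<lambda>i. (norm (abs_L2 (s i) - abs_L2 f))\<^sup>2) \<longlonglongrightarrow> 0"
    using s f by (simp add: abs_L2_diff norm_abs_L2 sq_int_diff)
  then have "(\<lambda>i. norm (abs_L2 (s i) - abs_L2 f)) \<longlonglongrightarrow> 0"
    using tendsto_real_sqrt by fastforce
  then show ?thesis by (simp add: LIM_zero_iff tendsto_norm_zero_iff)
qed

instance L2 :: complete_space
proof
  fix F :: "nat \<Rightarrow> L2"
  assume F: "Cauchy F"
  have "\<exists>f. sq_int f \<and> F i = abs_L2 f" for i by (metis abs_L2_cases)
  then obtain f where f: "\<And>i. sq_int (f i)" and Ff: "\<And>i. F i = abs_L2 (f i)" by metis
  have [measurable]: "\<And>i. f i \<in> borel_measurable unit_lebesgue" using f by auto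
  have "\<exists>N. \<forall>m\<ge>N. \<forall>n\<ge>N. dist (F m) (F n) < (1/2)^k" for k
    using F by (auto simp: Cauchy_def)
  then obtain N where N: "\<And>k m n. m \<ge> N k \<Longrightarrow> n \<ge> N k \<Longrightarrow> dist (F m) (F n) < (1/2)^k" by metis
  define r where "r k = (\<Sum>j\<le>k. N j)" for k
  have rN: "N k \<le> r k" for k by (auto simp: r_def intro: member_le_sum)
  have r_mono: "r j \<le> r k" if "j \<le> k" for j k
    using that by (auto simp: r_def intro: sum_mono2)
  define d where "d k t = \<bar>f (r (Suc k)) t - f (r k) t\<bar>" for k t
  have d_nonneg: "d k t \<ge> 0" for k t by (simp add: d_def)
  have [measurable]: "\<And>k. d k \<in> borel_measurable unit_lebesgue" unfolding d_def by measurable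
  have d_sq: "sq_int (d k)" for k
    by (rule sq_int_bound[OF sq_int_diff[OF f[of "r (Suc k)"] f[of "r k"]]]) (auto simp: d_def)
  have d_int: "integrable unit_lebesgue (d k)" for k
    using sq_int_mult[OF d_sq[of k] sq_int_const[of 1]] by simp
  have d_le: "(\<integral>t. d k t \<partial>unit_lebesgue) \<le> (1/2)^k" for k
  proof -
    have "(\<integral>t. d k t \<partial>unit_lebesgue) = inner (abs_L2 (d k)) (abs_L2 (\<lambda>_. 1))"
      by (simp add: inner_L2.abs_eq d_sq sq_int_const)
    also have "\<dots> \<le> norm (abs_L2 (d k)) * norm (abs_L2 (\<lambda>_. 1))"
      by (rule norm_cauchy_schwarz)
    also have "norm (abs_L2 (\<lambda>_. 1)) = 1"
      using norm_abs_L2[OF sq_int_const[of 1]] prob_space.prob_space[OF prob_space_unit_lebesgue]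
      by (simp add: power2_eq_1_iff) (smt (verit) norm_ge_zero)
    also have "(norm (abs_L2 (d k)))\<^sup>2 = (norm (F (r (Suc k)) - F (r k)))\<^sup>2"
      by (simp add: Ff abs_L2_diff f norm_abs_L2 sq_int_diff d_sq) (simp add: d_def)
    then have "norm (abs_L2 (d k)) = dist (F (r (Suc k))) (F (r k))"
      by (simp add: dist_norm power2_eq_iff_nonneg)
    also have "\<dots> * 1 \<le> (1/2)^k"
      using N[of k "r (Suc k)" "r k"] rN[of k] r_mono[of k "Suc k"] by simp
    finally show ?thesis by simp
  qed
  have "(\<integral>\<^sup>+ t. (\<Sum>k. ennreal (d k t)) \<partial>unit_lebesgue) = (\<Sum>k. \<integral>\<^sup>+ t. ennreal (d k t) \<partial>unit_lebesgue)"
    by (rule nn_integral_suminf) measurable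
  also have "\<dots> \<le> (\<Sum>k. ennreal ((1/2)^k))"
  proof (rule suminf_le)
    show "(\<integral>\<^sup>+ t. ennreal (d k t) \<partial>unit_lebesgue) \<le> ennreal ((1/2)^k)" for k
      by (subst nn_integral_eq_integral[OF d_int]) (use d_le[of k] in \<open>auto simp: d_nonneg intro: ennreal_leI\<close>)
  qed auto
  also have "\<dots> = ennreal (\<Sum>k. (1/2)^k)"
    by (rule suminf_ennreal2) auto
  also have "\<dots> < \<infinity>" by simp
  finally have fin: "(\<integral>\<^sup>+ t. (\<Sum>k. ennreal (d k t)) \<partial>unit_lebesgue) \<noteq> \<infinity>" by simp
  have "AE t in unit_lebesgue. (\<Sum>k. ennreal (d k t)) \<noteq> \<infinity>"
    by (rule nn_integral_PInf_AE[OF _ fin]) measurable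
  then have conv: "AE t in unit_lebesgue. convergent (\<lambda>k. f (r k) t)"
  proof eventually_elim
    case (elim t)
    have "summable (\<lambda>k. d k t)"
      by (rule summable_suminf_not_top) (use elim in \<open>auto simp: d_def\<close>)
    then have "summable (\<lambda>k. f (r (Suc k)) t - f (r k) t)"
      unfolding d_def by (rule summable_rabs_cancel)
    from summable_LIMSEQ[OF this] obtain l where "(\<lambda>n. f (r n) t - f (r 0) t) \<longlonglongrightarrow> l"
      unfolding sum_lessThan_telescope[of "\<lambda>k. f (r k) t"] by blast
    from tendsto_add[OF this tendsto_const[of "f (r 0) t"]] show ?case
      by (auto simp: convergent_def)
  qed
  define g where "g t = lim (\<lambda>k. f (r k) t)" for t
  have [measurable]: "g \<in> borel_measurable unit_lebesgue" unfolding g_def by measurable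
  have lim: "AE t in unit_lebesgue. (\<lambda>k. f (r k) t) \<longlonglongrightarrow> g t"
    using conv by eventually_elim (simp add: g_def convergent_LIMSEQ_iff)
  have key: "(\<integral>\<^sup>+ t. ennreal ((f m t - g t)\<^sup>2) \<partial>unit_lebesgue) \<le> ennreal (((1/2)^j)\<^sup>2)"
    if m: "m \<ge> N j" for m j
  proof -
    have "(\<integral>\<^sup>+ t. ennreal ((f m t - g t)\<^sup>2) \<partial>unit_lebesgue) =
      (\<integral>\<^sup>+ t. liminf (\<lambda>k. ennreal ((f m t - f (r k) t)\<^sup>2)) \<partial>unit_lebesgue)"
    proof (rule nn_integral_cong_AE)
      show "AE t in unit_lebesgue. ennreal ((f m t - g t)\<^sup>2) =
          liminf (\<lambda>k. ennreal ((f m t - f (r k) t)\<^sup>2))"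
        using lim
      proof eventually_elim
        case (elim t)
        have "(\<lambda>k. ennreal ((f m t - f (r k) t)\<^sup>2)) \<longlonglongrightarrow> ennreal ((f m t - g t)\<^sup>2)"
          by (intro tendsto_intros elim)
        then show ?case by (intro lim_imp_Liminf[symmetric]) auto
      qed
    qed
    also have "\<dots> \<le> liminf (\<lambda>k. \<integral>\<^sup>+ t. ennreal ((f m t - f (r k) t)\<^sup>2) \<partial>unit_lebesgue)"
      by (rule nn_integral_liminf) measurable
    also have "\<dots> \<le> ennreal (((1/2)^j)\<^sup>2)"
    proof (rule Liminf_le)
      show "\<forall>\<^sub>F k in sequentially.
          (\<integral>\<^sup>+ t. ennreal ((f m t - f (r k) t)\<^sup>2) \<partial>unit_lebesgue) \<le> ennreal (((1/2)^j)\<^sup>2)"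
        using eventually_ge_at_top[of j]
      proof eventually_elim
        case (elim k)
        have "(\<integral>\<^sup>+ t. ennreal ((f m t - f (r k) t)\<^sup>2) \<partial>unit_lebesgue) =
            ennreal (\<integral>t. (f m t - f (r k) t)\<^sup>2 \<partial>unit_lebesgue)"
          by (rule nn_integral_eq_integral) (use sq_int_diff[OF f f] in \<open>auto simp: sq_int_def\<close>)
        also have "\<dots> = ennreal ((dist (F m) (F (r k)))\<^sup>2)"
          by (simp add: dist_norm Ff abs_L2_diff f norm_abs_L2 sq_int_diff)
        also have "\<dots> \<le> ennreal (((1/2)^j)\<^sup>2)"
          using N[OF m, of "r k"] rN[of j] r_mono[OF elim]
          by (intro ennreal_leI power_mono) auto
        finally show ?case .
      qed
    qed auto
    finally show ?thesis .
  qed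
  have diff_sq: "sq_int (\<lambda>t. f m t - g t)" if "m \<ge> N j" for m j
    unfolding sq_int_def
  proof (intro conjI)
    show "integrable unit_lebesgue (\<lambda>t. (f m t - g t)\<^sup>2)"
      using key[OF that] by (intro integrableI_nonneg) (auto intro: le_less_trans)
  qed measurable
  have g_sq: "sq_int g"
    using sq_int_diff[OF f[of "N 0"] diff_sq[of 0 "N 0"]] by simp
  have "F \<longlonglongrightarrow> abs_L2 g"
  proof (rule LIMSEQ_I)
    fix \<epsilon> :: real
    assume "\<epsilon> > 0"
    then obtain j where j: "(1/2)^j < \<epsilon>" using real_arch_pow_inv[of \<epsilon> "1/2"] by auto
    have "norm (F m - abs_L2 g) < \<epsilon>" if m: "m \<ge> N j" for m
    proof -
      have "ennreal ((norm (F m - abs_L2 g))\<^sup>2) = ennreal (\<integral>t. (f m t - g t)\<^sup>2 \<partial>unit_lebesgue)"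
        by (simp add: Ff abs_L2_diff f g_sq norm_abs_L2 diff_sq[OF m])
      also have "\<dots> = (\<integral>\<^sup>+ t. ennreal ((f m t - g t)\<^sup>2) \<partial>unit_lebesgue)"
        by (rule nn_integral_eq_integral[symmetric]) (use diff_sq[OF m] in \<open>auto simp: sq_int_def\<close>)
      also have "\<dots> \<le> ennreal (((1/2)^j)\<^sup>2)" by (rule key[OF m])
      finally have "(norm (F m - abs_L2 g))\<^sup>2 \<le> ((1/2)^j)\<^sup>2" by (simp add: ennreal_le_iff)
      then have "norm (F m - abs_L2 g) \<le> (1/2)^j" by (rule power2_le_imp_le) simp
      with j show ?thesis by simp
    qed
    then show "\<exists>n0. \<forall>m\<ge>n0. norm (F m - abs_L2 g) < \<epsilon>" by blast
  qed
  then show "convergent F" by (auto simp: convergent_def)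
qed

instance L2 :: banach ..

lemma abs_L2_sum:
  assumes "finite I" "\<And>i. sq_int (g i)"
  shows "sq_int (\<lambda>t. \<Sum>i\<in>I. g i t) \<and> abs_L2 (\<lambda>t. \<Sum>i\<in>I. g i t) = (\<Sum>i\<in>I. abs_L2 (g i))"
  using assms(1)
proof (induction I rule: finite_induct)
  case empty
  then show ?case by (simp add: sq_int_const zero_L2_def)
next
  case (insert i I)
  have sum: "(\<lambda>t. \<Sum>j\<in>insert i I. g j t) = (\<lambda>t. g i t + (\<Sum>j\<in>I. g j t))"
    using insert.hyps by simp
  have "abs_L2 (\<lambda>t. g i t + (\<Sum>j\<in>I. g j t)) = abs_L2 (g i) + abs_L2 (\<lambda>t. \<Sum>j\<in>I. g j t)"
    using insert.IH assms(2) by (intro abs_L2_add[symmetric]) auto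
  then show ?case
    unfolding sum using insert sq_int_add[OF assms(2)[of i] insert.IH[THEN conjunct1]] by simp
qed

lemma L2_countable_dense: "\<exists>D :: L2 set. countable D \<and> closure D = UNIV"
proof -
  obtain B :: "real set set" where B: "countable B" "topological_basis B"
    using ex_countable_basis by blast
  define G where "G = Inter ` {F. finite F \<and> F \<subseteq> B}"
  have G_countable: "countable G"
    unfolding G_def by (intro countable_image countable_Collect_finite_subset B(1))
  have G_open: "open A" if "A \<in> G" for A
    using that B(2) by (auto simp: G_def topological_basis_open intro!: open_Inter)
  have B_G: "B \<subseteq> G"
    by (auto simp: G_def image_iff intro!: exI[of _ "{x}" for x])
  have G_stable: "Int_stable G"
  proof (rule Int_stableI)
    fix a b assume "a \<in> G" "b \<in> G"
    then obtain F F' where "a = \<Inter>F" "finite F" "F \<subseteq> B" "b = \<Inter>F'" "finite F'" "F' \<subseteq> B"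
      by (auto simp: G_def)
    then show "a \<inter> b \<in> G"
      unfolding G_def by (intro image_eqI[of _ _ "F \<union> F'"]) auto
  qed
  have borel_G: "sigma_sets UNIV G = sets borel"
  proof
    have "G \<subseteq> sets borel" using G_open by auto
    then show "sigma_sets UNIV G \<subseteq> sets borel"
      using sets.sigma_sets_subset[of G borel] by simp
    have "sets borel = sigma_sets UNIV B"
      by (subst borel_eq_countable_basis[OF B]) simp
    also have "\<dots> \<subseteq> sigma_sets UNIV G" by (rule sigma_sets_mono') (fact B_G)
    finally show "sets borel \<subseteq> sigma_sets UNIV G" .
  qed
  define V :: "real set \<Rightarrow> L2" where "V A = abs_L2 (indicator A)" for A
  define D where "D = (\<lambda>xs. \<Sum>(q, A)\<leftarrow>xs. real_of_rat q *\<^sub>R V A) ` lists (UNIV \<times> G)"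
  define K where "K = closure D"
  have D_countable: "countable D"
    unfolding D_def by (intro countable_image countable_lists countable_SIGMA G_countable) auto
  have D_add: "x + y \<in> D" if "x \<in> D" "y \<in> D" for x y
  proof -
    from that obtain xs ys where "xs \<in> lists (UNIV \<times> G)" "ys \<in> lists (UNIV \<times> G)"
      "x = (\<Sum>(q, A)\<leftarrow>xs. real_of_rat q *\<^sub>R V A)" "y = (\<Sum>(q, A)\<leftarrow>ys. real_of_rat q *\<^sub>R V A)"
      by (auto simp: D_def)
    then show ?thesis unfolding D_def by (intro image_eqI[of _ _ "xs @ ys"]) auto
  qed
  have D_scale: "real_of_rat q *\<^sub>R x \<in> D" if "x \<in> D" for x q
  proof -
    from that obtain xs where xs: "xs \<in> lists (UNIV \<times> G)"
      "x = (\<Sum>(q, A)\<leftarrow>xs. real_of_rat q *\<^sub>R V A)"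
      by (auto simp: D_def)
    have "real_of_rat q *\<^sub>R (\<Sum>(q, A)\<leftarrow>xs. real_of_rat q *\<^sub>R V A) =
        (\<Sum>(q, A)\<leftarrow>map (\<lambda>(p, A). (q * p, A)) xs. real_of_rat q *\<^sub>R V A)"
      by (induction xs) (auto simp: scaleR_add_right of_rat_mult)
    moreover have "map (\<lambda>(p, A). (q * p, A)) xs \<in> lists (UNIV \<times> G)"
      using xs(1) by (auto simp: lists_eq_set)
    ultimately show ?thesis unfolding D_def xs(2) by (intro image_eqI) auto
  qed
  have K_add: "x + y \<in> K" if xy: "x \<in> K" "y \<in> K" for x y
  proof -
    from xy obtain xs ys where "\<And>n. xs n \<in> D" "xs \<longlonglongrightarrow> x" "\<And>n. ys n \<in> D" "ys \<longlonglongrightarrow> y"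
      by (auto simp: K_def closure_sequential)
    then show ?thesis unfolding K_def closure_sequential
      by (intro exI[of _ "\<lambda>n. xs n + ys n"]) (auto intro: D_add tendsto_add)
  qed
  have K_scale: "c *\<^sub>R x \<in> K" if x: "x \<in> K" for x c
  proof -
    from x obtain xs where xs: "\<And>n. xs n \<in> D" "xs \<longlonglongrightarrow> x"
      by (auto simp: K_def closure_sequential)
    have "c \<in> closure \<rat>" by (simp add: Rats_closure_real)
    then obtain cs where cs: "\<And>n. cs n \<in> \<rat>" "cs \<longlonglongrightarrow> c"
      by (auto simp: closure_sequential)
    have "cs n *\<^sub>R xs n \<in> D" for n
      using cs(1)[of n] D_scale[OF xs(1)[of n]] by (auto elim!: Rats_cases)
    then show ?thesis unfolding K_def closure_sequential
      by (intro exI[of _ "\<lambda>n. cs n *\<^sub>R xs n"]) (auto intro: tendsto_scaleR cs xs)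
  qed
  have K_lim: "x \<in> K" if "\<And>n. xs n \<in> K" "xs \<longlonglongrightarrow> x" for xs x
    using closed_sequentially[of K xs x] that by (auto simp: K_def)
  have D_V: "V A \<in> D" if "A \<in> G" for A
    unfolding D_def by (rule image_eqI[of _ _ "[(1, A)]"]) (use that in auto)
  then have K_V: "V A \<in> K" if "A \<in> G" for A
    using that closure_subset[of D] by (auto simp: K_def)
  have K_zero: "0 \<in> K"
    unfolding K_def D_def by (rule subsetD[OF closure_subset], rule image_eqI[of _ _ "[]"]) auto
  have K_sum: "(\<Sum>i\<in>I. x i) \<in> K" if "\<And>i. i \<in> I \<Longrightarrow> x i \<in> K" for x and I :: "'i set"
    using that by (induction I rule: infinite_finite_induct) (auto intro: K_zero K_add)
  have borel_ev: "A \<inter> {0..1} \<in> sets unit_lebesgue" if "A \<in> sets borel" for A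
    using that by (auto simp: sets_restrict_space)
  have ind_sq: "sq_int (indicator A)" if "A \<in> sets borel" for A
  proof (rule sq_int_bound[OF sq_int_const[of 1]])
    show "indicator A \<in> borel_measurable unit_lebesgue"
      using that by (intro measurable_restrict_space1 measurable_completion) auto
  qed (auto simp: indicator_def)
  have UNIV_G: "UNIV \<in> G" unfolding G_def by (rule image_eqI[of _ _ "{}"]) auto
  have K_borel: "V A \<in> K" if "A \<in> sets borel" for A
  proof -
    have G_Pow: "G \<subseteq> Pow UNIV" by simp
    have "A \<in> sigma_sets UNIV G" using that borel_G by simp
    then show ?thesis
    proof (induction rule: sigma_sets_induct_disjoint
        [OF G_stable G_Pow, consumes 1, case_names basic empty compl union])
      case empty
      have "V {} = 0" by (simp add: V_def zero_L2_def indicator_def [abs_def])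
      then show ?case by (simp add: K_zero)
    next
      case (compl A)
      then have A: "A \<in> sets borel" by (simp add: borel_G)
      have "V UNIV + (- 1) *\<^sub>R V A = V UNIV - V A" by simp
      also have "\<dots> = V (UNIV - A)"
        unfolding V_def using A ind_sq[of A] ind_sq[of UNIV]
        by (subst abs_L2_diff) (auto simp: indicator_def intro!: arg_cong[of _ _ abs_L2])
      finally have "V (UNIV - A) = V UNIV + (- 1) *\<^sub>R V A" by simp
      then show ?case using compl K_V[OF UNIV_G] by (metis K_add K_scale)
    next
      case (union A)
      then have A: "\<And>i. A i \<in> sets borel" by (auto simp: borel_G)
      have part: "V (\<Union>i<n. A i) \<in> K" for n :: nat
      proof (induction n)
        case 0
        have "V {} = 0" by (simp add: V_def zero_L2_def indicator_def [abs_def])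
        then show ?case by (simp add: K_zero)
      next
        case (Suc n)
        have "A i \<inter> A n = {}" if "i < n" for i
          using disjoint_family_onD[OF union(1), of i n] that by simp
        then have disj: "t \<notin> A n" if "i < n" "t \<in> A i" for i t
          using that by blast
        have "V (\<Union>i<n. A i) + V (A n) =
            abs_L2 (\<lambda>t. indicator (\<Union>i<n. A i) t + indicator (A n) t)"
          unfolding V_def by (rule abs_L2_add) (use A in \<open>auto intro!: ind_sq\<close>)
        also have "(\<lambda>t. indicator (\<Union>i<n. A i) t + indicator (A n) t :: real) =
            indicator (\<Union>i<Suc n. A i)"
        proof
          fix t
          show "indicator (\<Union>i<n. A i) t + indicator (A n) t =
              (indicator (\<Union>i<Suc n. A i) t :: real)"
            by (cases "t \<in> A n"; cases "t \<in> (\<Union>i<n. A i)")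
              (auto simp: indicator_def lessThan_Suc dest: disj)
        qed
        finally have "V (\<Union>i<Suc n. A i) = V (\<Union>i<n. A i) + V (A n)" by (simp add: V_def)
        then show ?case using Suc union(3)[of n] by (simp add: K_add)
      qed
      have "(\<lambda>n. V (\<Union>i<n. A i)) \<longlonglongrightarrow> V (\<Union>i. A i)"
        unfolding V_def
      proof (rule abs_L2_tendsto_dominated[where w = "\<lambda>_. 1"])
        show "AE t in unit_lebesgue.
            (\<lambda>n. indicator (\<Union>i<n. A i) t :: real) \<longlonglongrightarrow> indicator (\<Union>i. A i) t"
          by (intro always_eventually allI LIMSEQ_indicator_UN)
      qed (use A in \<open>auto intro: ind_sq sq_int_const simp: indicator_def\<close>)
      from K_lim[OF _ this] show ?case using part by simp
    qed (auto intro: K_V)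
  qed
  have K_ev: "V A \<in> K" if A: "A \<in> sets unit_lebesgue" for A
  proof -
    have "A \<in> sets lebesgue" using A by (auto simp: sets_restrict_space)
    then obtain S N N' where S: "A = S \<union> N" "N \<subseteq> N'" "N' \<in> null_sets lborel" "S \<in> sets lborel"
      by (rule sets_completionE)
    have N': "AE t in unit_lebesgue. t \<notin> N'"
    proof (rule AE_restrict_space_iff[THEN iffD2])
      show "AE t in lebesgue. t \<in> {0..1} \<longrightarrow> t \<notin> N'"
        using AE_not_in[OF null_sets_completionI[OF S(3)]] by eventually_elim auto
    qed auto
    have "V A = V S"
      unfolding V_def
    proof (rule abs_L2_cong[OF sq_int_indicator[OF A]])
      show "AE t in unit_lebesgue. indicator A t = (indicator S t :: real)"
        using N' by eventually_elim (use S in \<open>auto simp: indicator_def\<close>)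
    qed (use S in \<open>auto intro: ind_sq\<close>)
    then show ?thesis using K_borel S by simp
  qed
  have "F \<in> K" for F
  proof -
    obtain f where f: "sq_int f" "F = abs_L2 f" by (rule abs_L2_cases)
    obtain s where s: "\<And>i. simple_function unit_lebesgue (s i)"
      "\<And>x. x \<in> {0..1} \<Longrightarrow> (\<lambda>i. s i x) \<longlonglongrightarrow> f x"
      "\<And>i x. x \<in> {0..1} \<Longrightarrow> \<bar>s i x\<bar> \<le> 2 * \<bar>f x\<bar>"
      using borel_measurable_implies_sequence_metric[OF sq_int_measurable[OF f(1)], of 0]
      by (simp add: Bex_def Ball_def) blast
    have ev: "s i -` {y} \<inter> {0..1} \<in> sets unit_lebesgue" for i y
      using simple_functionD(2)[OF s(1)[of i], of "{y}"] by simp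
    have s_sq: "sq_int (s i)" for i
    proof (rule sq_int_bound[OF sq_int_cmult[OF f(1), of 2]])
      show "AE t in unit_lebesgue. \<bar>s i t\<bar> \<le> \<bar>2 * f t\<bar>"
        using s(3) by (auto intro!: AE_I2 simp: abs_mult)
    qed (intro borel_measurable_simple_function s)
    have s_K: "abs_L2 (s i) \<in> K" for i
    proof -
      let ?Y = "s i ` {0..1}" and ?g = "\<lambda>y t. y * indicator (s i -` {y} \<inter> {0..1}) t"
      have fin: "finite ?Y" using simple_functionD(1)[OF s(1)[of i]] by simp
      have g_sq: "sq_int (?g y)" for y by (intro sq_int_cmult sq_int_indicator ev)
      have g_V: "abs_L2 (?g y) = y *\<^sub>R V (s i -` {y} \<inter> {0..1})" for y
        unfolding V_def by (rule abs_L2_scaleR[symmetric]) (rule sq_int_indicator[OF ev])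
      have sum: "sq_int (\<lambda>t. \<Sum>y\<in>?Y. ?g y t)"
        "abs_L2 (\<lambda>t. \<Sum>y\<in>?Y. ?g y t) = (\<Sum>y\<in>?Y. y *\<^sub>R V (s i -` {y} \<inter> {0..1}))"
        using abs_L2_sum[of ?Y ?g, OF fin g_sq] unfolding g_V by (rule conjunct1, rule conjunct2)
      have eq: "s i t = (\<Sum>y\<in>?Y. ?g y t)" if t: "t \<in> {0..1}" for t
      proof -
        have "(\<Sum>y\<in>?Y. ?g y t) = (\<Sum>y\<in>?Y. if y = s i t then y else 0)"
          using t by (intro sum.cong) (auto simp: indicator_def)
        also have "\<dots> = s i t" using fin t by simp
        finally show ?thesis by simp
      qed
      have "abs_L2 (s i) = abs_L2 (\<lambda>t. \<Sum>y\<in>?Y. ?g y t)"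
        by (rule abs_L2_cong[OF s_sq sum(1)], rule AE_I2, rule eq) (simp only: space_lebesgue_on)
      also have "\<dots> \<in> K"
        unfolding sum(2) by (intro K_sum K_scale K_ev ev)
      finally show ?thesis .
    qed
    have "(\<lambda>i. abs_L2 (s i)) \<longlonglongrightarrow> abs_L2 f"
    proof (rule abs_L2_tendsto_dominated[OF s_sq f(1) sq_int_cmult[OF f(1), of 3]])
      show "AE t in unit_lebesgue. (\<lambda>i. s i t) \<longlonglongrightarrow> f t" using s(2) by (intro AE_I2) simp
      show "AE t in unit_lebesgue. \<bar>s i t - f t\<bar> \<le> \<bar>3 * f t\<bar>" for i
      proof (rule AE_I2)
        fix t assume "t \<in> space unit_lebesgue"
        then have "\<bar>s i t\<bar> \<le> 2 * \<bar>f t\<bar>" using s(3) by simp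
        then show "\<bar>s i t - f t\<bar> \<le> \<bar>3 * f t\<bar>" by linarith
      qed
    qed
    from K_lim[OF _ this] show ?thesis using s_K f(2) by simp
  qed
  then show ?thesis using D_countable by (auto simp: K_def)
qed

instance L2 :: second_countable_topology
proof
  obtain D :: "L2 set" where D: "countable D" "closure D = UNIV"
    using L2_countable_dense by blast
  define B where "B = (\<lambda>(x, q). ball x (real_of_rat q)) ` (D \<times> UNIV)"
  have "topological_basis B"
  proof (rule topological_basisI)
    show "open U" if "U \<in> B" for U using that by (auto simp: B_def)
    fix U :: "L2 set" and x assume "open U" "x \<in> U"
    then obtain \<epsilon> where \<epsilon>: "\<epsilon> > 0" "ball x \<epsilon> \<subseteq> U" by (auto simp: open_contains_ball)
    then obtain q where q: "0 < real_of_rat q" "real_of_rat q < \<epsilon> / 2"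
      using of_rat_dense[of 0 "\<epsilon> / 2"] by auto
    have "x \<in> closure D" using D by simp
    then obtain y where y: "y \<in> D" "dist y x < real_of_rat q"
      using q(1) unfolding closure_approachable by blast
    have "ball y (real_of_rat q) \<subseteq> ball x \<epsilon>"
    proof
      fix z assume "z \<in> ball y (real_of_rat q)"
      then have "dist y z < real_of_rat q" by simp
      then show "z \<in> ball x \<epsilon>"
        using y q dist_triangle[of x z y] by (simp add: dist_commute)
    qed
    then show "\<exists>W\<in>B. x \<in> W \<and> W \<subseteq> U"
      using y \<epsilon> by (intro bexI[of _ "ball y (real_of_rat q)"]) (auto simp: B_def)
  qed
  moreover have "countable B"
    unfolding B_def by (intro countable_image countable_SIGMA D) auto
  ultimately show "\<exists>B::L2 set set. countable B \<and> open = generate_topology B"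
    using topological_basis_imp_subbasis by blast
qed

instance L2 :: polish_space ..

definition rank_one :: "L2 \<Rightarrow> L2 \<Rightarrow> L2" where
  "rank_one u f = (u \<bullet> f) *\<^sub>R u"

text \<open>The expectation \<open>E[X \<otimes> X]\<close> is taken in the strong sense: pointwise in \<open>f\<close>, as a Bochner
  integral in \<^typ>\<open>L2\<close>.\<close>

definition cov_op :: "'w measure \<Rightarrow> ('w \<Rightarrow> L2) \<Rightarrow> L2 \<Rightarrow> L2" where
  "cov_op M X f = (\<integral>\<omega>. rank_one (X \<omega>) f \<partial>M)"

definition orthonormal_basis :: "(nat \<Rightarrow> L2) \<Rightarrow> bool" where
  "orthonormal_basis e \<longleftrightarrow>
     (\<forall>i j. e i \<bullet> e j = (if i = j then 1 else 0)) \<and> closure (span (range e)) = UNIV"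

text \<open>A self-adjoint operator \<open>T \<ge> 0\<close> equals \<open>|T|\<close>, so it is trace-class iff
  \<open>\<Sum>j. \<langle>T b\<^sub>j, b\<^sub>j\<rangle>\<close> converges for some (equivalently, every) orthonormal basis \<open>b\<close>.\<close>

definition pos_def_trace_class :: "(L2 \<Rightarrow> L2) \<Rightarrow> bool" where
  "pos_def_trace_class T \<longleftrightarrow>
     bounded_linear T \<and> (\<forall>f g. T f \<bullet> g = f \<bullet> T g) \<and> (\<forall>f. f \<noteq> 0 \<longrightarrow> T f \<bullet> f > 0) \<and>
     (\<exists>b. orthonormal_basis b \<and> summable (\<lambda>j. T (b j) \<bullet> b j))"

text \<open>Eigenvalues and eigenvectors are indexed from 0.\<close>

definition spectral_decomposition :: "(L2 \<Rightarrow> L2) \<Rightarrow> (nat \<Rightarrow> real) \<Rightarrow> (nat \<Rightarrow> L2) \<Rightarrow> bool" where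
  "spectral_decomposition T s e \<longleftrightarrow>
     orthonormal_basis e \<and> decseq s \<and> (\<forall>j. s j > 0) \<and>
     (\<forall>f. (\<lambda>j. s j *\<^sub>R rank_one (e j) f) sums T f)"

text \<open>\<open>\<phi>(T) f\<close> for an operator \<open>T\<close> with spectral decomposition \<open>(s, e)\<close> and \<open>\<phi>\<close> bounded on the
  eigenvalues.\<close>

definition op_fun :: "(nat \<Rightarrow> real) \<Rightarrow> (nat \<Rightarrow> L2) \<Rightarrow> (real \<Rightarrow> real) \<Rightarrow> L2 \<Rightarrow> L2" where
  "op_fun s e \<phi> f = (\<Sum>j. \<phi> (s j) *\<^sub>R rank_one (e j) f)"

text \<open>\<open>tr((\<Gamma> + l)\<^sup>-\<^sup>1 \<Gamma>)\<close>, for \<open>\<Gamma>\<close> with eigenvalues \<open>s\<close>\<close>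

definition eff_dim :: "(nat \<Rightarrow> real) \<Rightarrow> real \<Rightarrow> real" where
  "eff_dim s l = (\<Sum>j. s j / (s j + l))"

definition huber :: "real \<Rightarrow> real \<Rightarrow> real" where
  "huber \<gamma> u = (if \<bar>u\<bar> \<le> \<gamma> then u\<^sup>2 / 2 else \<gamma> * \<bar>u\<bar> - \<gamma>\<^sup>2 / 2)"

text \<open>A sample of size \<open>n\<close> consists of the indices \<open>i < n\<close>.\<close>

definition huber_objective ::
    "nat \<Rightarrow> real \<Rightarrow> real \<Rightarrow> (nat \<Rightarrow> L2) \<Rightarrow> (nat \<Rightarrow> real) \<Rightarrow> L2 \<Rightarrow> real" where
  "huber_objective n \<gamma> l x y f =
     (1 / real n) * (\<Sum>i<n. huber \<gamma> (y i - x i \<bullet> f)) + l * (norm f)\<^sup>2"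

definition huber_estimator ::
    "nat \<Rightarrow> real \<Rightarrow> real \<Rightarrow> (nat \<Rightarrow> L2) \<Rightarrow> (nat \<Rightarrow> real) \<Rightarrow> L2 \<Rightarrow> bool" where
  "huber_estimator n \<gamma> l x y f \<longleftrightarrow> is_arg_min (huber_objective n \<gamma> l x y) (\<lambda>_. True) f"

definition huber_rate ::
    "real \<Rightarrow> real \<Rightarrow> real \<Rightarrow> (nat \<Rightarrow> real) \<Rightarrow> nat \<Rightarrow> real \<Rightarrow> real \<Rightarrow> real" where
  "huber_rate r \<kappa> v s n l \<gamma> =
     (let \<kappa>' = min \<kappa> 1; r' = min r (1/2)
      in sqrt (v * \<gamma> powr (1 - \<kappa>') * (eff_dim s l / real n)) + l powr (r' + 1/2)
         + v * \<gamma> powr (- \<kappa>'))"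

definition iid_copies ::
    "'w measure \<Rightarrow> ('w \<Rightarrow> 'b::topological_space) \<Rightarrow> (nat \<Rightarrow> 'w \<Rightarrow> 'b) \<Rightarrow> bool" where
  "iid_copies M Z Zs \<longleftrightarrow>
     Z \<in> borel_measurable M \<and> prob_space.indep_vars M (\<lambda>_. borel) Zs UNIV \<and>
     (\<forall>i. distr M borel (Zs i) = distr M borel Z)"

definition moment_condition :: "'w measure \<Rightarrow> ('w \<Rightarrow> L2) \<Rightarrow> bool" where
  "moment_condition M X \<longleftrightarrow>
     integrable M (\<lambda>\<omega>. (norm (X \<omega>)) ^ 4) \<and> pos_def_trace_class (cov_op M X) \<and>
     (\<exists>C>0. \<forall>f. root 4 (\<integral>\<omega>. (X \<omega> \<bullet> f) ^ 4 \<partial>M) \<le> C * sqrt (\<integral>\<omega>. (X \<omega> \<bullet> f)\<^sup>2 \<partial>M))"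

definition source_condition :: "(nat \<Rightarrow> real) \<Rightarrow> (nat \<Rightarrow> L2) \<Rightarrow> real \<Rightarrow> L2 \<Rightarrow> bool" where
  "source_condition s e r f \<longleftrightarrow>
     r \<ge> 0 \<and> (\<exists>C>0. \<exists>g. norm g \<le> C \<and> f = op_fun s e (\<lambda>x. x powr r) g)"

definition eff_dim_condition :: "(nat \<Rightarrow> real) \<Rightarrow> bool" where
  "eff_dim_condition s \<longleftrightarrow>
     (\<exists>\<beta>\<in>{0<..1}. \<exists>C>0. \<forall>l>0. eff_dim s l \<le> C * l powr (- \<beta>))"

definition gen_subalgebra :: "'w measure \<Rightarrow> ('w \<Rightarrow> L2) \<Rightarrow> 'w measure" where
  "gen_subalgebra M X = vimage_algebra (space M) X borel"

text \<open>\<open>E[|\<epsilon>|\<^sup>q | X] \<le> v\<close> almost surely. The nonnegative conditional expectation makes the bound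
  entail integrability of \<open>|\<epsilon>|\<^sup>q\<close>.\<close>

definition cond_moment_le :: "'w measure \<Rightarrow> ('w \<Rightarrow> L2) \<Rightarrow> ('w \<Rightarrow> real) \<Rightarrow> real \<Rightarrow> real \<Rightarrow> bool" where
  "cond_moment_le M X \<epsilon> q v \<longleftrightarrow>
     (AE \<omega> in M. nn_cond_exp M (gen_subalgebra M X) (\<lambda>\<omega>. ennreal (\<bar>\<epsilon> \<omega>\<bar> powr q)) \<omega> \<le> ennreal v)"

definition noise_condition :: "'w measure \<Rightarrow> ('w \<Rightarrow> L2) \<Rightarrow> ('w \<Rightarrow> real) \<Rightarrow> real \<Rightarrow> real \<Rightarrow> bool" where
  "noise_condition M X \<epsilon> \<kappa> v \<longleftrightarrow>
     \<kappa> > 0 \<and> v > 0 \<and>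
     (AE \<omega> in M. real_cond_exp M (gen_subalgebra M X) \<epsilon> \<omega> = 0) \<and> cond_moment_le M X \<epsilon> (1 + \<kappa>) v"

text \<open>The moment generating function is a nonnegative integral, so that the bound entails its
  finiteness.\<close>

definition subgaussian_scores ::
    "'w measure \<Rightarrow> ('w \<Rightarrow> L2) \<Rightarrow> (nat \<Rightarrow> real) \<Rightarrow> (nat \<Rightarrow> L2) \<Rightarrow> bool" where
  "subgaussian_scores M X s e \<longleftrightarrow>
     (\<forall>\<omega>\<in>space M. (\<lambda>j. (X \<omega> \<bullet> e j) *\<^sub>R e j) sums X \<omega>) \<and>
     prob_space.indep_vars M (\<lambda>_. borel) (\<lambda>j \<omega>. X \<omega> \<bullet> e j) UNIV \<and>
     (\<exists>C>0. \<forall>j t. (\<integral>\<^sup>+ \<omega>. ennreal (exp (t * (X \<omega> \<bullet> e j) / sqrt (s j))) \<partial>M)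
        \<le> ennreal (exp (C * t\<^sup>2)))"

text \<open>\<open>Z\<^sub>n = O\<^sub>p(a\<^sub>n)\<close>, over sample sizes \<open>n \<ge> 1\<close>; measurability of the \<open>Z\<^sub>n\<close> is part of the
  notion.\<close>

definition bigO_prob :: "'w measure \<Rightarrow> (nat \<Rightarrow> 'w \<Rightarrow> real) \<Rightarrow> (nat \<Rightarrow> real) \<Rightarrow> bool" where
  "bigO_prob M Z a \<longleftrightarrow>
     (\<forall>n\<ge>1. Z n \<in> borel_measurable M) \<and>
     (\<forall>\<delta>\<in>{0<..<1}. \<exists>C>0. \<forall>n\<ge>1. measure M {\<omega> \<in> space M. \<bar>Z n \<omega>\<bar> > C * a n} < \<delta>)"

end

theory Submission
  imports Defs
begin

text \<open>In the whitened coordinates \<open>z\<^sub>i = (\<Gamma> + \<lambda>)\<^sup>-\<^sup>1\<^sup>/\<^sup>2 X\<^sub>i\<close>, convexity reduces the theorem to two facts: the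
  penalised empirical loss has curvature bounded below, uniformly over the sphere of radius \<open>R\<close>
  around \<open>f\<^sub>0\<close>, as long as \<open>R\<close> is at most a fixed multiple of \<open>\<gamma>\<close>, and the whitened gradient at
  \<open>f\<^sub>0\<close> is of order \<open>\<omega>\<^sub>n\<close>. Its deterministic part, the regularisation and Huber biases, is controlled
  by the condition \<open>\<gamma> \<ge> C\<^sub>1 \<omega>\<^sub>n\<close>; its random part is \<open>o(\<gamma>)\<close> because \<open>v \<le> \<gamma> powr (1 + min \<kappa> 1)\<close> and
  \<open>\<N>(\<lambda>) / n \<rightarrow> 0\<close>, so \<open>C\<^sub>1\<close> need not depend on the probability level.

  For the curvature one only needs \<open>\<N>(\<lambda>)\<^sup>2 / n \<rightarrow> 0\<close>, which follows from
  \<open>\<N>(\<lambda>) \<le> tr \<Gamma> / \<lambda>\<close>: the whitened Gram operator then concentrates in Hilbert-Schmidt norm, and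
  Hoeffding's inequality for truncated squares is applied on a net of \<open>exp (O(\<N>(\<lambda>)\<^sup>2))\<close> points
  that lives on the \<open>O(\<N>(\<lambda>))\<close> leading eigendirections. The stochastic terms are bounded by
  Chebyshev's inequality in part (i) and by Pinelis' exponential inequality in Hilbert space in part
  (ii).\<close>

section \<open>Orthonormal expansions and the tensor square\<close>

text \<open>Huber's loss is quadratic only while residuals stay within \<gamma>. A move h therefore
  earns curvature at an observation only through a capped value of \<open>X i \<bullet> h\<close>,
  and only where the noise is at most \<gamma> / 2. Capped squares are not linear in the Gram
  operator, so its concentration cannot give the lower bound; Hoeffding gives it at finitely many
  directions, and the Gram operator supplies the upper bound that makes passing to a nearby
  direction cheap. Directions that the covariance sees weakly need no data: in whitened coordinates
  the penalty contributes exactly the complement 1 - Q of the quadratic form Q of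
  \<open>(\<Gamma> + \<lambda>)\<^sup>-\<^sup>1 \<Gamma>\<close>. Convexity is used by contraction.
  If the estimator is farther than R from f0 in the whitened norm, the point of the segment at
  distance exactly R still has objective at most that of f0, so the cap can be taken proportional to
  R. It must stay below \<gamma> / 2, and with R of order \<omega>_n this is what the lower bound on
  \<gamma> provides.\<close>

lemma orthonormal_basisD:
  assumes "orthonormal_basis e"
  shows "e i \<bullet> e j = (if i = j then 1 else 0)" and "closure (span (range e)) = UNIV"
  using assms by (auto simp: orthonormal_basis_def)

lemma orthonormal_partial_sum_inner:
  assumes "orthonormal_basis e" "finite J"
  shows "(\<Sum>j\<in>J. c j *\<^sub>R e j) \<bullet> e i = (if i \<in> J then c i else 0)"
proof -
  have "(\<Sum>j\<in>J. c j *\<^sub>R e j) \<bullet> e i = (\<Sum>j\<in>J. if j = i then c j else 0)"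
    by (auto simp: inner_sum_left orthonormal_basisD[OF assms(1)] intro!: sum.cong)
  also have "\<dots> = (if i \<in> J then c i else 0)" using assms(2) by simp
  finally show ?thesis .
qed

lemma orthonormal_norm_partial_sum:
  assumes "orthonormal_basis e" "finite J"
  shows "(norm (\<Sum>j\<in>J. c j *\<^sub>R e j))\<^sup>2 = (\<Sum>j\<in>J. (c j)\<^sup>2)"
proof -
  have "(norm (\<Sum>j\<in>J. c j *\<^sub>R e j))\<^sup>2 = (\<Sum>i\<in>J. c i * ((\<Sum>j\<in>J. c j *\<^sub>R e j) \<bullet> e i))"
    unfolding power2_norm_eq_inner inner_sum_right by simp
  also have "\<dots> = (\<Sum>j\<in>J. (c j)\<^sup>2)"
    by (intro sum.cong refl) (simp add: orthonormal_partial_sum_inner[OF assms] power2_eq_square)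
  finally show ?thesis .
qed

text \<open>Pairing x with its projection p gives the squared norm of p, and Cauchy-Schwarz then
  cancels one factor \<open>norm p\<close>.\<close>

lemma bessel_ineq:
  assumes "orthonormal_basis e"
  shows "(norm (\<Sum>j<n. (x \<bullet> e j) *\<^sub>R e j)) \<le> norm x"
proof -
  define p where "p = (\<Sum>j<n. (x \<bullet> e j) *\<^sub>R e j)"
  have "x \<bullet> p = (\<Sum>j<n. (x \<bullet> e j)\<^sup>2)"
    by (simp add: p_def inner_sum_right power2_eq_square)
  also have "\<dots> = (norm p)\<^sup>2"
    unfolding p_def by (simp add: orthonormal_norm_partial_sum[OF assms])
  finally have "norm p * norm p \<le> norm x * norm p"
    using norm_cauchy_schwarz[of x p] by (simp add: power2_eq_square)
  then show ?thesis unfolding p_def[symmetric]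
    by (cases "norm p = 0") (auto simp: mult_le_cancel_right)
qed

text \<open>The vectors that are limits of their own expansion form a subspace containing the basis.
  Density extends this to every x because the partial sums are contractions: three errors of size r
  / 3 suffice.\<close>

lemma orthonormal_expansion:
  assumes "orthonormal_basis e"
  shows "(\<lambda>j. (x \<bullet> e j) *\<^sub>R e j) sums x"
proof -
  define P where "P n x = (\<Sum>j<n. (x \<bullet> e j) *\<^sub>R e j)" for n x
  have P_diff: "P n (x - y) = P n x - P n y" for n x y
    by (simp add: P_def inner_diff_left scaleR_diff_left sum_subtractf)
  define V where "V = {x. (\<lambda>n. P n x) \<longlonglongrightarrow> x}"
  have "subspace V"
  proof (rule subspaceI)
    show "0 \<in> V" by (simp add: V_def P_def)
    fix x y assume "x \<in> V" "y \<in> V"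
    then have "(\<lambda>n. P n x + P n y) \<longlonglongrightarrow> x + y" by (auto simp: V_def intro: tendsto_add)
    then show "x + y \<in> V" by (simp add: V_def P_def inner_add_left scaleR_add_left sum.distrib)
  next
    fix c x assume "x \<in> V"
    then have "(\<lambda>n. c *\<^sub>R P n x) \<longlonglongrightarrow> c *\<^sub>R x" by (auto simp: V_def intro: tendsto_intros)
    then show "c *\<^sub>R x \<in> V" by (simp add: V_def P_def scaleR_sum_right)
  qed
  moreover have "range e \<subseteq> V"
  proof clarify
    fix i
    have "P n (e i) = e i" if "n > i" for n
    proof -
      have "P n (e i) = (\<Sum>j<n. if j = i then e i else 0)"
        unfolding P_def by (intro sum.cong) (auto simp: orthonormal_basisD[OF assms])
      then show ?thesis using that by simp
    qed
    then have "\<forall>\<^sub>F n in sequentially. P n (e i) = e i"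
      using eventually_gt_at_top[of i] by (rule eventually_mono[rotated])
    then show "e i \<in> V" by (simp add: V_def tendsto_eventually)
  qed
  ultimately have sp: "span (range e) \<subseteq> V" by (simp add: span_minimal)
  have "(\<lambda>n. P n x) \<longlonglongrightarrow> x"
  proof (rule LIMSEQ_I)
    fix r :: real assume r: "r > 0"
    have "x \<in> closure (span (range e))" using orthonormal_basisD[OF assms] by simp
    then obtain y where y: "y \<in> span (range e)" "dist y x < r / 3"
      using r unfolding closure_approachable by (metis zero_less_divide_iff zero_less_numeral)
    then have "(\<lambda>n. P n y) \<longlonglongrightarrow> y" using sp by (auto simp: V_def)
    then obtain n0 where n0: "\<And>n. n \<ge> n0 \<Longrightarrow> norm (P n y - y) < r / 3"
      using LIMSEQ_D[of "\<lambda>n. P n y" y "r/3"] r by auto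
    have "norm (P n x - x) < r" if "n \<ge> n0" for n
    proof -
      have "P n x - x = P n (x - y) + (P n y - y) + (y - x)" by (simp add: P_diff)
      then have "norm (P n x - x) \<le> norm (P n (x - y)) + norm (P n y - y) + norm (y - x)"
        by (metis norm_triangle_mono order_refl)
      moreover have "norm (P n (x - y)) \<le> norm (y - x)"
        unfolding P_def using bessel_ineq[OF assms] by (metis norm_minus_commute)
      ultimately show ?thesis using n0[OF that] y(2) by (simp add: dist_norm)
    qed
    then show "\<exists>no. \<forall>n\<ge>no. norm (P n x - x) < r" by blast
  qed
  then show ?thesis by (simp add: sums_def P_def)
qed

lemma parseval_inner:
  assumes "orthonormal_basis e"
  shows "(\<lambda>j. (x \<bullet> e j) * (y \<bullet> e j)) sums (x \<bullet> y)"
  using bounded_linear.sums[OF bounded_linear_inner_left[of y] orthonormal_expansion[OF assms, of x]]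
  by (simp add: inner_commute[of y])

lemma parseval:
  assumes "orthonormal_basis e"
  shows "(\<lambda>j. (x \<bullet> e j)\<^sup>2) sums (norm x)\<^sup>2"
  using parseval_inner[OF assms, of x x] by (simp add: power2_eq_square power2_norm_eq_inner flip: power2_eq_square)

lemma orthonormal_eqI:
  assumes "orthonormal_basis e" "\<And>j. x \<bullet> e j = y \<bullet> e j"
  shows "x = y"
  using sums_unique2[OF orthonormal_expansion[OF assms(1), of x]]
    orthonormal_expansion[OF assms(1), of y] assms(2) by simp

lemma orthonormal_summable:
  assumes e: "orthonormal_basis e" and c: "summable (\<lambda>j. (c j)\<^sup>2)"
  shows "summable (\<lambda>j. c j *\<^sub>R e j)" and "(\<Sum>j. c j *\<^sub>R e j) \<bullet> e i = c i"
proof -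
  show sm: "summable (\<lambda>j. c j *\<^sub>R e j)"
  proof (rule summable_Cauchy[THEN iffD2], intro allI impI)
    fix r :: real assume r: "r > 0"
    then have "r\<^sup>2 > 0" by simp
    with c obtain N where N: "\<And>m n. m \<ge> N \<Longrightarrow> norm (\<Sum>j=m..<n. (c j)\<^sup>2) < r\<^sup>2"
      unfolding summable_Cauchy by blast
    have "norm (\<Sum>j=m..<n. c j *\<^sub>R e j) < r" if "m \<ge> N" for m n
    proof -
      have "(norm (\<Sum>j=m..<n. c j *\<^sub>R e j))\<^sup>2 < r\<^sup>2"
        using N[OF that, of n] by (simp add: orthonormal_norm_partial_sum[OF e] sum_nonneg)
      then show ?thesis using r by (simp add: power2_less_imp_less)
    qed
    then show "\<exists>N. \<forall>m\<ge>N. \<forall>n. norm (\<Sum>j=m..<n. c j *\<^sub>R e j) < r" by blast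
  qed
  have "(\<lambda>j. (c j *\<^sub>R e j) \<bullet> e i) sums ((\<Sum>j. c j *\<^sub>R e j) \<bullet> e i)"
    by (intro bounded_linear.sums[OF bounded_linear_inner_left] summable_sums sm)
  moreover have "(\<lambda>j. (c j *\<^sub>R e j) \<bullet> e i) = (\<lambda>j. if j = i then c j else 0)"
    by (auto simp: orthonormal_basisD[OF e])
  ultimately show "(\<Sum>j. c j *\<^sub>R e j) \<bullet> e i = c i"
    using sums_If_finite[of "\<lambda>j. j = i" c] sums_unique2 by fastforce
qed

text \<open>Operator functions are handled through their coordinates. A multiplier bounded on the
  eigenvalues keeps the coefficients square summable, so the defining series converges and may be
  paired with a basis vector term by term.\<close>

lemma op_fun_coord:
  assumes e: "orthonormal_basis e" and K: "\<And>j. \<bar>\<phi> (s j)\<bar> \<le> K"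
  shows "op_fun s e \<phi> f \<bullet> e i = \<phi> (s i) * (f \<bullet> e i)"
proof -
  have "summable (\<lambda>j. (\<phi> (s j) * (f \<bullet> e j))\<^sup>2)"
  proof (rule summable_comparison_test')
    show "summable (\<lambda>j. K\<^sup>2 * (f \<bullet> e j)\<^sup>2)"
      using parseval[OF e, of f] by (intro summable_mult) (auto simp: sums_iff)
    have "(\<phi> (s j))\<^sup>2 \<le> K\<^sup>2" for j
      using K[of j] by (simp add: abs_le_square_iff[symmetric])
    then show "norm ((\<phi> (s j) * (f \<bullet> e j))\<^sup>2) \<le> K\<^sup>2 * (f \<bullet> e j)\<^sup>2" for j
      by (simp add: power_mult_distrib mult_right_mono)
  qed
  from orthonormal_summable(2)[OF e this, of i] show ?thesis
    by (simp add: op_fun_def rank_one_def inner_commute)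
qed

lemma op_fun_linear_bounded:
  assumes e: "orthonormal_basis e" and K: "\<And>j. \<bar>\<phi> (s j)\<bar> \<le> K"
  shows "op_fun s e \<phi> (f + g) = op_fun s e \<phi> f + op_fun s e \<phi> g"
    and "op_fun s e \<phi> (f - g) = op_fun s e \<phi> f - op_fun s e \<phi> g"
    and "op_fun s e \<phi> (c *\<^sub>R f) = c *\<^sub>R op_fun s e \<phi> f"
    and "op_fun s e \<phi> f \<bullet> g = f \<bullet> op_fun s e \<phi> g"
    and "norm (op_fun s e \<phi> f) \<le> K * norm f"
proof -
  note co = op_fun_coord[where \<phi> = \<phi> and s = s, OF e K]
  show "op_fun s e \<phi> (f + g) = op_fun s e \<phi> f + op_fun s e \<phi> g"
    "op_fun s e \<phi> (f - g) = op_fun s e \<phi> f - op_fun s e \<phi> g"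
    "op_fun s e \<phi> (c *\<^sub>R f) = c *\<^sub>R op_fun s e \<phi> f"
    by (rule orthonormal_eqI[OF e], simp add: co inner_add_left inner_diff_left algebra_simps)+
  show "op_fun s e \<phi> f \<bullet> g = f \<bullet> op_fun s e \<phi> g"
    using parseval_inner[OF e, of "op_fun s e \<phi> f" g] parseval_inner[OF e, of f "op_fun s e \<phi> g"]
    by (simp add: co sums_unique2 mult.left_commute mult.assoc)
  have "K \<ge> 0" using K[of 0] by linarith
  have "(norm (op_fun s e \<phi> f))\<^sup>2 \<le> (K * norm f)\<^sup>2"
  proof (rule sums_le)
    show "(\<lambda>j. (op_fun s e \<phi> f \<bullet> e j)\<^sup>2) sums (norm (op_fun s e \<phi> f))\<^sup>2" by (rule parseval[OF e])
    show "(\<lambda>j. K\<^sup>2 * (f \<bullet> e j)\<^sup>2) sums (K * norm f)\<^sup>2"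
      unfolding power_mult_distrib by (intro sums_mult parseval[OF e])
    fix j
    have "(\<phi> (s j))\<^sup>2 \<le> K\<^sup>2"
      using K[of j] by (simp add: abs_le_square_iff[symmetric])
    then show "(op_fun s e \<phi> f \<bullet> e j)\<^sup>2 \<le> K\<^sup>2 * (f \<bullet> e j)\<^sup>2"
      by (simp add: co power_mult_distrib mult_right_mono)
  qed
  then show "norm (op_fun s e \<phi> f) \<le> K * norm f"
    by (rule power2_le_imp_le) (use \<open>K \<ge> 0\<close> in simp)
qed

text \<open>The tensor square of \<open>L\<^sup>2\<close> is realised inside \<open>L\<^sup>2\<close> itself by enumerating the pairs of basis
  indices; this makes Hilbert-Schmidt operators vectors of \<open>L\<^sup>2\<close>.\<close>

definition tens :: "(nat \<Rightarrow> L2) \<Rightarrow> L2 \<Rightarrow> L2" where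
  "tens e x = (\<Sum>m. (case prod_decode m of (i, j) \<Rightarrow> (x \<bullet> e i) * (x \<bullet> e j)) *\<^sub>R e m)"

text \<open>Absolute summability makes the double family unconditionally summable, so the bijection
  \<open>prod_decode\<close> may rearrange it into one series.\<close>

lemma sums_prod_decode:
  fixes a :: "nat \<Rightarrow> real"
  assumes a: "summable (\<lambda>i. \<bar>a i\<bar>)" and "a sums A"
  shows "(\<lambda>m. case prod_decode m of (i, j) \<Rightarrow> a i * a j) sums (A * A)"
proof -
  have h: "(a has_sum A) UNIV" using norm_summable_imp_has_sum[OF _ assms(2)] a by simp
  have ha: "((\<lambda>i. \<bar>a i\<bar>) has_sum (\<Sum>i. \<bar>a i\<bar>)) UNIV"
    using a by (intro norm_summable_imp_has_sum) (auto simp: summable_sums)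
  have "(\<lambda>(i, j). \<bar>a i\<bar> * \<bar>a j\<bar>) summable_on (UNIV \<times> UNIV)"
  proof (rule summable_on_SigmaI)
    show "((\<lambda>j. case (i, j) of (i, j) \<Rightarrow> \<bar>a i\<bar> * \<bar>a j\<bar>) has_sum \<bar>a i\<bar> * (\<Sum>i. \<bar>a i\<bar>)) UNIV" for i
      using has_sum_cmult_right[OF ha, of "\<bar>a i\<bar>"] by simp
    show "(\<lambda>i. \<bar>a i\<bar> * (\<Sum>i. \<bar>a i\<bar>)) summable_on UNIV"
      using has_sum_cmult_left[OF ha] summable_on_def by blast
  qed auto
  then have "Infinite_Sum.abs_summable_on (\<lambda>(i, j). a i * a j) (UNIV \<times> UNIV)"
    by (simp add: case_prod_unfold abs_mult)
  then have sm: "(\<lambda>(i, j). a i * a j) summable_on (UNIV \<times> UNIV)"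
    by (rule abs_summable_summable)
  have "((\<lambda>(i, j). a i * a j) has_sum (A * A)) (UNIV \<times> UNIV)"
  proof (rule has_sum_SigmaI[OF _ _ sm])
    show "((\<lambda>j. case (i, j) of (i, j) \<Rightarrow> a i * a j) has_sum a i * A) UNIV" for i
      using has_sum_cmult_right[OF h, of "a i"] by simp
    show "((\<lambda>i. a i * A) has_sum A * A) UNIV" by (rule has_sum_cmult_left[OF h])
  qed
  then have "((\<lambda>m. case prod_decode m of (i, j) \<Rightarrow> a i * a j) has_sum (A * A)) UNIV"
    using has_sum_reindex_bij_betw[OF bij_prod_decode, of "\<lambda>(i, j). a i * a j"] by simp
  then show ?thesis by (rule has_sum_imp_sums)
qed

lemma tens_coord:
  assumes e: "orthonormal_basis e"
  shows "tens e x \<bullet> e m = (case prod_decode m of (i, j) \<Rightarrow> (x \<bullet> e i) * (x \<bullet> e j))"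
    and "summable (\<lambda>m. (case prod_decode m of (i, j) \<Rightarrow> (x \<bullet> e i) * (x \<bullet> e j)) *\<^sub>R e m)"
proof -
  have "summable (\<lambda>m. case prod_decode m of (i, j) \<Rightarrow> (x \<bullet> e i)\<^sup>2 * (x \<bullet> e j)\<^sup>2)"
    using sums_prod_decode[OF _ parseval[OF e, of x]] parseval[OF e, of x] by (auto simp: sums_iff)
  then have sm: "summable (\<lambda>m. (case prod_decode m of (i, j) \<Rightarrow> (x \<bullet> e i) * (x \<bullet> e j))\<^sup>2)"
    by (simp add: case_prod_unfold power_mult_distrib)
  show "tens e x \<bullet> e m = (case prod_decode m of (i, j) \<Rightarrow> (x \<bullet> e i) * (x \<bullet> e j))"
    unfolding tens_def by (rule orthonormal_summable(2)[OF e sm])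
  show "summable (\<lambda>m. (case prod_decode m of (i, j) \<Rightarrow> (x \<bullet> e i) * (x \<bullet> e j)) *\<^sub>R e m)"
    by (rule orthonormal_summable(1)[OF e sm])
qed

text \<open>The coordinates of the two tensor squares multiply to \<open>a i * a j\<close>, where a
  lists the coordinate products of x and y; the double series is therefore the square of the series
  for \<open>x \<bullet> y\<close>. Through this identity a quadratic form in k becomes linear in
  \<open>tens e k\<close>.\<close>

lemma tens_inner:
  assumes e: "orthonormal_basis e"
  shows "tens e x \<bullet> tens e y = (x \<bullet> y)\<^sup>2"
proof -
  have "summable (\<lambda>i. \<bar>(x \<bullet> e i) * (y \<bullet> e i)\<bar>)"
  proof (rule summable_comparison_test')
    show "summable (\<lambda>i. (x \<bullet> e i)\<^sup>2 + (y \<bullet> e i)\<^sup>2)"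
      using parseval[OF e, of x] parseval[OF e, of y] by (intro summable_add) (auto simp: sums_iff)
    have "\<bar>a * b\<bar> \<le> a\<^sup>2 + b\<^sup>2" for a b :: real
      using sum_squares_bound[of "\<bar>a\<bar>" "\<bar>b\<bar>"] zero_le_power2[of a] zero_le_power2[of b]
      unfolding abs_mult by (simp add: mult.assoc) (smt (verit) mult_nonneg_nonneg abs_ge_zero)
    then show "norm \<bar>(x \<bullet> e i) * (y \<bullet> e i)\<bar> \<le> (x \<bullet> e i)\<^sup>2 + (y \<bullet> e i)\<^sup>2" for i by simp
  qed
  from sums_prod_decode[OF this parseval_inner[OF e]]
  have "(\<lambda>m. (tens e x \<bullet> e m) * (tens e y \<bullet> e m)) sums ((x \<bullet> y) * (x \<bullet> y))"
    by (simp add: tens_coord[OF e] case_prod_unfold algebra_simps)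
  then show ?thesis
    using parseval_inner[OF e, of "tens e x" "tens e y"] sums_unique2 by (auto simp: power2_eq_square)
qed

lemma norm_tens:
  assumes "orthonormal_basis e"
  shows "norm (tens e x) = (norm x)\<^sup>2"
  by (simp add: norm_eq_sqrt_inner tens_inner[OF assms])

lemma borel_measurable_tens:
  assumes "orthonormal_basis e"
  shows "tens e \<in> borel_measurable borel"
proof (rule borel_measurable_LIMSEQ_metric)
  show "(\<lambda>n. \<Sum>m<n. (case prod_decode m of (i, j) \<Rightarrow> (x \<bullet> e i) * (x \<bullet> e j)) *\<^sub>R e m) \<longlonglongrightarrow> tens e x" for x
    unfolding tens_def by (intro summable_LIMSEQ tens_coord[OF assms])
  show "(\<lambda>x. \<Sum>m<n. (case prod_decode m of (i, j) \<Rightarrow> (x \<bullet> e i) * (x \<bullet> e j)) *\<^sub>R e m) \<in> borel_measurable borel"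
    for n unfolding case_prod_unfold by measurable
qed

lemma borel_measurable_op_fun:
  assumes "orthonormal_basis e" and K: "\<And>j. \<bar>\<phi> (s j)\<bar> \<le> K"
  shows "op_fun s e \<phi> \<in> borel_measurable borel"
proof (rule borel_measurable_continuous_onI)
  have "bounded_linear (op_fun s e \<phi>)"
    by (rule bounded_linear_intro[where K = K])
      (simp_all add: op_fun_linear_bounded[where \<phi> = \<phi>, OF assms] mult.commute[of _ K])
  then show "continuous_on UNIV (op_fun s e \<phi>)"
    by (rule linear_continuous_on)
qed

section \<open>Concentration of sums in Hilbert space\<close>

lemma power_le_chord:
  fixes x y p q :: real
  assumes "p \<ge> 0" "q \<ge> 0" "p + q = 1" "x \<ge> 0" "y \<ge> 0"
  shows "(p * x + q * y) ^ k \<le> p * x ^ k + q * y ^ k"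
proof (induction k)
  case (Suc k)
  \<comment> \<open>Powers are monotone on the half-line, so both factors have the same sign;
    \<open>p * q\<close> times this product is exactly what the induction step gains.\<close>
  have "(x - y) * (x ^ k - y ^ k) \<ge> 0"
    using assms by (cases "x \<le> y") (auto simp: mult_nonpos_nonpos power_mono)
  then have *: "0 \<le> p * q * ((x - y) * (x ^ k - y ^ k))" using assms by simp
  have q: "q = 1 - p" using assms(3) by simp
  have "(p * x + q * y) ^ Suc k \<le> (p * x + q * y) * (p * x ^ k + q * y ^ k)"
    using Suc assms by (simp add: mult_left_mono)
  also have "\<dots> = p * x ^ Suc k + q * y ^ Suc k - p * q * ((x - y) * (x ^ k - y ^ k))"
    unfolding q by (simp add: algebra_simps)
  finally show ?case using * by linarith
qed (use assms in simp)

text \<open>\<open>cosh z\<close> is a power series in the square of z with nonnegative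
  coefficients, hence convex as a function of that square; the series are compared term by
  term.\<close>

lemma cosh_le_chord:
  fixes u w z p q :: real
  assumes pq: "p \<ge> 0" "q \<ge> 0" "p + q = 1" and z: "z\<^sup>2 = p * u\<^sup>2 + q * w\<^sup>2"
  shows "cosh z \<le> p * cosh u + q * cosh w"
proof (rule sums_le)
  show "(\<lambda>n. if even n then z ^ n /\<^sub>R fact n else 0) sums cosh z" by (rule cosh_converges)
  show "(\<lambda>n. p * (if even n then u ^ n /\<^sub>R fact n else 0) + q * (if even n then w ^ n /\<^sub>R fact n else 0))
      sums (p * cosh u + q * cosh w)"
    by (intro sums_add sums_mult cosh_converges)
  fix n :: nat
  show "(if even n then z ^ n /\<^sub>R fact n else 0) \<le>
    p * (if even n then u ^ n /\<^sub>R fact n else 0) + q * (if even n then w ^ n /\<^sub>R fact n else 0)"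
  proof (cases "even n")
    case True
    then obtain k where k: "n = 2 * k" by blast
    have "(p * u\<^sup>2 + q * w\<^sup>2) ^ k \<le> p * (u\<^sup>2) ^ k + q * (w\<^sup>2) ^ k"
      by (rule power_le_chord) (use pq in auto)
    then have "z ^ n \<le> p * u ^ n + q * w ^ n" by (simp only: k power_mult z)
    then have "z ^ n / fact n \<le> (p * u ^ n + q * w ^ n) / fact n" by (simp add: divide_right_mono)
    then show ?thesis using True by (simp add: divide_inverse algebra_simps)
  qed simp
qed

lemma sinh_ge_self: "(x::real) \<ge> 0 \<Longrightarrow> sinh x \<ge> x"
  using real_le_x_sinh[of x] by (simp add: sinh_def exp_minus)

text \<open>The one-step estimate behind Pinelis' inequality: the increment enters through a factor
  that depends only on its norm, plus a term linear in it. The linear term is what a mean that is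
  zero or small makes harmless.\<close>

lemma cosh_norm_add_le:
  fixes x y :: "'b::real_inner"
  shows "cosh (norm (x + y)) \<le> cosh (norm x) * (exp (norm y) - norm y) +
    ((sinh (norm x) / norm x) *\<^sub>R x) \<bullet> y"
proof -
  define a b where "a = norm x" and "b = norm y"
  have ab: "a \<ge> 0" "b \<ge> 0" by (auto simp: a_def b_def)
  have sh: "sinh b \<ge> b" "sinh a \<ge> 0" "sinh a \<le> cosh a" using sinh_ge_self[OF ab(2)] ab(1)
    by (auto simp: sinh_def cosh_def)
  have ex: "exp b = cosh b + sinh b" by (simp add: cosh_plus_sinh)
  show ?thesis
  proof (cases "a = 0 \<or> b = 0")
    case True
    then show ?thesis
    proof
      assume "a = 0"
      then have "x = 0" by (simp add: a_def)
      then show ?thesis using sh ex by (simp add: b_def)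
    next
      assume "b = 0"
      then have "y = 0" by (simp add: b_def)
      then show ?thesis by simp
    qed
  next
    case False
    then have ab0: "a > 0" "b > 0" using ab by auto
    define c where "c = x \<bullet> y / (a * b)"
    have xy: "x \<bullet> y = c * a * b" using ab0 by (simp add: c_def)
    have "\<bar>x \<bullet> y\<bar> \<le> a * b" unfolding a_def b_def by (rule Cauchy_Schwarz_ineq2)
    then have "\<bar>c\<bar> \<le> 1" using ab0 by (simp add: c_def abs_mult abs_div divide_le_eq)
    then have c: "c \<le> 1" "-1 \<le> c" by auto
    have "(norm (x + y))\<^sup>2 = a\<^sup>2 + 2 * (c * a * b) + b\<^sup>2"
      unfolding a_def b_def using xy[unfolded a_def b_def]
      by (simp add: power2_norm_eq_inner inner_add_left inner_add_right inner_commute)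
    \<comment> \<open>With c the cosine of the angle, the squared norm lies on the chord between the
      collinear extremes \<open>a + b\<close> and \<open>a - b\<close>.\<close>
    then have q: "(norm (x + y))\<^sup>2 = (1 + c) / 2 * (a + b)\<^sup>2 + (1 - c) / 2 * (a - b)\<^sup>2"
      by (simp add: power2_eq_square field_simps)
    have "cosh (norm (x + y)) \<le> (1 + c) / 2 * cosh (a + b) + (1 - c) / 2 * cosh (a - b)"
      by (rule cosh_le_chord[OF _ _ _ q]) (use c in \<open>auto simp: field_simps\<close>)
    also have "\<dots> = cosh a * cosh b + c * (sinh a * sinh b)"
      by (simp add: cosh_add cosh_diff field_simps)
    also have "c * (sinh a * sinh b) = c * sinh a * b + c * (sinh a * (sinh b - b))"
      by (simp add: algebra_simps)
    \<comment> \<open>The angle is given up only for the part of \<open>sinh b\<close> beyond its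
      linear term; the part linear in b is kept exactly, as an inner product.\<close>
    also have "c * (sinh a * (sinh b - b)) \<le> 1 * (cosh a * (sinh b - b))"
      using c sh by (intro mult_mono mult_right_mono) auto
    also have "c * sinh a * b = ((sinh a / a) *\<^sub>R x) \<bullet> y"
      using ab0 by (simp add: xy)
    finally show ?thesis unfolding ex[unfolded b_def] a_def b_def by (simp add: algebra_simps)
  qed
qed

context prob_space
begin

lemma
  fixes U V :: "'a \<Rightarrow> 'b::{real_inner, banach, second_countable_topology}"
  assumes ind: "indep_var borel U borel V" and U: "integrable M U" and V: "integrable M V"
  shows indep_var_integrable_inner: "integrable M (\<lambda>\<omega>. U \<omega> \<bullet> V \<omega>)"
    and indep_var_expectation_inner: "expectation (\<lambda>\<omega>. U \<omega> \<bullet> V \<omega>) = expectation U \<bullet> expectation V"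
proof -
  have [measurable]: "random_variable borel U" "random_variable borel V" using U V by auto
  have "indep_var borel (norm \<circ> U) borel (norm \<circ> V)"
    by (rule indep_var_compose[OF ind]) auto
  then have "integrable M (\<lambda>\<omega>. norm (U \<omega>) * norm (V \<omega>))"
    using indep_var_integrable[of "norm \<circ> U" "norm \<circ> V"] U V by (simp add: comp_def)
  then show int: "integrable M (\<lambda>\<omega>. U \<omega> \<bullet> V \<omega>)"
    by (rule Bochner_Integration.integrable_bound) (auto simp: Cauchy_Schwarz_ineq2)
  have eq: "distr M borel U \<Otimes>\<^sub>M distr M borel V = distr M (borel \<Otimes>\<^sub>M borel) (\<lambda>x. (U x, V x))"
    using ind by (simp add: indep_var_distribution_eq)
  interpret PU: prob_space "distr M borel U" by (rule prob_space_distr) simp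
  interpret PV: prob_space "distr M borel V" by (rule prob_space_distr) simp
  interpret P: pair_prob_space "distr M borel U" "distr M borel V" ..
  have int': "integrable (distr M borel U \<Otimes>\<^sub>M distr M borel V) (\<lambda>p. fst p \<bullet> snd p)"
    unfolding eq by (subst integrable_distr_eq) (use int in \<open>auto intro!: borel_measurable_inner\<close>)
  have "expectation (\<lambda>\<omega>. U \<omega> \<bullet> V \<omega>) = (\<integral>p. fst p \<bullet> snd p \<partial>(distr M borel U \<Otimes>\<^sub>M distr M borel V))"
    unfolding eq by (subst integral_distr) (auto intro!: borel_measurable_inner)
  also have "\<dots> = (\<integral>u. (\<integral>v. u \<bullet> v \<partial>distr M borel V) \<partial>distr M borel U)"
    using P.integral_fst'[OF int'] by simp
  also have "(\<lambda>u. \<integral>v. u \<bullet> v \<partial>distr M borel V) = (\<lambda>u. u \<bullet> expectation V)"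
    using V by (auto simp: integral_distr)
  also have "(\<integral>u. u \<bullet> expectation V \<partial>distr M borel U) = expectation U \<bullet> expectation V"
    using U by (simp add: integral_distr)
  finally show "expectation (\<lambda>\<omega>. U \<omega> \<bullet> V \<omega>) = expectation U \<bullet> expectation V" .
qed

lemma indep_var_partial_sum:
  fixes Y :: "nat \<Rightarrow> 'a \<Rightarrow> 'b::{real_normed_vector, second_countable_topology}"
  assumes "indep_vars (\<lambda>_. borel) Y UNIV"
  shows "indep_var borel (\<lambda>\<omega>. \<Sum>i<n. Y i \<omega>) borel (Y n)"
proof -
  have "indep_var
    borel ((\<lambda>f. \<Sum>i<n. f i) \<circ> (\<lambda>\<omega>. restrict (\<lambda>i. Y i \<omega>) {..<n}))
    borel ((\<lambda>f. f n) \<circ> (\<lambda>\<omega>. restrict (\<lambda>i. Y i \<omega>) {n}))"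
    by (intro indep_var_compose[OF indep_var_restrict[OF assms]]) auto
  also have "((\<lambda>f. f n) \<circ> (\<lambda>\<omega>. restrict (\<lambda>i. Y i \<omega>) {n})) = Y n" by auto
  also have "((\<lambda>f. \<Sum>i<n. f i) \<circ> (\<lambda>\<omega>. restrict (\<lambda>i. Y i \<omega>) {..<n})) = (\<lambda>\<omega>. \<Sum>i<n. Y i \<omega>)"
    by auto
  finally show ?thesis .
qed

section \<open>Second moments and Chebyshev bounds for independent sums\<close>

lemma integrable_norm_from_square:
  fixes Y :: "'a \<Rightarrow> 'b::{banach, second_countable_topology}"
  assumes [measurable]: "Y \<in> borel_measurable M" and "integrable M (\<lambda>\<omega>. (norm (Y \<omega>))\<^sup>2)"
  shows "integrable M Y"
proof (rule Bochner_Integration.integrable_bound)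
  show "integrable M (\<lambda>\<omega>. 1 + (norm (Y \<omega>))\<^sup>2)" using assms by simp
  have "x \<le> 1 + x\<^sup>2" for x :: real
    using zero_le_power2[of "x - 1"] zero_le_power2[of x] unfolding power2_diff power_one mult_1_right by linarith
  then show "AE \<omega> in M. norm (Y \<omega>) \<le> norm (1 + (norm (Y \<omega>))\<^sup>2)" by simp
qed simp

lemma integrable_and_le_from_nn:
  assumes [measurable]: "f \<in> borel_measurable M" and nn: "\<And>\<omega>. f \<omega> \<ge> 0"
    and le: "(\<integral>\<^sup>+\<omega>. ennreal (f \<omega>) \<partial>M) \<le> ennreal B" and B: "B \<ge> 0"
  shows "integrable M f" "expectation f \<le> B"
proof -
  show int: "integrable M f"
    by (rule integrableI_nonneg) (use le nn in \<open>auto intro: le_less_trans\<close>)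
  show "expectation f \<le> B"
    using le nn_integral_eq_integral[OF int] nn B by (simp add: ennreal_le_iff)
qed

lemma expectation_centered_sq:
  fixes Y :: "'a \<Rightarrow> 'b::{real_inner, banach, second_countable_topology}"
  assumes [measurable]: "random_variable borel Y" and sq: "integrable M (\<lambda>\<omega>. (norm (Y \<omega>))\<^sup>2)"
  shows "integrable M (\<lambda>\<omega>. (norm (Y \<omega> - expectation Y))\<^sup>2)"
    "expectation (\<lambda>\<omega>. (norm (Y \<omega> - expectation Y))\<^sup>2) \<le> expectation (\<lambda>\<omega>. (norm (Y \<omega>))\<^sup>2)"
proof -
  have Y: "integrable M Y" by (rule integrable_norm_from_square[OF assms])
  have eq: "(norm (Y \<omega> - expectation Y))\<^sup>2 = (norm (Y \<omega>))\<^sup>2 - 2 * (Y \<omega> \<bullet> expectation Y) + (norm (expectation Y))\<^sup>2" for \<omega>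
    by (simp add: power2_norm_eq_inner inner_diff_left inner_diff_right inner_commute)
  show "integrable M (\<lambda>\<omega>. (norm (Y \<omega> - expectation Y))\<^sup>2)"
    unfolding eq using sq Y by auto
  have "expectation (\<lambda>\<omega>. (norm (Y \<omega> - expectation Y))\<^sup>2) =
    expectation (\<lambda>\<omega>. (norm (Y \<omega>))\<^sup>2) - 2 * (expectation Y \<bullet> expectation Y) + (norm (expectation Y))\<^sup>2"
    unfolding eq using sq Y by (simp add: prob_space)
  then show "expectation (\<lambda>\<omega>. (norm (Y \<omega> - expectation Y))\<^sup>2) \<le> expectation (\<lambda>\<omega>. (norm (Y \<omega>))\<^sup>2)"
    by (simp add: power2_norm_eq_inner)
qed

lemma union_bound3:
  assumes "A \<in> events" "B \<in> events" "D \<in> events" "S \<subseteq> A \<union> B \<union> D"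
  shows "prob S \<le> prob A + prob B + prob D"
proof -
  have "prob S \<le> prob (A \<union> B \<union> D)" using assms by (intro finite_measure_mono) auto
  also have "\<dots> \<le> prob (A \<union> B) + prob D" using assms by (intro measure_Un_le) auto
  also have "prob (A \<union> B) \<le> prob A + prob B" using assms by (intro measure_Un_le) auto
  finally show ?thesis by simp
qed

lemma second_moment_sum:
  fixes Y :: "nat \<Rightarrow> 'a \<Rightarrow> 'b::{real_inner, banach, second_countable_topology}"
  assumes ind: "indep_vars (\<lambda>_. borel) Y UNIV"
    and sq: "\<And>i. integrable M (\<lambda>\<omega>. (norm (Y i \<omega>))\<^sup>2)"
    and zero: "\<And>i. expectation (Y i) = 0"
    and bound: "\<And>i. expectation (\<lambda>\<omega>. (norm (Y i \<omega>))\<^sup>2) \<le> v"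
  shows "integrable M (\<lambda>\<omega>. (norm (\<Sum>i<n. Y i \<omega>))\<^sup>2) \<and>
    expectation (\<lambda>\<omega>. (norm (\<Sum>i<n. Y i \<omega>))\<^sup>2) \<le> real n * v"
proof (induction n)
  case (Suc n)
  have [measurable]: "random_variable borel (Y i)" for i using ind by (auto simp: indep_vars_def)
  have Y: "integrable M (Y i)" for i by (rule integrable_norm_from_square) (auto simp: sq)
  then have S: "integrable M (\<lambda>\<omega>. \<Sum>i<n. Y i \<omega>)" by simp
  note i = indep_var_integrable_inner[OF indep_var_partial_sum[OF ind] S Y]
    indep_var_expectation_inner[OF indep_var_partial_sum[OF ind] S Y]
  have eq: "(norm (\<Sum>i<Suc n. Y i \<omega>))\<^sup>2 = (norm (\<Sum>i<n. Y i \<omega>))\<^sup>2 +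
      2 * ((\<Sum>i<n. Y i \<omega>) \<bullet> Y n \<omega>) + (norm (Y n \<omega>))\<^sup>2" for \<omega>
    by (simp add: power2_norm_eq_inner inner_add_left inner_add_right inner_commute)
  show ?case unfolding eq
    using Suc i sq[of n] zero[of n] bound[of n] by (simp add: algebra_simps)
qed simp

lemma chebyshev_sum:
  fixes Y :: "nat \<Rightarrow> 'a \<Rightarrow> 'b::{real_inner, banach, second_countable_topology}"
  assumes ind: "indep_vars (\<lambda>_. borel) Y UNIV"
    and sq: "\<And>i. integrable M (\<lambda>\<omega>. (norm (Y i \<omega>))\<^sup>2)"
    and zero: "\<And>i. expectation (Y i) = 0"
    and bound: "\<And>i. expectation (\<lambda>\<omega>. (norm (Y i \<omega>))\<^sup>2) \<le> v"
    and x: "x > 0" and n: "n \<ge> 1"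
  shows "prob {\<omega> \<in> space M. norm ((1 / real n) *\<^sub>R (\<Sum>i<n. Y i \<omega>)) \<ge> x} \<le> v / (real n * x\<^sup>2)"
proof -
  have [measurable]: "random_variable borel (Y i)" for i using ind by (auto simp: indep_vars_def)
  note sm = second_moment_sum[OF ind sq zero bound, of n]
  have "{\<omega> \<in> space M. norm ((1 / real n) *\<^sub>R (\<Sum>i<n. Y i \<omega>)) \<ge> x} =
     {\<omega> \<in> space M. (norm (\<Sum>i<n. Y i \<omega>))\<^sup>2 \<ge> (real n * x)\<^sup>2}"
  proof -
    have "norm ((1 / real n) *\<^sub>R w) \<ge> x \<longleftrightarrow> (norm w)\<^sup>2 \<ge> (real n * x)\<^sup>2" for w :: 'b
      using x n abs_le_square_iff[of "real n * x" "norm w"] by (simp add: field_simps)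
    then show ?thesis by simp
  qed
  also have "prob \<dots> \<le> expectation (\<lambda>\<omega>. (norm (\<Sum>i<n. Y i \<omega>))\<^sup>2) / (real n * x)\<^sup>2"
    by (rule integral_Markov_inequality_measure[where A = "space M"]) (use sm x n in auto)
  also have "\<dots> \<le> (real n * v) / (real n * x)\<^sup>2" using sm by (intro divide_right_mono) auto
  also have "\<dots> = v / (real n * x\<^sup>2)" using n x by (simp add: power2_eq_square field_simps)
  finally show ?thesis .
qed

text \<open>Each summand multiplies the expected \<open>cosh\<close> of the norm by at most
  \<open>1 + \<rho> + m\<close>: \<rho> pays for the terms of order two and higher, m for a nonzero
  mean. Means are allowed because clipping the noise biases the summands.\<close>

lemma pinelis_cosh:
  fixes Y :: "nat \<Rightarrow> 'a \<Rightarrow> 'b::{real_inner, banach, second_countable_topology}"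
  assumes ind: "indep_vars (\<lambda>_. borel) Y UNIV"
    and exp_int: "\<And>i. integrable M (\<lambda>\<omega>. exp (norm (Y i \<omega>)))"
    and rho: "\<And>i. expectation (\<lambda>\<omega>. exp (norm (Y i \<omega>)) - 1 - norm (Y i \<omega>)) \<le> \<rho>"
    and mean: "\<And>i. norm (expectation (Y i)) \<le> m"
  shows "integrable M (\<lambda>\<omega>. cosh (norm (\<Sum>i<n. Y i \<omega>))) \<and>
    expectation (\<lambda>\<omega>. cosh (norm (\<Sum>i<n. Y i \<omega>))) \<le> (1 + \<rho> + m) ^ n"
proof (induction n)
  case 0
  then show ?case by (simp add: prob_space)
next
  case (Suc n)
  have [measurable]: "random_variable borel (Y i)" for i using ind by (auto simp: indep_vars_def)
  define S where "S \<omega> = (\<Sum>i<n. Y i \<omega>)" for \<omega>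
  have [measurable]: "random_variable borel S" unfolding S_def by simp
  have ge: "x \<le> exp x" for x :: real using exp_ge_add_one_self[of x] by linarith
  have Yn: "integrable M (\<lambda>\<omega>. norm (Y n \<omega>))"
    by (rule Bochner_Integration.integrable_bound[OF exp_int[of n]]) (auto simp: ge)
  then have Y: "integrable M (Y n)" by (subst integrable_norm_iff[symmetric]) auto
  have IH: "integrable M (\<lambda>\<omega>. cosh (norm (S \<omega>)))" "expectation (\<lambda>\<omega>. cosh (norm (S \<omega>))) \<le> (1 + \<rho> + m) ^ n"
    using Suc by (auto simp: S_def)
  \<comment> \<open>The gradient of \<open>cosh\<close> of the norm. At 0 the quotient is 0 by the
    convention for division, which is harmless since it multiplies the zero vector.\<close>
  define g :: "'b \<Rightarrow> 'b" where "g x = (sinh (norm x) / norm x) *\<^sub>R x" for x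
  have [measurable]: "g \<in> borel_measurable borel"
    unfolding g_def sinh_def by measurable
  have norm_g: "norm (g x) \<le> cosh (norm x)" for x
    by (auto simp: g_def sinh_def cosh_def divide_simps)
  have gS: "integrable M (\<lambda>\<omega>. g (S \<omega>))"
    by (rule Bochner_Integration.integrable_bound[OF IH(1)]) (auto simp: norm_g)
  have ind_S: "indep_var borel S borel (Y n)"
    unfolding S_def[abs_def] by (rule indep_var_partial_sum[OF ind])
  have indg: "indep_var borel (\<lambda>\<omega>. g (S \<omega>)) borel (Y n)"
    by (rule indep_var_compose[OF ind_S, of g borel "\<lambda>x. x" borel, unfolded comp_def]) measurable
  have cm: "(\<lambda>x::'b. cosh (norm x)) \<in> borel_measurable borel" unfolding cosh_def by measurable
  have indc: "indep_var borel (\<lambda>\<omega>. cosh (norm (S \<omega>))) borel (\<lambda>\<omega>. exp (norm (Y n \<omega>)) - norm (Y n \<omega>))"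
    by (rule indep_var_compose[OF ind_S cm, of "\<lambda>x. exp (norm x) - norm x" borel, unfolded comp_def]) measurable
  have E: "integrable M (\<lambda>\<omega>. exp (norm (Y n \<omega>)) - norm (Y n \<omega>))" using exp_int Yn by simp
  note i1 = indep_var_integrable[OF indc IH(1) E] indep_var_lebesgue_integral[OF indc IH(1) E]
  note i2 = indep_var_integrable_inner[OF indg gS Y] indep_var_expectation_inner[OF indg gS Y]
  have le: "cosh (norm (S \<omega> + Y n \<omega>)) \<le>
     cosh (norm (S \<omega>)) * (exp (norm (Y n \<omega>)) - norm (Y n \<omega>)) + g (S \<omega>) \<bullet> Y n \<omega>" for \<omega>
    unfolding g_def by (rule cosh_norm_add_le)
  have int: "integrable M (\<lambda>\<omega>. cosh (norm (S \<omega> + Y n \<omega>)))"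
  proof (rule Bochner_Integration.integrable_bound)
    show "integrable M (\<lambda>\<omega>. cosh (norm (S \<omega>)) * (exp (norm (Y n \<omega>)) - norm (Y n \<omega>)) + g (S \<omega>) \<bullet> Y n \<omega>)"
      using i1 i2 by simp
    show "(\<lambda>\<omega>. cosh (norm (S \<omega> + Y n \<omega>))) \<in> borel_measurable M" unfolding cosh_def by measurable
    have "norm (cosh (norm (S \<omega> + Y n \<omega>)))
      \<le> norm (cosh (norm (S \<omega>)) * (exp (norm (Y n \<omega>)) - norm (Y n \<omega>)) + g (S \<omega>) \<bullet> Y n \<omega>)" for \<omega>
      using le[of \<omega>] cosh_real_nonneg[of "norm (S \<omega> + Y n \<omega>)"] by simp
    then show "AE \<omega> in M. norm (cosh (norm (S \<omega> + Y n \<omega>)))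
      \<le> norm (cosh (norm (S \<omega>)) * (exp (norm (Y n \<omega>)) - norm (Y n \<omega>)) + g (S \<omega>) \<bullet> Y n \<omega>)" by simp
  qed
  have c0: "expectation (\<lambda>\<omega>. cosh (norm (S \<omega>))) \<ge> 0" by simp
  have E1: "expectation (\<lambda>\<omega>. exp (norm (Y n \<omega>)) - norm (Y n \<omega>)) \<le> 1 + \<rho>"
    using rho[of n] exp_int[of n] Yn by (simp add: prob_space)
  have E2: "norm (expectation (\<lambda>\<omega>. g (S \<omega>))) \<le> expectation (\<lambda>\<omega>. cosh (norm (S \<omega>)))"
    by (rule order_trans[OF integral_norm_bound]) (use gS IH norm_g in \<open>auto intro!: integral_mono\<close>)
  have m0: "m \<ge> 0" using mean[of 0] norm_ge_zero order_trans by blast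
  have "expectation (\<lambda>\<omega>. cosh (norm (S \<omega> + Y n \<omega>))) \<le>
     expectation (\<lambda>\<omega>. cosh (norm (S \<omega>)) * (exp (norm (Y n \<omega>)) - norm (Y n \<omega>)) + g (S \<omega>) \<bullet> Y n \<omega>)"
    using i1 i2 by (intro integral_mono int le) simp
  also have "\<dots> = expectation (\<lambda>\<omega>. cosh (norm (S \<omega>))) * expectation (\<lambda>\<omega>. exp (norm (Y n \<omega>)) - norm (Y n \<omega>))
      + expectation (\<lambda>\<omega>. g (S \<omega>)) \<bullet> expectation (Y n)"
    using i1 i2 by simp
  also have "\<dots> \<le> expectation (\<lambda>\<omega>. cosh (norm (S \<omega>))) * (1 + \<rho>) + expectation (\<lambda>\<omega>. cosh (norm (S \<omega>))) * m"
  proof (intro add_mono mult_left_mono E1 c0)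
    have "expectation (\<lambda>\<omega>. g (S \<omega>)) \<bullet> expectation (Y n) \<le> norm (expectation (\<lambda>\<omega>. g (S \<omega>))) * norm (expectation (Y n))"
      by (rule norm_cauchy_schwarz)
    also have "\<dots> \<le> expectation (\<lambda>\<omega>. cosh (norm (S \<omega>))) * m"
      using E2 mean[of n] c0 by (intro mult_mono) auto
    finally show "expectation (\<lambda>\<omega>. g (S \<omega>)) \<bullet> expectation (Y n) \<le> expectation (\<lambda>\<omega>. cosh (norm (S \<omega>))) * m" .
  qed
  also have "\<dots> = expectation (\<lambda>\<omega>. cosh (norm (S \<omega>))) * (1 + \<rho> + m)" by (simp add: algebra_simps)
  also have "\<dots> \<le> (1 + \<rho> + m) ^ n * (1 + \<rho> + m)"
  proof (intro mult_right_mono IH(2))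
    have "expectation (\<lambda>\<omega>. exp (norm (Y n \<omega>)) - 1 - norm (Y n \<omega>)) \<ge> 0"
    proof (rule integral_nonneg_AE, rule AE_I2)
      show "0 \<le> exp (norm (Y n \<omega>)) - 1 - norm (Y n \<omega>)" for \<omega>
        using exp_ge_add_one_self[of "norm (Y n \<omega>)"] by linarith
    qed
    then show "0 \<le> 1 + \<rho> + m" using rho[of n] m0 by linarith
  qed
  finally show ?case using int by (simp add: S_def mult.commute)
qed

text \<open>Markov's inequality applied to \<open>cosh\<close>; the factor 2 comes from
  \<open>exp x / 2 \<le> cosh x\<close>.\<close>

lemma pinelis_tail:
  fixes Y :: "nat \<Rightarrow> 'a \<Rightarrow> 'b::{real_inner, banach, second_countable_topology}"
  assumes "indep_vars (\<lambda>_. borel) Y UNIV"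
    and "\<And>i. integrable M (\<lambda>\<omega>. exp (norm (Y i \<omega>)))"
    and "\<And>i. expectation (\<lambda>\<omega>. exp (norm (Y i \<omega>)) - 1 - norm (Y i \<omega>)) \<le> \<rho>"
    and "\<And>i. norm (expectation (Y i)) \<le> m"
  shows "prob {\<omega> \<in> space M. norm (\<Sum>i<n. Y i \<omega>) \<ge> x} \<le> 2 * exp (real n * (\<rho> + m) - x)"
proof -
  have [measurable]: "random_variable borel (Y i)" for i using assms(1) by (auto simp: indep_vars_def)
  note p = pinelis_cosh[OF assms, of n]
  have "prob {\<omega> \<in> space M. norm (\<Sum>i<n. Y i \<omega>) \<ge> x}
    \<le> prob {\<omega> \<in> space M. cosh (norm (\<Sum>i<n. Y i \<omega>)) \<ge> exp x / 2}"
  proof (rule finite_measure_mono)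
    have "exp x / 2 \<le> cosh r" if "x \<le> r" for r :: real
    proof -
      have "exp x \<le> exp r" using that by simp
      moreover have "exp r \<le> 2 * cosh r" by (simp add: cosh_def)
      ultimately show ?thesis by linarith
    qed
    then show "{\<omega> \<in> space M. norm (\<Sum>i<n. Y i \<omega>) \<ge> x}
      \<subseteq> {\<omega> \<in> space M. cosh (norm (\<Sum>i<n. Y i \<omega>)) \<ge> exp x / 2}" by auto
    have "(\<lambda>\<omega>. cosh (norm (\<Sum>i<n. Y i \<omega>))) \<in> borel_measurable M" using p by auto
    then show "{\<omega> \<in> space M. cosh (norm (\<Sum>i<n. Y i \<omega>)) \<ge> exp x / 2} \<in> events" by measurable
  qed
  also have "\<dots> \<le> expectation (\<lambda>\<omega>. cosh (norm (\<Sum>i<n. Y i \<omega>))) / (exp x / 2)"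
    by (rule integral_Markov_inequality_measure[where A = "space M"]) (use p in auto)
  also have "\<dots> \<le> (1 + \<rho> + m) ^ n / (exp x / 2)" using p by (intro divide_right_mono) auto
  also have "\<dots> \<le> exp (\<rho> + m) ^ n / (exp x / 2)"
  proof (intro divide_right_mono power_mono)
    show "1 + \<rho> + m \<le> exp (\<rho> + m)" using exp_ge_add_one_self[of "\<rho> + m"] by linarith
    have "expectation (\<lambda>\<omega>. exp (norm (Y n \<omega>)) - 1 - norm (Y n \<omega>)) \<ge> 0"
    proof (rule integral_nonneg_AE, rule AE_I2)
      show "0 \<le> exp (norm (Y n \<omega>)) - 1 - norm (Y n \<omega>)" for \<omega>
        using exp_ge_add_one_self[of "norm (Y n \<omega>)"] by linarith
    qed
    then show "0 \<le> 1 + \<rho> + m" using assms(3)[of n] assms(4)[of n] norm_ge_zero[of "expectation (Y n)"] by linarith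
  qed simp
  also have "\<dots> = 2 * exp (real n * (\<rho> + m) - x)"
    by (simp add: exp_diff exp_of_nat_mult)
  finally show ?thesis .
qed

lemma hoeffding_lower:
  fixes Y :: "nat \<Rightarrow> 'a \<Rightarrow> real"
  assumes ind: "indep_vars (\<lambda>_. borel) Y UNIV"
    and range: "\<And>i \<omega>. 0 \<le> Y i \<omega> \<and> Y i \<omega> \<le> b" and b: "b > 0"
    and mean: "\<And>i. expectation (Y i) \<ge> \<mu>" and n: "n \<ge> 1" and t: "t \<ge> 0"
  shows "prob {\<omega> \<in> space M. (1 / real n) * (\<Sum>i<n. Y i \<omega>) \<le> \<mu> - t} \<le> exp (- 2 * real n * t\<^sup>2 / b\<^sup>2)"
proof -
  have [measurable]: "random_variable borel (Y i)" for i using ind by (auto simp: indep_vars_def)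
  interpret H: Hoeffding_ineq M "{..<n}" Y "\<lambda>_. 0" "\<lambda>_. b" "\<Sum>i<n. expectation (Y i)"
    by unfold_locales (use range in \<open>auto intro: indep_vars_subset[OF ind]\<close>)
  have "prob {\<omega> \<in> space M. (1 / real n) * (\<Sum>i<n. Y i \<omega>) \<le> \<mu> - t} \<le>
    prob {\<omega> \<in> space M. (\<Sum>i<n. Y i \<omega>) \<le> (\<Sum>i<n. expectation (Y i)) - real n * t}"
  proof (rule finite_measure_mono)
    have "real n * \<mu> \<le> (\<Sum>i<n. expectation (Y i))"
      using sum_mono[of "{..<n}" "\<lambda>_. \<mu>" "\<lambda>i. expectation (Y i)"] mean by simp
    then show "{\<omega> \<in> space M. (1 / real n) * (\<Sum>i<n. Y i \<omega>) \<le> \<mu> - t} \<subseteq>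
      {\<omega> \<in> space M. (\<Sum>i<n. Y i \<omega>) \<le> (\<Sum>i<n. expectation (Y i)) - real n * t}"
      using n by (auto simp: field_simps)
  qed measurable
  also have "\<dots> \<le> exp (-2 * (real n * t)\<^sup>2 / (\<Sum>i<n. (b - 0)\<^sup>2))"
    by (rule H.Hoeffding_ineq_le) (use t b n in auto)
  also have "\<dots> = exp (- 2 * real n * t\<^sup>2 / b\<^sup>2)" using n b by (simp add: power2_eq_square field_simps)
  finally show ?thesis .
qed

end

section \<open>Huber's loss\<close>

definition huber_score :: "real \<Rightarrow> real \<Rightarrow> real" where
  "huber_score \<gamma> u = max (- \<gamma>) (min \<gamma> u)"

lemma abs_huber_score_le: "\<gamma> \<ge> 0 \<Longrightarrow> \<bar>huber_score \<gamma> u\<bar> \<le> \<gamma>"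
  by (auto simp: huber_score_def)

lemma borel_measurable_huber_score [measurable]: "huber_score \<gamma> \<in> borel_measurable borel"
  unfolding huber_score_def by measurable

text \<open>The conjugate representation \<open>huber \<gamma> u = max {a u - a\<^sup>2 / 2 | \<bar>a\<bar> \<le> \<gamma>}\<close>, attained at the
  score, replaces all derivative computations.\<close>

lemma huber_eq_score: "\<gamma> \<ge> 0 \<Longrightarrow> huber \<gamma> u = huber_score \<gamma> u * u - (huber_score \<gamma> u)\<^sup>2 / 2"
  by (auto simp: huber_def huber_score_def power2_eq_square)

lemma huber_ge_affine:
  assumes "\<bar>a\<bar> \<le> \<gamma>"
  shows "a * u - a\<^sup>2 / 2 \<le> huber \<gamma> u"
proof (cases "\<bar>u\<bar> \<le> \<gamma>")
  case True
  have "(u - a)\<^sup>2 \<ge> 0" by simp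
  then show ?thesis using True by (simp add: huber_def power2_diff algebra_simps)
next
  case False
  have "a * u \<le> \<bar>a\<bar> * \<bar>u\<bar>" by (metis abs_ge_self abs_mult)
  \<comment> \<open>This product is twice the gap between the linear branch of the loss at u and
    \<open>\<bar>a\<bar> * \<bar>u\<bar> - a\<^sup>2 / 2\<close>.\<close>
  moreover have "(\<gamma> - \<bar>a\<bar>) * (2 * \<bar>u\<bar> - \<gamma> - \<bar>a\<bar>) \<ge> 0" using assms False by simp
  moreover have "a\<^sup>2 = \<bar>a\<bar> * \<bar>a\<bar>" by (simp add: power2_eq_square)
  ultimately show ?thesis using False by (simp add: huber_def power2_eq_square algebra_simps)
qed

lemma continuous_on_huber: "\<gamma> \<ge> 0 \<Longrightarrow> continuous_on UNIV (huber \<gamma>)"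
  by (rule continuous_on_eq[where f = "\<lambda>u. huber_score \<gamma> u * u - (huber_score \<gamma> u)\<^sup>2 / 2"])
    (auto simp: huber_eq_score huber_score_def intro!: continuous_intros)

lemma huber_convex:
  assumes "\<gamma> \<ge> 0" "0 \<le> t" "t \<le> 1"
  shows "huber \<gamma> ((1 - t) * u + t * w) \<le> (1 - t) * huber \<gamma> u + t * huber \<gamma> w"
proof -
  define a where "a = huber_score \<gamma> ((1 - t) * u + t * w)"
  have a: "\<bar>a\<bar> \<le> \<gamma>" unfolding a_def by (rule abs_huber_score_le[OF assms(1)])
  have "huber \<gamma> ((1 - t) * u + t * w) = (1 - t) * (a * u - a\<^sup>2 / 2) + t * (a * w - a\<^sup>2 / 2)"
    unfolding huber_eq_score[OF assms(1)] a_def[symmetric] by (simp add: field_simps)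
  also have "\<dots> \<le> (1 - t) * huber \<gamma> u + t * huber \<gamma> w"
    using huber_ge_affine[OF a] assms by (intro add_mono mult_left_mono) auto
  finally show ?thesis .
qed

text \<open>The left side is the Bregman divergence of the loss, always nonnegative. When the noise
  uses at most half of the quadratic range, the other half is free for the move u, so the divergence
  keeps at least half the square of u capped at T.\<close>

lemma huber_bregman_ge:
  assumes "0 \<le> T" "T \<le> \<gamma> / 2"
  shows "huber \<gamma> (\<epsilon> - u) - huber \<gamma> \<epsilon> + huber_score \<gamma> \<epsilon> * u \<ge>
    (min \<bar>u\<bar> T)\<^sup>2 / 2 * (if \<bar>\<epsilon>\<bar> \<le> \<gamma> / 2 then 1 else 0)"
proof (cases "\<bar>\<epsilon>\<bar> \<le> \<gamma> / 2")
  case False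
  have g: "\<gamma> \<ge> 0" using assms by simp
  show ?thesis
    using huber_ge_affine[OF abs_huber_score_le[OF g], of \<epsilon> "\<epsilon> - u"] huber_eq_score[OF g, of \<epsilon>] False
    by (simp add: algebra_simps)
next
  case True
  define m where "m = min \<bar>u\<bar> T"
  \<comment> \<open>c is u clipped to [-T, T]. Then \<open>\<epsilon> - c\<close> is an admissible
    slope in the conjugate representation, and the affine minorant with this slope leaves
    \<open>c * u - c\<^sup>2 / 2\<close>.\<close>
  define c where "c = sgn u * m"
  have m: "0 \<le> m" "m \<le> \<bar>u\<bar>" "m \<le> T" using assms by (auto simp: m_def)
  have c: "\<bar>c\<bar> \<le> m" "c * u = m * \<bar>u\<bar>" "c\<^sup>2 \<le> m * m"
    using m by (auto simp: c_def abs_mult sgn_if power2_eq_square)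
  have sc: "huber_score \<gamma> \<epsilon> = \<epsilon>" "huber \<gamma> \<epsilon> = \<epsilon>\<^sup>2 / 2"
    using True by (auto simp: huber_score_def huber_def)
  have "\<bar>\<epsilon> - c\<bar> \<le> \<gamma>" using True c m assms by linarith
  from huber_ge_affine[OF this, of "\<epsilon> - u"]
  have "huber \<gamma> (\<epsilon> - u) - huber \<gamma> \<epsilon> + huber_score \<gamma> \<epsilon> * u \<ge> c * u - c\<^sup>2 / 2"
    by (simp add: sc power2_eq_square field_simps)
  moreover have "m * \<bar>u\<bar> \<ge> m * m" using m by (simp add: mult_left_mono)
  ultimately show ?thesis using True c unfolding m_def[symmetric] by (simp add: power2_eq_square)
qed

section \<open>Strong convexity of the penalised objective\<close>

lemma norm_convex_comb_sq:
  fixes f g :: "'b::real_inner"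
  shows "(norm ((1 - t) *\<^sub>R f + t *\<^sub>R g))\<^sup>2 =
    (1 - t) * (norm f)\<^sup>2 + t * (norm g)\<^sup>2 - t * (1 - t) * (norm (g - f))\<^sup>2"
  by (simp add: power2_norm_eq_inner inner_add_left inner_add_right inner_diff_left inner_diff_right
      inner_commute algebra_simps)

lemma huber_objective_strongly_convex:
  assumes "\<gamma> \<ge> 0" "0 \<le> t" "t \<le> 1"
  shows "huber_objective n \<gamma> l x y ((1 - t) *\<^sub>R f + t *\<^sub>R g) \<le>
    (1 - t) * huber_objective n \<gamma> l x y f + t * huber_objective n \<gamma> l x y g
      - l * t * (1 - t) * (norm (g - f))\<^sup>2"
proof -
  define S where "S f = (\<Sum>i<n. huber \<gamma> (y i - x i \<bullet> f))" for f
  define c where "c = 1 / real n"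
  have "S ((1 - t) *\<^sub>R f + t *\<^sub>R g) \<le>
     (\<Sum>i<n. (1 - t) * huber \<gamma> (y i - x i \<bullet> f) + t * huber \<gamma> (y i - x i \<bullet> g))"
    unfolding S_def
  proof (rule sum_mono)
    fix i
    have "y i - x i \<bullet> ((1 - t) *\<^sub>R f + t *\<^sub>R g) = (1 - t) * (y i - x i \<bullet> f) + t * (y i - x i \<bullet> g)"
      by (simp add: inner_add_right algebra_simps)
    then show "huber \<gamma> (y i - x i \<bullet> ((1 - t) *\<^sub>R f + t *\<^sub>R g)) \<le>
       (1 - t) * huber \<gamma> (y i - x i \<bullet> f) + t * huber \<gamma> (y i - x i \<bullet> g)"
      using huber_convex[OF assms] by simp
  qed
  also have "\<dots> = (1 - t) * S f + t * S g"
    by (simp add: S_def sum.distrib sum_distrib_left)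
  finally have "c * S ((1 - t) *\<^sub>R f + t *\<^sub>R g) \<le> c * ((1 - t) * S f + t * S g)"
    by (rule mult_left_mono) (simp add: c_def)
  then show ?thesis
    unfolding huber_objective_def norm_convex_comb_sq S_def[symmetric] c_def[symmetric]
    by (simp add: distrib_left right_diff_distrib left_diff_distrib mult.assoc mult.left_commute)
qed

text \<open>Comparing the minimiser with a point at parameter t of the segment to f gives the gap up
  to a factor 1 - t, and then t tends to 0.\<close>

lemma huber_estimator_gap:
  assumes g: "\<gamma> \<ge> 0" and est: "huber_estimator n \<gamma> l x y fh"
  shows "l * (norm (f - fh))\<^sup>2 \<le> huber_objective n \<gamma> l x y f - huber_objective n \<gamma> l x y fh"
proof -
  let ?J = "huber_objective n \<gamma> l x y"
  have "l * (norm (f - fh))\<^sup>2 - (?J f - ?J fh) \<le> t * (l * (norm (f - fh))\<^sup>2)" if t: "0 < t" "t < 1" for t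
  proof -
    have "?J fh \<le> ?J ((1 - t) *\<^sub>R fh + t *\<^sub>R f)"
      using est by (simp add: huber_estimator_def is_arg_min_linorder)
    also have "\<dots> \<le> (1 - t) * ?J fh + t * ?J f - l * t * (1 - t) * (norm (f - fh))\<^sup>2"
      using t by (intro huber_objective_strongly_convex[OF g]) auto
    finally have "0 \<le> t * (?J f - ?J fh - l * (1 - t) * (norm (f - fh))\<^sup>2)"
      by (simp add: algebra_simps)
    then have "0 \<le> ?J f - ?J fh - l * (1 - t) * (norm (f - fh))\<^sup>2"
      using t by (simp add: zero_le_mult_iff)
    then show ?thesis by (simp add: algebra_simps)
  qed
  then have "\<forall>\<^sub>F t in at_right 0. l * (norm (f - fh))\<^sup>2 - (?J f - ?J fh) \<le> t * (l * (norm (f - fh))\<^sup>2)"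
    by (intro eventually_at_rightI[of 0 1]) auto
  moreover have "((\<lambda>t. t * (l * (norm (f - fh))\<^sup>2)) \<longlongrightarrow> 0 * (l * (norm (f - fh))\<^sup>2)) (at_right 0)"
    by (intro tendsto_intros)
  ultimately have "l * (norm (f - fh))\<^sup>2 - (?J f - ?J fh) \<le> 0 * (l * (norm (f - fh))\<^sup>2)"
    by (intro tendsto_lowerbound[of _ _ "at_right 0"]) auto
  then show ?thesis by simp
qed

text \<open>Stated for every point \<open>f0 + h\<close> of the segment from f0 to the estimator,
  because the later argument picks the point at a prescribed distance. Such a point need not
  minimise, but convexity keeps its objective at or below that of f0. The factors 2 clear the 1/2 of
  the Bregman bound.\<close>

lemma huber_estimator_basic_ineq:
  fixes x :: "nat \<Rightarrow> L2"
  assumes T: "0 \<le> T" "T \<le> \<gamma> / 2" and l: "l \<ge> 0" and t: "0 \<le> t" "t \<le> 1"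
    and est: "huber_estimator n \<gamma> l x y fh"
    and y: "\<And>i. i < n \<Longrightarrow> y i = f0 \<bullet> x i + \<epsilon> i"
    and h: "h = t *\<^sub>R (fh - f0)"
  shows "(1 / real n) * (\<Sum>i<n. (min \<bar>x i \<bullet> h\<bar> T)\<^sup>2 * (if \<bar>\<epsilon> i\<bar> \<le> \<gamma> / 2 then 1 else 0)) + 2 * l * (norm h)\<^sup>2
    \<le> 2 * (((1 / real n) *\<^sub>R (\<Sum>i<n. huber_score \<gamma> (\<epsilon> i) *\<^sub>R x i) - (2 * l) *\<^sub>R f0) \<bullet> h)"
proof -
  let ?J = "huber_objective n \<gamma> l x y"
  have g: "\<gamma> \<ge> 0" using T by simp
  have "f0 + h = (1 - t) *\<^sub>R f0 + t *\<^sub>R fh" by (simp add: h algebra_simps)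
  then have "?J (f0 + h) \<le> (1 - t) * ?J f0 + t * ?J fh - l * t * (1 - t) * (norm (fh - f0))\<^sup>2"
    using huber_objective_strongly_convex[OF g t] by simp
  also have "\<dots> \<le> (1 - t) * ?J f0 + t * ?J f0 - 0"
    using est t l by (intro diff_mono add_mono mult_left_mono)
      (auto simp: huber_estimator_def is_arg_min_linorder)
  finally have J: "?J (f0 + h) \<le> ?J f0" by (simp add: algebra_simps)
  define A B E M c where "A = (\<Sum>i<n. huber \<gamma> (\<epsilon> i - x i \<bullet> h))" and "B = (\<Sum>i<n. huber \<gamma> (\<epsilon> i))"
    and "E = (\<Sum>i<n. huber_score \<gamma> (\<epsilon> i) * (x i \<bullet> h))"
    and "M = (\<Sum>i<n. (min \<bar>x i \<bullet> h\<bar> T)\<^sup>2 * (if \<bar>\<epsilon> i\<bar> \<le> \<gamma> / 2 then 1 else 0))"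
    and "c = 1 / real n"
  have "?J (f0 + h) = c * A + l * (norm (f0 + h))\<^sup>2"
    unfolding huber_objective_def A_def c_def
    by (intro arg_cong2[where f = "(+)"] arg_cong2[where f = "(*)"] sum.cong refl)
      (simp add: y inner_add_right inner_commute)
  moreover have "?J f0 = c * B + l * (norm f0)\<^sup>2"
    unfolding huber_objective_def B_def c_def
    by (intro arg_cong2[where f = "(+)"] arg_cong2[where f = "(*)"] sum.cong refl)
      (simp add: y inner_commute)
  moreover have "(norm (f0 + h))\<^sup>2 = (norm f0)\<^sup>2 + 2 * (f0 \<bullet> h) + (norm h)\<^sup>2"
    by (simp add: power2_norm_eq_inner inner_add_left inner_add_right inner_commute)
  ultimately have 1: "c * A - c * B + 2 * (l * (f0 \<bullet> h)) + l * (norm h)\<^sup>2 \<le> 0"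
    using J by (simp add: distrib_left)
  have "(\<Sum>i<n. (min \<bar>x i \<bullet> h\<bar> T)\<^sup>2 / 2 * (if \<bar>\<epsilon> i\<bar> \<le> \<gamma> / 2 then 1 else 0)) \<le>
     (\<Sum>i<n. huber \<gamma> (\<epsilon> i - x i \<bullet> h) - huber \<gamma> (\<epsilon> i) + huber_score \<gamma> (\<epsilon> i) * (x i \<bullet> h))"
    by (intro sum_mono huber_bregman_ge T)
  also have "\<dots> = A - B + E" by (simp add: A_def B_def E_def sum.distrib sum_subtractf)
  also have "(\<Sum>i<n. (min \<bar>x i \<bullet> h\<bar> T)\<^sup>2 / 2 * (if \<bar>\<epsilon> i\<bar> \<le> \<gamma> / 2 then 1 else 0)) = M / 2"
    by (simp add: M_def sum_divide_distrib)
  finally have "c * (M / 2) \<le> c * (A - B + E)" by (rule mult_left_mono) (simp add: c_def)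
  then have "c * M + 2 * l * (norm h)\<^sup>2 \<le> 2 * (c * E - 2 * (l * (f0 \<bullet> h)))"
    using 1 by (simp add: distrib_left right_diff_distrib)
  moreover have "((1 / real n) *\<^sub>R (\<Sum>i<n. huber_score \<gamma> (\<epsilon> i) *\<^sub>R x i) - (2 * l) *\<^sub>R f0) \<bullet> h
      = c * E - 2 * (l * (f0 \<bullet> h))"
    by (simp add: inner_diff_left inner_sum_left E_def c_def)
  ultimately show ?thesis by (simp add: M_def c_def)
qed

text \<open>The estimator is given pointwise as a minimiser, so its measurability has to be earned.
  A near-minimiser chosen from a fixed countable dense sequence is measurable, and strong convexity
  forces near-minimisers to converge to the minimiser.\<close>

lemma borel_measurable_huber_estimator:
  assumes X [measurable]: "\<And>i. Xs i \<in> borel_measurable M" and Y [measurable]: "\<And>i. ys i \<in> borel_measurable M"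
    and g: "\<gamma> \<ge> 0" and l: "l > 0"
    and est: "\<And>\<omega>. \<omega> \<in> space M \<Longrightarrow> huber_estimator n \<gamma> l (\<lambda>i. Xs i \<omega>) (\<lambda>i. ys i \<omega>) (fh \<omega>)"
  shows "fh \<in> borel_measurable M"
proof -
  obtain D :: "L2 set" where D: "countable D" "closure D = UNIV" using L2_countable_dense by blast
  have Dne: "D \<noteq> {}" using D by auto
  define d where "d = from_nat_into D"
  have ran_d: "range d = D" unfolding d_def by (rule range_from_nat_into[OF Dne D(1)])
  define J where "J \<omega> f = huber_objective n \<gamma> l (\<lambda>i. Xs i \<omega>) (\<lambda>i. ys i \<omega>) f" for \<omega> f
  have [measurable]: "huber \<gamma> \<in> borel_measurable borel"
    by (rule borel_measurable_continuous_onI[OF continuous_on_huber[OF g]])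
  have J_meas [measurable]: "(\<lambda>\<omega>. J \<omega> f) \<in> borel_measurable M" for f
    unfolding J_def huber_objective_def by measurable
  have J_cont: "continuous_on UNIV (J \<omega>)" for \<omega>
    unfolding J_def huber_objective_def
    by (intro continuous_intros continuous_on_compose2[OF continuous_on_huber[OF g]]) auto
  have J_min: "J \<omega> (fh \<omega>) \<le> J \<omega> f" if "\<omega> \<in> space M" for \<omega> f
    using est[OF that] by (simp add: J_def huber_estimator_def is_arg_min_linorder)
  have close: "\<exists>k. J \<omega> (d k) \<le> J \<omega> f + r" if "r > 0" for \<omega> f r
  proof -
    have "open (J \<omega> -` {..<J \<omega> f + r})" by (intro open_vimage J_cont) auto
    moreover have "f \<in> J \<omega> -` {..<J \<omega> f + r}" using that by simp
    ultimately have "D \<inter> (J \<omega> -` {..<J \<omega> f + r}) \<noteq> {}"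
      using D(2) by (metis IntI UNIV_I closure_iff_nhds_not_empty equals0D subset_refl inf_commute)
    then obtain f' where "f' \<in> range d" "J \<omega> f' < J \<omega> f + r" unfolding ran_d by auto
    then show ?thesis by (auto intro: less_imp_le)
  qed
  \<comment> \<open>Near-optimality is tested only against the dense sequence. This makes it a
    countable condition, and by continuity of the objective nothing is lost.\<close>
  define P where "P m \<omega> k \<longleftrightarrow> (\<forall>j. J \<omega> (d k) \<le> J \<omega> (d j) + 1 / real (Suc m))" for m \<omega> k
  define a where "a m \<omega> = (LEAST k. P m \<omega> k)" for m \<omega>
  have [measurable]: "a m \<in> measurable M (count_space UNIV)" for m
    unfolding a_def P_def by measurable
  have P: "P m \<omega> (a m \<omega>)" if "\<omega> \<in> space M" for m \<omega>
  proof -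
    obtain k where "J \<omega> (d k) \<le> J \<omega> (fh \<omega>) + 1 / real (Suc m)"
      using close[of "1 / real (Suc m)" \<omega> "fh \<omega>"] by auto
    then have "P m \<omega> k"
      unfolding P_def using J_min[OF that] by (meson add_right_mono order_trans)
    then show ?thesis unfolding a_def by (rule LeastI)
  qed
  have gap: "l * (norm (d (a m \<omega>) - fh \<omega>))\<^sup>2 \<le> 1 / real (Suc m)" if w: "\<omega> \<in> space M" for m \<omega>
  proof -
    have "J \<omega> (d (a m \<omega>)) \<le> J \<omega> (fh \<omega>) + 1 / real (Suc m) + r" if r: "r > 0" for r
    proof -
      obtain k where "J \<omega> (d k) \<le> J \<omega> (fh \<omega>) + r" using close[OF r] by blast
      then show ?thesis using P[OF w, of m] unfolding P_def by (smt (verit))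
    qed
    then have "J \<omega> (d (a m \<omega>)) \<le> J \<omega> (fh \<omega>) + 1 / real (Suc m)" by (rule field_le_epsilon)
    then show ?thesis
      using huber_estimator_gap[OF g est[OF w], of "d (a m \<omega>)"] unfolding J_def by linarith
  qed
  show ?thesis
  proof (rule borel_measurable_LIMSEQ_metric)
    show "(\<lambda>\<omega>. d (a m \<omega>)) \<in> borel_measurable M" for m
      by (rule measurable_compose[of "a m" M "count_space UNIV"]) auto
    fix \<omega> assume w: "\<omega> \<in> space M"
    have "(\<lambda>m. (norm (d (a m \<omega>) - fh \<omega>))\<^sup>2) \<longlonglongrightarrow> 0"
    proof (rule tendsto_sandwich[of "\<lambda>_. 0" _ _ "\<lambda>m. (1 / l) * (1 / real (Suc m))"])
      show "(\<lambda>m. (1 / l) * (1 / real (Suc m))) \<longlonglongrightarrow> 0"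
        using tendsto_mult[OF tendsto_const[of "1 / l"] LIMSEQ_inverse_real_of_nat] by (simp add: inverse_eq_divide)
      show "\<forall>\<^sub>F m in sequentially. (norm (d (a m \<omega>) - fh \<omega>))\<^sup>2 \<le> (1 / l) * (1 / real (Suc m))"
      proof (intro always_eventually allI)
        fix m
        have "x \<le> (1 / l) * c" if "l * x \<le> c" for x c :: real
          using that l by (simp add: field_simps)
        then show "(norm (d (a m \<omega>) - fh \<omega>))\<^sup>2 \<le> (1 / l) * (1 / real (Suc m))" using gap[OF w] by blast
      qed
    qed auto
    from tendsto_real_sqrt[OF this] have "(\<lambda>m. norm (d (a m \<omega>) - fh \<omega>)) \<longlonglongrightarrow> 0" by simp
    then show "(\<lambda>m. d (a m \<omega>)) \<longlonglongrightarrow> fh \<omega>"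
      by (simp add: tendsto_norm_zero_iff LIM_zero_iff)
  qed
qed

section \<open>Whitening, and a net for the effective dimension\<close>

lemma power2_norm_diff_le:
  fixes u w :: "'b::real_inner"
  shows "(norm (u - w))\<^sup>2 \<le> 2 * (norm u)\<^sup>2 + 2 * (norm w)\<^sup>2"
proof -
  have "(norm (u - w))\<^sup>2 + (norm (u + w))\<^sup>2 = 2 * (norm u)\<^sup>2 + 2 * (norm w)\<^sup>2"
    by (simp add: power2_norm_eq_inner inner_add_left inner_add_right inner_diff_left inner_diff_right inner_commute)
  then show ?thesis using zero_le_power2[of "norm (u + w)"] by linarith
qed

lemma power2_add_le: "((a::real) + b)\<^sup>2 \<le> 2 * a\<^sup>2 + 2 * b\<^sup>2"
  using power2_norm_diff_le[of a "- b"] by simp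

locale eigen_system =
  fixes s :: "nat \<Rightarrow> real" and e :: "nat \<Rightarrow> L2"
  assumes onb: "orthonormal_basis e" and s_pos: "\<And>j. s j > 0" and s_dec: "decseq s"
    and s_summable: "summable s"
begin

abbreviation reg_sqrt :: "real \<Rightarrow> L2 \<Rightarrow> L2" where
  "reg_sqrt l \<equiv> op_fun s e (\<lambda>x. sqrt (x + l))"

abbreviation reg_isqrt :: "real \<Rightarrow> L2 \<Rightarrow> L2" where
  "reg_isqrt l \<equiv> op_fun s e (\<lambda>x. 1 / sqrt (x + l))"

definition weight :: "real \<Rightarrow> nat \<Rightarrow> real" where
  "weight l j = s j / (s j + l)"

text \<open>The quadratic form of \<open>(\<Gamma> + l)\<^sup>-\<^sup>1 \<Gamma>\<close>, i.e. the second moment of the whitened covariate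
  \<open>(\<Gamma> + l)\<^sup>-\<^sup>1\<^sup>/\<^sup>2 X\<close> in direction \<open>k\<close>.\<close>

definition qform :: "real \<Rightarrow> L2 \<Rightarrow> real" where
  "qform l k = (\<Sum>j. weight l j * (k \<bullet> e j)\<^sup>2)"

lemma s_le: "s j \<le> s 0" using s_dec by (simp add: decseq_def)

lemma reg_sqrt_bound: "l > 0 \<Longrightarrow> \<bar>sqrt (s j + l)\<bar> \<le> sqrt (s 0 + l)"
  using s_le[of j] s_pos[of j] by simp

lemma reg_isqrt_bound: "l > 0 \<Longrightarrow> \<bar>1 / sqrt (s j + l)\<bar> \<le> 1 / sqrt l"
  using s_pos[of j] by (simp add: frac_le)

lemmas reg_sqrt_eqs = op_fun_linear_bounded[where \<phi> = "\<lambda>x. sqrt (x + l)" and s = s, OF onb reg_sqrt_bound] for l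
lemmas reg_isqrt_eqs = op_fun_linear_bounded[where \<phi> = "\<lambda>x. 1 / sqrt (x + l)" and s = s, OF onb reg_isqrt_bound] for l

lemma reg_sqrt_coord: "l > 0 \<Longrightarrow> reg_sqrt l f \<bullet> e j = sqrt (s j + l) * (f \<bullet> e j)"
  using op_fun_coord[where \<phi> = "\<lambda>x. sqrt (x + l)" and s = s, OF onb reg_sqrt_bound] by simp

lemma reg_isqrt_coord: "l > 0 \<Longrightarrow> reg_isqrt l f \<bullet> e j = (f \<bullet> e j) / sqrt (s j + l)"
  using op_fun_coord[where \<phi> = "\<lambda>x. 1 / sqrt (x + l)" and s = s, OF onb reg_isqrt_bound] by simp

lemma borel_measurable_reg_sqrt: "l > 0 \<Longrightarrow> reg_sqrt l \<in> borel_measurable borel"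
  using borel_measurable_op_fun[where \<phi> = "\<lambda>x. sqrt (x + l)" and s = s, OF onb reg_sqrt_bound] by simp

lemma borel_measurable_reg_isqrt: "l > 0 \<Longrightarrow> reg_isqrt l \<in> borel_measurable borel"
  using borel_measurable_op_fun[where \<phi> = "\<lambda>x. 1 / sqrt (x + l)" and s = s, OF onb reg_isqrt_bound] by simp

lemma reg_isqrt_sqrt: "l > 0 \<Longrightarrow> reg_isqrt l (reg_sqrt l f) = f"
  by (rule orthonormal_eqI[OF onb]) (use s_pos in \<open>simp add: reg_sqrt_coord reg_isqrt_coord add_pos_pos less_imp_neq[symmetric]\<close>)

lemma weight_bounds: "l > 0 \<Longrightarrow> 0 < weight l j" "l > 0 \<Longrightarrow> weight l j < 1" "l > 0 \<Longrightarrow> weight l j \<le> s j / l"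
  using s_pos[of j] by (auto simp: weight_def field_simps)

lemma weight_antimono: "l > 0 \<Longrightarrow> i \<le> j \<Longrightarrow> weight l j \<le> weight l i"
  using s_pos[of j] s_pos[of i] decseqD[OF s_dec, of i j] by (simp add: weight_def field_simps)

lemma weight_summable: "l > 0 \<Longrightarrow> summable (weight l)"
  by (rule summable_comparison_test'[OF summable_divide[OF s_summable, of l]])
    (use weight_bounds in \<open>simp add: less_imp_le\<close>)

lemma weight_sums: "l > 0 \<Longrightarrow> weight l sums eff_dim s l"
  using summable_sums[OF weight_summable] unfolding eff_dim_def weight_def[symmetric] .

lemma weight_le_eff_dim: "l > 0 \<Longrightarrow> weight l j \<le> eff_dim s l"
  using sum_le_suminf[OF weight_summable, of l "{j}"] weight_sums[of l] weight_bounds[of l]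
  by (simp add: sums_iff less_imp_le)

lemma eff_dim_pos: "l > 0 \<Longrightarrow> eff_dim s l > 0"
  using weight_le_eff_dim[of l 0] weight_bounds[of l 0] by linarith

lemma eff_dim_le_trace: "l > 0 \<Longrightarrow> eff_dim s l \<le> suminf s / l"
  by (rule sums_le[OF _ weight_sums sums_divide[OF summable_sums[OF s_summable]]]) (auto simp: weight_bounds)

lemma qform_sums: "l > 0 \<Longrightarrow> (\<lambda>j. weight l j * (k \<bullet> e j)\<^sup>2) sums qform l k"
  unfolding qform_def
  by (intro summable_sums summable_comparison_test'[OF sums_summable[OF parseval[OF onb, of k]]])
    (use weight_bounds[of l] in \<open>auto intro!: mult_left_le_one_le simp: less_imp_le\<close>)

lemma qform_nonneg: "l > 0 \<Longrightarrow> 0 \<le> qform l k"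
  by (rule sums_le[OF _ sums_zero qform_sums]) (use weight_bounds in \<open>auto simp: less_imp_le\<close>)

lemma qform_le: "l > 0 \<Longrightarrow> qform l k \<le> (norm k)\<^sup>2"
  by (rule sums_le[OF _ qform_sums parseval[OF onb]])
    (use weight_bounds[of l] in \<open>auto intro!: mult_left_le_one_le simp: less_imp_le\<close>)

lemma qform_diff_le: "l > 0 \<Longrightarrow> qform l k \<le> 2 * qform l k' + 2 * qform l (k - k')"
proof (rule sums_le[OF _ qform_sums sums_add[OF sums_mult[OF qform_sums] sums_mult[OF qform_sums]]])
  fix j assume l: "l > 0"
  have "(k \<bullet> e j)\<^sup>2 \<le> 2 * (k' \<bullet> e j)\<^sup>2 + 2 * ((k - k') \<bullet> e j)\<^sup>2"
    using power2_add_le[of "k' \<bullet> e j" "(k - k') \<bullet> e j"] by (simp add: inner_diff_left)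
  then have "weight l j * (k \<bullet> e j)\<^sup>2 \<le> weight l j * (2 * (k' \<bullet> e j)\<^sup>2 + 2 * ((k - k') \<bullet> e j)\<^sup>2)"
    using weight_bounds(1)[OF l, of j] by (intro mult_left_mono) auto
  then show "weight l j * (k \<bullet> e j)\<^sup>2 \<le> 2 * (weight l j * (k' \<bullet> e j)\<^sup>2) + 2 * (weight l j * ((k - k') \<bullet> e j)\<^sup>2)"
    by (simp add: algebra_simps)
qed

lemma qform_le_weight0: "l > 0 \<Longrightarrow> qform l k \<le> weight l 0 * (norm k)\<^sup>2"
  by (rule sums_le[OF _ qform_sums sums_mult[OF parseval[OF onb]]])
    (auto intro!: mult_right_mono simp: weight_antimono)

text \<open>Per coordinate this is \<open>1 - s / (s + l) = l / (s + l)\<close>: in whitened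
  coordinates the penalty is exactly the complement of the covariance form.\<close>

lemma reg_sqrt_norm_split:
  assumes l: "l > 0"
  shows "l * (norm h)\<^sup>2 = (norm (reg_sqrt l h))\<^sup>2 - qform l (reg_sqrt l h)"
proof -
  have "(\<lambda>j. (reg_sqrt l h \<bullet> e j)\<^sup>2 - weight l j * (reg_sqrt l h \<bullet> e j)\<^sup>2) sums
     ((norm (reg_sqrt l h))\<^sup>2 - qform l (reg_sqrt l h))"
    by (intro sums_diff parseval[OF onb] qform_sums l)
  moreover have "(reg_sqrt l h \<bullet> e j)\<^sup>2 - weight l j * (reg_sqrt l h \<bullet> e j)\<^sup>2 = l * (h \<bullet> e j)\<^sup>2" for j
  proof -
    have "s j + l > 0" using s_pos[of j] l by simp
    then show ?thesis using l by (simp add: reg_sqrt_coord weight_def power_mult_distrib field_simps)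
  qed
  ultimately show ?thesis using sums_mult[OF parseval[OF onb, of h], of l] by (simp add: sums_unique2)
qed

text \<open>Every index before the cutoff has weight above 1/64 and so uses up at least 1/64 of the
  effective dimension, which is the sum of the weights.\<close>

lemma weight_cutoff:
  assumes l: "l > 0"
  obtains d where "\<And>j. j \<ge> d \<Longrightarrow> weight l j \<le> 1/64" and "real d \<le> 64 * eff_dim s l"
proof -
  have "weight l \<longlonglongrightarrow> 0" by (rule summable_LIMSEQ_zero[OF weight_summable[OF l]])
  then have "\<forall>\<^sub>F j in sequentially. weight l j < 1/64" by (rule order_tendstoD) simp
  then have ex: "\<exists>j. weight l j \<le> 1/64" by (auto simp: eventually_sequentially intro: less_imp_le)
  define d where "d = (LEAST j. weight l j \<le> 1/64)"
  have "weight l d \<le> 1/64" unfolding d_def by (rule LeastI_ex[OF ex])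
  then have 1: "weight l j \<le> 1/64" if "j \<ge> d" for j using weight_antimono[OF l that] by linarith
  have "(\<Sum>j<d. 1/64) \<le> (\<Sum>j<d. weight l j)"
  proof (rule sum_mono)
    fix j assume "j \<in> {..<d}"
    then have "\<not> weight l j \<le> 1/64" unfolding d_def by (auto dest: not_less_Least)
    then show "1/64 \<le> weight l j" by linarith
  qed
  also have "\<dots> \<le> eff_dim s l"
    using sum_le_suminf[OF weight_summable[OF l], of "{..<d}"] weight_sums[OF l] weight_bounds[OF l]
    by (simp add: sums_iff less_imp_le)
  finally have "real d \<le> 64 * eff_dim s l" by simp
  with 1 show ?thesis by (rule that)
qed

text \<open>Since the quadratic form is small on the tail coordinates, a grid on the leading
  \<open>O(\<N>(l))\<close> coordinates is a net of the unit ball.\<close>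

lemma finite_net:
  assumes l: "l > 0"
  obtains W where "finite W" "real (card W) \<le> exp (65536 * (eff_dim s l)\<^sup>2)"
    and "\<And>k'. k' \<in> W \<Longrightarrow> (norm k')\<^sup>2 \<le> 6"
    and "\<And>k. norm k \<le> 1 \<Longrightarrow> \<exists>k'\<in>W. qform l (k - k') \<le> 1/32 \<and> (norm (k - k'))\<^sup>2 \<le> 2"
proof -
  obtain d where d: "\<And>j. j \<ge> d \<Longrightarrow> weight l j \<le> 1/64" and dN: "real d \<le> 64 * eff_dim s l"
    using weight_cutoff[OF l] by blast
  define G where "G = PiE {..<d} (\<lambda>_. {- 8 * int d .. 8 * int d})"
  \<comment> \<open>The mesh \<open>1 / (8 * d)\<close> makes the rounding errors of d coordinates
    add up to at most 1/64 in squared norm.\<close>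
  define p where "p g = (\<Sum>j<d. (real_of_int (g j) / (8 * real d)) *\<^sub>R e j)" for g :: "nat \<Rightarrow> int"
  \<comment> \<open>An approximant of a unit-ball vector at squared distance at most 2 has squared
    norm at most \<open>2 * 1 + 2 * 2 = 6\<close>. Discarding larger grid points lets one truncation
    level serve the whole net.\<close>
  define W where "W = {k' \<in> p ` G. (norm k')\<^sup>2 \<le> 6}"
  have finG: "finite G" unfolding G_def by (intro finite_PiE) auto
  have "card W \<le> card (p ` G)" unfolding W_def by (rule card_mono) (use finG in auto)
  also have "\<dots> \<le> card G" by (rule card_image_le[OF finG])
  also have "card G = (16 * d + 1) ^ d" unfolding G_def by (subst card_PiE) (auto simp: nat_add_distrib nat_mult_distrib)
  finally have "real (card W) \<le> (real (16 * d + 1)) ^ d" by (metis of_nat_le_iff of_nat_power)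
  also have "\<dots> \<le> exp (16 * real d) ^ d"
    using exp_ge_add_one_self[of "16 * real d"] by (intro power_mono) (auto simp: add.commute)
  also have "\<dots> = exp (16 * (real d)\<^sup>2)" by (simp add: exp_of_nat_mult[symmetric] power2_eq_square mult_ac)
  also have "\<dots> \<le> exp (16 * (64 * eff_dim s l)\<^sup>2)" using power_mono[OF dN, of 2] by simp
  finally have card: "real (card W) \<le> exp (65536 * (eff_dim s l)\<^sup>2)" by (simp add: power_mult_distrib)
  have net: "\<exists>k'\<in>W. qform l (k - k') \<le> 1/32 \<and> (norm (k - k'))\<^sup>2 \<le> 2" if k: "norm k \<le> 1" for k
  proof -
    define g where "g = restrict (\<lambda>j. \<lfloor>(k \<bullet> e j) * (8 * real d)\<rfloor>) {..<d}"
    have "\<bar>k \<bullet> e j\<bar> \<le> 1" for j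
    proof -
      have "norm (e j) = 1" using orthonormal_basisD(1)[OF onb, of j j] by (simp add: norm_eq_sqrt_inner)
      then show ?thesis using Cauchy_Schwarz_ineq2[of k "e j"] k by simp
    qed
    then have kj: "- 1 \<le> k \<bullet> e j" "k \<bullet> e j \<le> 1" for j by (auto simp: abs_le_iff minus_le_iff)
    have gG: "g \<in> G"
    proof -
      have "- 8 * int d \<le> \<lfloor>(k \<bullet> e j) * (8 * real d)\<rfloor> \<and> \<lfloor>(k \<bullet> e j) * (8 * real d)\<rfloor> \<le> 8 * int d" for j
      proof
        have "(-1) * (8 * real d) \<le> (k \<bullet> e j) * (8 * real d)" by (intro mult_right_mono kj) simp
        then show "- 8 * int d \<le> \<lfloor>(k \<bullet> e j) * (8 * real d)\<rfloor>" by (simp add: le_floor_iff)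
        have "(k \<bullet> e j) * (8 * real d) \<le> 1 * (8 * real d)" by (intro mult_right_mono kj) simp
        then show "\<lfloor>(k \<bullet> e j) * (8 * real d)\<rfloor> \<le> 8 * int d" by (simp add: floor_le_iff)
      qed
      then show ?thesis by (auto simp: G_def g_def)
    qed
    have pc: "p g \<bullet> e j = (if j < d then real_of_int (g j) / (8 * real d) else 0)" for j
      unfolding p_def by (subst orthonormal_partial_sum_inner[OF onb]) auto
    have low: "((k - p g) \<bullet> e j)\<^sup>2 \<le> (1 / (8 * real d))\<^sup>2" if j: "j < d" for j
    proof -
      have dp: "8 * real d > 0" using j by simp
      have "\<bar>(k \<bullet> e j) * (8 * real d) - real_of_int (g j)\<bar> \<le> 1"
        using j unfolding g_def by (simp; linarith)
      then have "\<bar>(k \<bullet> e j) - real_of_int (g j) / (8 * real d)\<bar> \<le> 1 / (8 * real d)"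
        using dp by (simp add: field_simps abs_le_iff)
      then show ?thesis using j by (simp add: inner_diff_left pc abs_le_square_iff[symmetric])
    qed
    have high: "(k - p g) \<bullet> e j = k \<bullet> e j" if "\<not> j < d" for j
      using that by (simp add: inner_diff_left pc)
    have grid: "(\<lambda>j. if j \<in> {..<d} then (1 / (8 * real d))\<^sup>2 else 0) sums (\<Sum>j<d. (1 / (8 * real d))\<^sup>2)"
      by (rule sums_If_finite_set) simp
    \<comment> \<open>For d = 0 the mesh is a division by zero, but the sum is then empty.\<close>
    have grid_le: "(\<Sum>j<d. (1 / (8 * real d))\<^sup>2) \<le> 1 / 64"
      by (cases "d = 0") (auto simp: power2_eq_square field_simps)
    have k2: "(norm k)\<^sup>2 \<le> 1" using k by (simp add: power_le_one)
    have "(norm (k - p g))\<^sup>2 \<le> (\<Sum>j<d. (1 / (8 * real d))\<^sup>2) + (norm k)\<^sup>2"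
      by (rule sums_le[OF _ parseval[OF onb] sums_add[OF grid parseval[OF onb]]])
        (use low high in \<open>auto intro: add_increasing2\<close>)
    then have n2: "(norm (k - p g))\<^sup>2 \<le> 2" using grid_le k2 by linarith
    have "qform l (k - p g) \<le> (\<Sum>j<d. (1 / (8 * real d))\<^sup>2) + 1 / 64 * (norm k)\<^sup>2"
    proof (rule sums_le[OF _ qform_sums[OF l] sums_add[OF grid sums_mult[OF parseval[OF onb]]]])
      fix j
      show "weight l j * ((k - p g) \<bullet> e j)\<^sup>2 \<le>
        (if j \<in> {..<d} then (1 / (8 * real d))\<^sup>2 else 0) + 1 / 64 * (k \<bullet> e j)\<^sup>2"
      proof (cases "j < d")
        case True
        have "weight l j * ((k - p g) \<bullet> e j)\<^sup>2 \<le> 1 * (1 / (8 * real d))\<^sup>2"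
          using weight_bounds[OF l, of j] low[OF True] by (intro mult_mono) auto
        then show ?thesis using True by (simp add: add_increasing2)
      next
        case False
        then show ?thesis
          using mult_right_mono[OF d[of j], of "(k \<bullet> e j)\<^sup>2"] by (simp add: high)
      qed
    qed
    then have q: "qform l (k - p g) \<le> 1/32" using grid_le k2 by linarith
    have "(norm (p g))\<^sup>2 \<le> 6"
      using power2_norm_diff_le[of k "k - p g"] n2 k2 by simp
    then have "p g \<in> W" using gG by (simp add: W_def)
    then show ?thesis using q n2 by blast
  qed
  show ?thesis
    by (rule that[of W]) (use finG card net in \<open>auto simp: W_def\<close>)
qed

text \<open>The capped form is 1-Lipschitz under the square, so moving from k to its net point costs
  only the uncapped empirical form of the difference. That form is controlled by
  \<open>upper\<close>, since the difference has small \<open>qform\<close> and bounded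
  norm.\<close>

lemma curvature_from_net:
  fixes z :: "nat \<Rightarrow> L2" and b :: "nat \<Rightarrow> real"
  assumes l: "l > 0" and b: "\<And>i. 0 \<le> b i \<and> b i \<le> 1"
    and cover: "\<And>k. norm k \<le> 1 \<Longrightarrow> \<exists>k'\<in>W. qform l (k - k') \<le> 1/32 \<and> (norm (k - k'))\<^sup>2 \<le> 2"
    and net: "\<And>k'. k' \<in> W \<Longrightarrow>
      (1 / real n) * (\<Sum>i<n. (min \<bar>z i \<bullet> k'\<bar> \<tau>)\<^sup>2 * b i) \<ge> qform l k' / 2 - 1/32"
    and upper: "\<And>k. (1 / real n) * (\<Sum>i<n. (z i \<bullet> k)\<^sup>2) \<le> qform l k + (norm k)\<^sup>2 / 512"
    and tau: "\<tau> \<ge> 0" and k: "norm k = 1"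
  shows "(1 / real n) * (\<Sum>i<n. (min \<bar>z i \<bullet> k\<bar> \<tau>)\<^sup>2 * b i) + 2 * (1 - qform l k) \<ge> 1/16"
proof -
  obtain k' where k': "k' \<in> W" "qform l (k - k') \<le> 1/32" "(norm (k - k'))\<^sup>2 \<le> 2"
    using cover[of k] k by auto
  define m where "m k = (1 / real n) * (\<Sum>i<n. (min \<bar>z i \<bullet> k\<bar> \<tau>)\<^sup>2 * b i)" for k
  have "m k' \<le> (1 / real n) * (\<Sum>i<n. 2 * ((min \<bar>z i \<bullet> k\<bar> \<tau>)\<^sup>2 * b i) + 2 * (z i \<bullet> (k - k'))\<^sup>2)"
    unfolding m_def
  proof (intro mult_left_mono sum_mono)
    fix i
    define u u' where "u = z i \<bullet> k" and "u' = z i \<bullet> k'"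
    have "min \<bar>u'\<bar> \<tau> \<le> min \<bar>u\<bar> \<tau> + \<bar>u - u'\<bar>" by auto
    then have "(min \<bar>u'\<bar> \<tau>)\<^sup>2 \<le> (min \<bar>u\<bar> \<tau> + \<bar>u - u'\<bar>)\<^sup>2" using tau by (intro power_mono) auto
    also have "\<dots> \<le> 2 * (min \<bar>u\<bar> \<tau>)\<^sup>2 + 2 * (u - u')\<^sup>2"
      using power2_add_le[of "min \<bar>u\<bar> \<tau>" "\<bar>u - u'\<bar>"] by simp
    finally have "(min \<bar>u'\<bar> \<tau>)\<^sup>2 * b i \<le> (2 * (min \<bar>u\<bar> \<tau>)\<^sup>2 + 2 * (u - u')\<^sup>2) * b i"
      using b[of i] by (intro mult_right_mono) auto
    also have "\<dots> \<le> 2 * ((min \<bar>u\<bar> \<tau>)\<^sup>2 * b i) + 2 * (u - u')\<^sup>2"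
      using b[of i] mult_left_mono[of "b i" 1 "2 * (u - u')\<^sup>2"] by (simp add: algebra_simps)
    finally show "(min \<bar>z i \<bullet> k'\<bar> \<tau>)\<^sup>2 * b i \<le> 2 * ((min \<bar>z i \<bullet> k\<bar> \<tau>)\<^sup>2 * b i) + 2 * (z i \<bullet> (k - k'))\<^sup>2"
      by (simp add: u_def u'_def inner_diff_right)
  qed simp
  also have "\<dots> = 2 * m k + 2 * ((1 / real n) * (\<Sum>i<n. (z i \<bullet> (k - k'))\<^sup>2))"
    unfolding m_def sum.distrib sum_distrib_left[symmetric] by (simp add: algebra_simps)
  finally have 1: "m k' \<le> 2 * m k + 2 * ((1 / real n) * (\<Sum>i<n. (z i \<bullet> (k - k'))\<^sup>2))" .
  have 2: "qform l k \<le> 2 * qform l k' + 2 * qform l (k - k')" by (rule qform_diff_le[OF l])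
  have 3: "qform l k \<le> 1" using qform_le[OF l, of k] k by simp
  show ?thesis
    \<comment> \<open>The estimates combine to \<open>m k \<ge> qform l k / 8 - 15 / 256\<close>.
      With the penalty added, the worst case is \<open>qform l k = 1\<close>, and 17/256 remains,
      which exceeds 1/16.\<close>
    using 1 2 3 net[OF k'(1)] upper[of "k - k'"] k'(2,3) unfolding m_def[symmetric] by argo
qed

text \<open>With r' the smaller of r and 1/2, the multiplier of the bias splits into
  \<open>s powr (r - r')\<close>, bounded by its value at the largest eigenvalue, and
  \<open>s powr r' / sqrt (s + l)\<close>, bounded by \<open>l powr (r' - 1/2)\<close>. The last
  step needs a nonpositive exponent, which is why smoothness beyond 1/2 brings no further gain
  here.\<close>

lemma source_bias:
  assumes src: "source_condition s e r f0"
  obtains C where "C > 0" "\<And>l. l > 0 \<Longrightarrow> l * norm (reg_isqrt l f0) \<le> C * l powr (min r (1/2) + 1/2)"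
proof -
  obtain g where g: "f0 = op_fun s e (\<lambda>x. x powr r) g" and r: "r \<ge> 0"
    using src by (auto simp: source_condition_def)
  have b: "\<bar>s j powr r\<bar> \<le> s 0 powr r" for j using s_le[of j] s_pos[of j] r by (simp add: powr_mono2)
  have f0: "f0 \<bullet> e j = s j powr r * (g \<bullet> e j)" for j
    unfolding g using op_fun_coord[where \<phi> = "\<lambda>x. x powr r" and s = s, OF onb b] by simp
  define r' where "r' = min r (1/2)"
  have r': "0 \<le> r'" "r' \<le> 1/2" "r' \<le> r" using r by (auto simp: r'_def)
  \<comment> \<open>The added ones keep C positive even when g = 0.\<close>
  define C where "C = (s 0 powr (r - r') + 1) * (norm g + 1)"
  have C: "C > 0" unfolding C_def by (intro mult_pos_pos add_nonneg_pos) auto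
  have "l * norm (reg_isqrt l f0) \<le> C * l powr (r' + 1/2)" if l: "l > 0" for l
  proof -
    have mult: "\<bar>s j powr r / sqrt (s j + l)\<bar> \<le> s 0 powr (r - r') * l powr (r' - 1/2)" for j
    proof -
      have sl: "s j + l > 0" using s_pos[of j] l by simp
      have "s j powr r / sqrt (s j + l) = s j powr (r - r') * (s j powr r' * (s j + l) powr (- (1/2)))"
      proof -
        have "s j powr r = s j powr (r - r') * s j powr r'"
          unfolding powr_add[symmetric] by simp
        moreover have "(s j + l) powr (- (1/2)) = 1 / sqrt (s j + l)"
          by (simp only: powr_minus powr_half_sqrt[OF less_imp_le[OF sl]] inverse_eq_divide)
        ultimately show ?thesis by simp
      qed
      also have "s j powr r' * (s j + l) powr (- (1/2)) \<le> (s j + l) powr r' * (s j + l) powr (- (1/2))"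
        using s_pos[of j] l r' by (intro mult_right_mono powr_mono2) auto
      also have "\<dots> = (s j + l) powr (r' - 1/2)" by (simp add: powr_add[symmetric])
      also have "\<dots> \<le> l powr (r' - 1/2)" using s_pos[of j] l r' by (intro powr_mono2') auto
      finally have "s j powr r / sqrt (s j + l) \<le> s j powr (r - r') * l powr (r' - 1/2)"
        by (simp add: mult_left_mono)
      also have "\<dots> \<le> s 0 powr (r - r') * l powr (r' - 1/2)"
        using s_pos[of j] s_le[of j] r' by (intro mult_right_mono powr_mono2) auto
      finally show ?thesis using sl by simp
    qed
    define A where "A = s 0 powr (r - r') * l powr (r' - 1/2)"
    have "(norm (reg_isqrt l f0))\<^sup>2 \<le> (A * norm g)\<^sup>2"
    proof (rule sums_le[OF _ parseval[OF onb]])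
      show "(\<lambda>j. A\<^sup>2 * (g \<bullet> e j)\<^sup>2) sums (A * norm g)\<^sup>2"
        unfolding power_mult_distrib by (intro sums_mult parseval[OF onb])
      fix j
      have "(reg_isqrt l f0 \<bullet> e j)\<^sup>2 = (s j powr r / sqrt (s j + l))\<^sup>2 * (g \<bullet> e j)\<^sup>2"
        using l by (simp add: reg_isqrt_coord f0 power_mult_distrib power_divide)
      also have "\<dots> \<le> A\<^sup>2 * (g \<bullet> e j)\<^sup>2"
        using mult[of j] unfolding A_def[symmetric]
        by (intro mult_right_mono) (auto intro: power2_mono)
      finally show "(reg_isqrt l f0 \<bullet> e j)\<^sup>2 \<le> A\<^sup>2 * (g \<bullet> e j)\<^sup>2" .
    qed
    then have "norm (reg_isqrt l f0) \<le> A * norm g"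
      by (rule power2_le_imp_le) (auto simp: A_def)
    then have "l * norm (reg_isqrt l f0) \<le> l * (A * norm g)" using l by simp
    also have "\<dots> = (s 0 powr (r - r') * norm g) * (l powr 1 * l powr (r' - 1/2))"
      using l by (simp add: A_def mult_ac)
    also have "l powr 1 * l powr (r' - 1/2) = l powr (r' + 1/2)" 
      unfolding powr_add[symmetric] by (rule arg_cong[where f = "\<lambda>x. l powr x"]) simp
    also have "s 0 powr (r - r') * norm g * l powr (r' + 1/2) \<le> C * l powr (r' + 1/2)"
      unfolding C_def by (intro mult_right_mono mult_mono) auto
    finally show ?thesis .
  qed
  with C show ?thesis unfolding r'_def by (rule that)
qed

end

section \<open>Moments of the whitened covariates\<close>

text \<open>Jensen's inequality for a discrete measure of total mass N, obtained by summing the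
  supporting line at the mean \<open>S / N\<close>. It is stated in \<open>ennreal\<close> because
  the right-hand series may diverge.\<close>

lemma weighted_tangent_jensen:
  fixes w x :: "nat \<Rightarrow> real" and g :: "real \<Rightarrow> real"
  assumes w: "\<And>j. w j \<ge> 0" "w sums N" and N: "N > 0"
    and x: "\<And>j. x j \<ge> 0" "(\<lambda>j. w j * x j) sums S"
    and tangent: "\<And>u. u \<ge> 0 \<Longrightarrow> g u \<ge> g (S / N) + c * (u - S / N)"
    and g: "\<And>u. u \<ge> 0 \<Longrightarrow> g u \<ge> 0"
  shows "ennreal (N * g (S / N)) \<le> (\<Sum>j. ennreal (w j * g (x j)))"
proof (cases "(\<Sum>j. ennreal (w j * g (x j))) = \<top>")
  case False
  have nn: "0 \<le> w j * g (x j)" for j using w(1)[of j] g[OF x(1)[of j]] by simp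
  have sm: "summable (\<lambda>j. w j * g (x j))"
    by (rule summable_suminf_not_top[OF nn False])
  have "N * g (S / N) \<le> (\<Sum>j. w j * g (x j))"
  proof (rule sums_le[OF _ _ summable_sums[OF sm]])
    have "(\<lambda>j. (g (S / N) - c * (S / N)) * w j + c * (w j * x j)) sums
        ((g (S / N) - c * (S / N)) * N + c * S)"
      by (intro sums_add sums_mult w x)
    then show "(\<lambda>j. (g (S / N) - c * (S / N)) * w j + c * (w j * x j)) sums (N * g (S / N))"
      using N by (simp add: field_simps)
    fix j
    have "w j * (g (S / N) + c * (x j - S / N)) \<le> w j * g (x j)"
      by (intro mult_left_mono tangent x w)
    then show "(g (S / N) - c * (S / N)) * w j + c * (w j * x j) \<le> w j * g (x j)"
      by (simp add: algebra_simps)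
  qed
  then show ?thesis by (subst suminf_ennreal2[OF nn sm]) (rule ennreal_leI)
qed simp

text \<open>The interface between the sampling model and the estimates: q stands for 1 plus the
  smaller of \<kappa> and 1, and K bounds the kurtosis in every direction. The conditional noise
  assumptions appear integrated against functions of the covariate, so that no conditional
  expectation occurs later.\<close>

locale regression = prob_space M + eigen_system s e
  for M :: "'w measure" and s :: "nat \<Rightarrow> real" and e :: "nat \<Rightarrow> L2" +
  fixes X :: "nat \<Rightarrow> 'w \<Rightarrow> L2" and \<epsilon> :: "nat \<Rightarrow> 'w \<Rightarrow> real" and q v K :: real
  assumes ind: "indep_vars (\<lambda>_. borel) (\<lambda>i \<omega>. (X i \<omega>, \<epsilon> i \<omega>)) UNIV"
    and q: "1 < q" "q \<le> 2" and v: "v > 0" and K: "K > 0"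
    and X_sq: "\<And>i. integrable M (\<lambda>\<omega>. (norm (X i \<omega>))\<^sup>2)"
    and X_second: "\<And>i f. (\<lambda>j. s j * (f \<bullet> e j)\<^sup>2) sums expectation (\<lambda>\<omega>. (X i \<omega> \<bullet> f)\<^sup>2)"
    and X_fourth: "\<And>i f. integrable M (\<lambda>\<omega>. (X i \<omega> \<bullet> f) ^ 4)"
      "\<And>i f. expectation (\<lambda>\<omega>. (X i \<omega> \<bullet> f) ^ 4) \<le> K * (expectation (\<lambda>\<omega>. (X i \<omega> \<bullet> f)\<^sup>2))\<^sup>2"
    and noise: "\<And>i F. F \<in> borel_measurable borel \<Longrightarrow>
      (\<integral>\<^sup>+\<omega>. F (X i \<omega>) * ennreal (\<bar>\<epsilon> i \<omega>\<bar> powr q) \<partial>M) \<le> ennreal v * (\<integral>\<^sup>+\<omega>. F (X i \<omega>) \<partial>M)"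
    and noise_mean: "\<And>i k. integrable M (\<lambda>\<omega>. (X i \<omega> \<bullet> k) * \<epsilon> i \<omega>)"
      "\<And>i k. expectation (\<lambda>\<omega>. (X i \<omega> \<bullet> k) * \<epsilon> i \<omega>) = 0"
begin

lemma rv_pair: "random_variable borel (\<lambda>\<omega>. (X i \<omega>, \<epsilon> i \<omega>))"
  using ind by (auto simp: indep_vars_def)

lemma X_meas [measurable]: "random_variable borel (X i)"
  using measurable_compose[OF rv_pair, of fst borel] by (simp add: borel_prod[symmetric])

lemma eps_meas [measurable]: "random_variable borel (\<epsilon> i)"
  using measurable_compose[OF rv_pair, of snd borel] by (simp add: borel_prod[symmetric])

lemma indep_image:
  assumes "case_prod g \<in> borel_measurable (borel \<Otimes>\<^sub>M borel)"
  shows "indep_vars (\<lambda>_. borel) (\<lambda>i \<omega>. g (X i \<omega>) (\<epsilon> i \<omega>)) UNIV"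
  using indep_vars_compose2[OF ind, of "\<lambda>_. case_prod g" "\<lambda>_. borel"] assms by (simp add: borel_prod)

section \<open>Whitened covariates and their directional moments\<close>

definition z :: "real \<Rightarrow> nat \<Rightarrow> 'w \<Rightarrow> L2" where
  "z l i \<omega> = reg_isqrt l (X i \<omega>)"

definition calm :: "real \<Rightarrow> nat \<Rightarrow> 'w \<Rightarrow> real" where
  "calm \<gamma> i \<omega> = (if \<bar>\<epsilon> i \<omega>\<bar> \<le> \<gamma> / 2 then 1 else 0)"

lemma reg_isqrt_meas [measurable]: "l > 0 \<Longrightarrow> reg_isqrt l \<in> borel_measurable borel"
  by (rule borel_measurable_reg_isqrt)

lemma tens_meas [measurable]: "tens e \<in> borel_measurable borel"
  by (rule borel_measurable_tens[OF onb])

lemma z_meas: "l > 0 \<Longrightarrow> random_variable borel (z l i)"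
  unfolding z_def by (rule measurable_compose[OF X_meas borel_measurable_reg_isqrt])

lemma z_inner: "l > 0 \<Longrightarrow> z l i \<omega> \<bullet> k = X i \<omega> \<bullet> reg_isqrt l k"
  unfolding z_def by (rule reg_isqrt_eqs)

lemma X_inner_sq_integrable: "integrable M (\<lambda>\<omega>. (X i \<omega> \<bullet> f)\<^sup>2)"
proof (rule Bochner_Integration.integrable_bound)
  show "integrable M (\<lambda>\<omega>. (norm f)\<^sup>2 * (norm (X i \<omega>))\<^sup>2)" using X_sq by simp
  have "(x \<bullet> f)\<^sup>2 \<le> (norm f)\<^sup>2 * (norm x)\<^sup>2" for x
    using Cauchy_Schwarz_ineq[of x f] by (simp add: power2_norm_eq_inner mult.commute)
  then show "AE \<omega> in M. norm ((X i \<omega> \<bullet> f)\<^sup>2) \<le> norm ((norm f)\<^sup>2 * (norm (X i \<omega>))\<^sup>2)" by simp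
qed simp

lemma z_second:
  assumes l: "l > 0"
  shows "integrable M (\<lambda>\<omega>. (z l i \<omega> \<bullet> k)\<^sup>2)" "expectation (\<lambda>\<omega>. (z l i \<omega> \<bullet> k)\<^sup>2) = qform l k"
proof -
  show "integrable M (\<lambda>\<omega>. (z l i \<omega> \<bullet> k)\<^sup>2)" using X_inner_sq_integrable by (simp add: z_inner l)
  have "s j * (reg_isqrt l k \<bullet> e j)\<^sup>2 = weight l j * (k \<bullet> e j)\<^sup>2" for j
    using l s_pos[of j] by (simp add: reg_isqrt_coord weight_def power_divide)
  then show "expectation (\<lambda>\<omega>. (z l i \<omega> \<bullet> k)\<^sup>2) = qform l k"
    using X_second[of "reg_isqrt l k" i] qform_sums[OF l, of k] by (simp add: z_inner[OF l] sums_unique2)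
qed

lemma z_fourth:
  assumes l: "l > 0"
  shows "integrable M (\<lambda>\<omega>. (z l i \<omega> \<bullet> k) ^ 4)" "expectation (\<lambda>\<omega>. (z l i \<omega> \<bullet> k) ^ 4) \<le> K * (qform l k)\<^sup>2"
  using X_fourth[of i "reg_isqrt l k"] z_second[OF l, of i k] by (simp_all add: z_inner l)

text \<open>The Karhunen-Loeve coefficient scaled to unit variance; unrelated to
  \<open>huber_score\<close>.\<close>

definition score :: "nat \<Rightarrow> nat \<Rightarrow> 'w \<Rightarrow> real" where
  "score i j \<omega> = (X i \<omega> \<bullet> e j) / sqrt (s j)"

lemma score_meas [measurable]: "random_variable borel (score i j)"
  unfolding score_def by measurable

lemma z_norm_sums:
  assumes l: "l > 0"
  shows "(\<lambda>j. weight l j * (score i j \<omega>)\<^sup>2) sums (norm (z l i \<omega>))\<^sup>2"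
proof -
  have "weight l j * (score i j \<omega>)\<^sup>2 = (z l i \<omega> \<bullet> e j)\<^sup>2" for j
    using l s_pos[of j] by (simp add: z_def score_def reg_isqrt_coord weight_def power_divide)
  then show ?thesis using parseval[OF onb, of "z l i \<omega>"] by simp
qed

text \<open>\<open>\<parallel>z\<parallel>\<^sup>2 / \<N>(l)\<close> is a convex combination of the squared standardised scores, so Jensen's
  inequality transfers their convex moments without any independence between the scores.\<close>

lemma z_convex_moment:
  fixes g :: "real \<Rightarrow> real"
  assumes l: "l > 0" and [measurable]: "g \<in> borel_measurable borel"
    and g: "\<And>u. u \<ge> 0 \<Longrightarrow> g u \<ge> 0"
    and tangent: "\<And>u w. u \<ge> 0 \<Longrightarrow> w \<ge> 0 \<Longrightarrow> g u \<ge> g w + g' w * (u - w)"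
    and bound: "\<And>j. (\<integral>\<^sup>+\<omega>. ennreal (g ((score i j \<omega>)\<^sup>2)) \<partial>M) \<le> ennreal B" and B: "B \<ge> 0"
  shows "(\<integral>\<^sup>+\<omega>. ennreal (g ((norm (z l i \<omega>))\<^sup>2 / eff_dim s l)) \<partial>M) \<le> ennreal B"
proof -
  define N where "N = eff_dim s l"
  have N: "N > 0" unfolding N_def by (rule eff_dim_pos[OF l])
  have [measurable]: "random_variable borel (z l i)" by (rule z_meas[OF l])
  have "ennreal N * (\<integral>\<^sup>+\<omega>. ennreal (g ((norm (z l i \<omega>))\<^sup>2 / N)) \<partial>M) =
    (\<integral>\<^sup>+\<omega>. ennreal (N * g ((norm (z l i \<omega>))\<^sup>2 / N)) \<partial>M)"
    using N g by (subst nn_integral_cmult[symmetric]) (auto simp: ennreal_mult)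
  also have "\<dots> \<le> (\<integral>\<^sup>+\<omega>. (\<Sum>j. ennreal (weight l j * g ((score i j \<omega>)\<^sup>2))) \<partial>M)"
  proof (rule nn_integral_mono)
    fix \<omega>
    show "ennreal (N * g ((norm (z l i \<omega>))\<^sup>2 / N)) \<le> (\<Sum>j. ennreal (weight l j * g ((score i j \<omega>)\<^sup>2)))"
      by (rule weighted_tangent_jensen[where c = "g' ((norm (z l i \<omega>))\<^sup>2 / N)"])
        (use N weight_bounds[OF l] weight_sums[OF l] z_norm_sums[OF l] tangent g
          in \<open>auto simp: N_def less_imp_le\<close>)
  qed
  also have "\<dots> = (\<Sum>j. \<integral>\<^sup>+\<omega>. ennreal (weight l j * g ((score i j \<omega>)\<^sup>2)) \<partial>M)"
    by (rule nn_integral_suminf) measurable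
  also have "\<dots> \<le> (\<Sum>j. ennreal (weight l j * B))"
  proof (rule suminf_le)
    fix j
    have "(\<integral>\<^sup>+\<omega>. ennreal (weight l j * g ((score i j \<omega>)\<^sup>2)) \<partial>M) =
       ennreal (weight l j) * (\<integral>\<^sup>+\<omega>. ennreal (g ((score i j \<omega>)\<^sup>2)) \<partial>M)"
      using weight_bounds[OF l, of j] g by (subst nn_integral_cmult[symmetric]) (auto simp: ennreal_mult)
    also have "\<dots> \<le> ennreal (weight l j) * ennreal B" by (intro mult_left_mono bound) simp
    finally show "(\<integral>\<^sup>+\<omega>. ennreal (weight l j * g ((score i j \<omega>)\<^sup>2)) \<partial>M) \<le> ennreal (weight l j * B)"
      using weight_bounds[OF l, of j] B by (simp add: ennreal_mult)
  qed auto
  also have "\<dots> = ennreal (N * B)"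
    using sums_mult2[OF weight_sums[OF l], of B] weight_bounds[OF l] B
    by (subst suminf_ennreal2) (auto simp: sums_iff less_imp_le N_def)
  finally have "ennreal N * (\<integral>\<^sup>+\<omega>. ennreal (g ((norm (z l i \<omega>))\<^sup>2 / N)) \<partial>M) \<le> ennreal N * ennreal B"
    using N B by (simp add: ennreal_mult)
  then show ?thesis using N by (simp add: ennreal_mult_le_mult_iff N_def[symmetric])
qed

lemma score_second: "integrable M (\<lambda>\<omega>. (score i j \<omega>)\<^sup>2)" "expectation (\<lambda>\<omega>. (score i j \<omega>)\<^sup>2) = 1"
proof -
  show "integrable M (\<lambda>\<omega>. (score i j \<omega>)\<^sup>2)"
    using X_inner_sq_integrable by (simp add: score_def power_divide)
  have "(\<lambda>k. s k * (e j \<bullet> e k)\<^sup>2) = (\<lambda>k. if k = j then s k else 0)"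
    by (auto simp: orthonormal_basisD[OF onb])
  then have "expectation (\<lambda>\<omega>. (X i \<omega> \<bullet> e j)\<^sup>2) = s j"
    using X_second[of "e j" i] sums_If_finite[of "\<lambda>k. k = j" s] by (simp add: sums_unique2)
  then show "expectation (\<lambda>\<omega>. (score i j \<omega>)\<^sup>2) = 1"
    using s_pos[of j] by (simp add: score_def power_divide)
qed

lemma score_fourth: "integrable M (\<lambda>\<omega>. (score i j \<omega>) ^ 4)" "expectation (\<lambda>\<omega>. (score i j \<omega>) ^ 4) \<le> K"
proof -
  have eq: "(score i j \<omega>) ^ 4 = (X i \<omega> \<bullet> ((1 / sqrt (s j)) *\<^sub>R e j)) ^ 4"
    "(score i j \<omega>)\<^sup>2 = (X i \<omega> \<bullet> ((1 / sqrt (s j)) *\<^sub>R e j))\<^sup>2" for \<omega>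
    by (simp_all add: score_def)
  show "integrable M (\<lambda>\<omega>. (score i j \<omega>) ^ 4)" unfolding eq(1) by (rule X_fourth)
  show "expectation (\<lambda>\<omega>. (score i j \<omega>) ^ 4) \<le> K"
    using X_fourth(2)[of i "(1 / sqrt (s j)) *\<^sub>R e j"] score_second(2)[of i j] unfolding eq by simp
qed

lemma z_norm_second:
  assumes l: "l > 0"
  shows "integrable M (\<lambda>\<omega>. (norm (z l i \<omega>))\<^sup>2)" "expectation (\<lambda>\<omega>. (norm (z l i \<omega>))\<^sup>2) \<le> eff_dim s l"
proof -
  have N: "eff_dim s l > 0" by (rule eff_dim_pos[OF l])
  have [measurable]: "random_variable borel (z l i)" by (rule z_meas[OF l])
  have "(\<integral>\<^sup>+\<omega>. ennreal ((norm (z l i \<omega>))\<^sup>2 / eff_dim s l) \<partial>M) \<le> ennreal 1"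
    by (rule z_convex_moment[where g = "\<lambda>u. u" and g' = "\<lambda>_. 1", OF l])
      (use nn_integral_eq_integral[OF score_second(1)] score_second(2) in auto)
  then have "integrable M (\<lambda>\<omega>. (norm (z l i \<omega>))\<^sup>2 / eff_dim s l)"
    "expectation (\<lambda>\<omega>. (norm (z l i \<omega>))\<^sup>2 / eff_dim s l) \<le> 1"
    by (rule integrable_and_le_from_nn[rotated 2]; use N in simp)+
  then show "integrable M (\<lambda>\<omega>. (norm (z l i \<omega>))\<^sup>2)" "expectation (\<lambda>\<omega>. (norm (z l i \<omega>))\<^sup>2) \<le> eff_dim s l"
    using N integrable_mult_right[where f = "\<lambda>\<omega>. (norm (z l i \<omega>))\<^sup>2 / eff_dim s l" and c = "eff_dim s l" and M = M] by auto
qed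

lemma z_norm_fourth:
  assumes l: "l > 0"
  shows "integrable M (\<lambda>\<omega>. (norm (z l i \<omega>)) ^ 4)" "expectation (\<lambda>\<omega>. (norm (z l i \<omega>)) ^ 4) \<le> K * (eff_dim s l)\<^sup>2"
proof -
  have N: "eff_dim s l > 0" by (rule eff_dim_pos[OF l])
  have [measurable]: "random_variable borel (z l i)" by (rule z_meas[OF l])
  have "(\<integral>\<^sup>+\<omega>. ennreal (((norm (z l i \<omega>))\<^sup>2 / eff_dim s l)\<^sup>2) \<partial>M) \<le> ennreal K"
  proof (rule z_convex_moment[where g = "\<lambda>u. u\<^sup>2" and g' = "\<lambda>w. 2 * w", OF l])
    fix j
    have "(\<integral>\<^sup>+\<omega>. ennreal ((score i j \<omega>) ^ 4) \<partial>M) \<le> ennreal K"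
      using nn_integral_eq_integral[OF score_fourth(1)[of i j]] score_fourth(2)[of i j] K
      by (auto simp: ennreal_leI)
    then show "(\<integral>\<^sup>+\<omega>. ennreal (((score i j \<omega>)\<^sup>2)\<^sup>2) \<partial>M) \<le> ennreal K" by simp
    show "w\<^sup>2 + 2 * w * (u - w) \<le> u\<^sup>2" for u w :: real
      using zero_le_power2[of "u - w"] by (simp add: power2_eq_square algebra_simps)
  qed (use K in auto)
  then have *: "integrable M (\<lambda>\<omega>. ((norm (z l i \<omega>))\<^sup>2 / eff_dim s l)\<^sup>2)"
    "expectation (\<lambda>\<omega>. ((norm (z l i \<omega>))\<^sup>2 / eff_dim s l)\<^sup>2) \<le> K"
    by (rule integrable_and_le_from_nn[rotated 2]; use K in simp)+
  have eq: "((norm (z l i \<omega>))\<^sup>2 / eff_dim s l)\<^sup>2 = (norm (z l i \<omega>)) ^ 4 / (eff_dim s l)\<^sup>2" for \<omega>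
    by (simp add: power_divide)
  show "integrable M (\<lambda>\<omega>. (norm (z l i \<omega>)) ^ 4)" "expectation (\<lambda>\<omega>. (norm (z l i \<omega>)) ^ 4) \<le> K * (eff_dim s l)\<^sup>2"
    using * N integrable_mult_right[where f = "\<lambda>\<omega>. (norm (z l i \<omega>)) ^ 4 / (eff_dim s l)\<^sup>2" and c = "(eff_dim s l)\<^sup>2" and M = M]
    unfolding eq by (auto simp: divide_le_eq)
qed

subsection \<open>Concentration of the whitened Gram operator\<close>

definition gram :: "real \<Rightarrow> nat \<Rightarrow> 'w \<Rightarrow> L2" where
  "gram l i \<omega> = tens e (z l i \<omega>) - expectation (\<lambda>\<omega>. tens e (z l i \<omega>))"

definition gram_dev :: "real \<Rightarrow> nat \<Rightarrow> 'w \<Rightarrow> L2" where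
  "gram_dev l n \<omega> = (1 / real n) *\<^sub>R (\<Sum>i<n. gram l i \<omega>)"

lemma tens_z_meas: "l > 0 \<Longrightarrow> random_variable borel (\<lambda>\<omega>. tens e (z l i \<omega>))"
  by (rule measurable_compose[OF z_meas tens_meas])

lemma tens_z_integrable: "l > 0 \<Longrightarrow> integrable M (\<lambda>\<omega>. tens e (z l i \<omega>))"
  by (subst integrable_norm_iff[symmetric]) (auto simp: tens_z_meas norm_tens[OF onb] z_norm_second)

lemma gram_indep:
  assumes l: "l > 0"
  shows "indep_vars (\<lambda>_. borel) (gram l) UNIV"
proof -
  have "indep_vars (\<lambda>_. borel) (\<lambda>i \<omega>. tens e (reg_isqrt l (X i \<omega>))) UNIV"
    by (rule indep_image) (use l in measurable)
  then show ?thesis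
    unfolding gram_def z_def
    by (rule indep_vars_compose2[where Y = "\<lambda>i x. x - expectation (\<lambda>\<omega>. tens e (reg_isqrt l (X i \<omega>)))"]) simp
qed

lemma gram_mean: "l > 0 \<Longrightarrow> expectation (gram l i) = 0"
  unfolding gram_def[abs_def] using tens_z_integrable[of l i] by (simp add: prob_space)

text \<open>Pairing with \<open>tens e k\<close> converts one bound on the norm of a single random
  vector into a bound on the empirical quadratic form in all directions simultaneously.\<close>

lemma gram_upper:
  assumes l: "l > 0" and n: "n \<ge> 1" and dev: "norm (gram_dev l n \<omega>) \<le> c"
  shows "(1 / real n) * (\<Sum>i<n. (z l i \<omega> \<bullet> k)\<^sup>2) \<le> qform l k + (norm k)\<^sup>2 * c"
proof -
  have "expectation (\<lambda>\<omega>. tens e (z l i \<omega>)) \<bullet> tens e k = qform l k" for i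
  proof -
    have "expectation (\<lambda>\<omega>. tens e (z l i \<omega>)) \<bullet> tens e k = expectation (\<lambda>\<omega>. tens e (z l i \<omega>) \<bullet> tens e k)"
      using tens_z_integrable[OF l] by simp
    then show ?thesis using z_second[OF l, of i k] by (simp add: tens_inner[OF onb])
  qed
  then have g: "gram l i \<omega> \<bullet> tens e k = (z l i \<omega> \<bullet> k)\<^sup>2 - qform l k" for i
    by (simp add: gram_def inner_diff_left tens_inner[OF onb])
  have "gram_dev l n \<omega> \<bullet> tens e k = (1 / real n) * (\<Sum>i<n. (z l i \<omega> \<bullet> k)\<^sup>2) - qform l k"
    using n by (simp add: gram_dev_def inner_sum_left g sum_subtractf field_simps)
  moreover have "gram_dev l n \<omega> \<bullet> tens e k \<le> norm (gram_dev l n \<omega>) * norm (tens e k)"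
    by (rule norm_cauchy_schwarz)
  moreover have "norm (gram_dev l n \<omega>) * norm (tens e k) \<le> c * (norm k)\<^sup>2"
    unfolding norm_tens[OF onb] using dev by (intro mult_right_mono) auto
  ultimately show ?thesis by (simp add: mult.commute)
qed

text \<open>The squared Hilbert-Schmidt norm of a whitened tensor square is the fourth power of the
  norm of z, so the variance is of order N squared, with N the effective dimension. This is where
  the ratio of N squared to n originates.\<close>

lemma gram_dev_chebyshev:
  assumes l: "l > 0" and n: "n \<ge> 1" and x: "x > 0"
  shows "prob {\<omega> \<in> space M. norm (gram_dev l n \<omega>) \<ge> x} \<le> K * (eff_dim s l)\<^sup>2 / (real n * x\<^sup>2)"
  unfolding gram_dev_def
proof (rule chebyshev_sum[OF gram_indep[OF l] _ gram_mean[OF l] _ x n])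
  fix i
  have sq: "(\<lambda>\<omega>. (norm (tens e (z l i \<omega>)))\<^sup>2) = (\<lambda>\<omega>. (norm (z l i \<omega>)) ^ 4)"
    by (simp add: norm_tens[OF onb])
  have i: "integrable M (\<lambda>\<omega>. (norm (tens e (z l i \<omega>)))\<^sup>2)" unfolding sq by (rule z_norm_fourth[OF l])
  note c = expectation_centered_sq[OF tens_z_meas[OF l] i, folded gram_def]
  show "integrable M (\<lambda>\<omega>. (norm (gram l i \<omega>))\<^sup>2)" by (rule c)
  show "expectation (\<lambda>\<omega>. (norm (gram l i \<omega>))\<^sup>2) \<le> K * (eff_dim s l)\<^sup>2"
    using c(2) z_norm_fourth(2)[OF l, of i] unfolding sq by linarith
qed

end

section \<open>Curvature and gradient of the empirical loss\<close>

text \<open>Clipping changes only values beyond \<gamma>, and there \<open>\<bar>u\<bar>\<close> may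
  be traded for the q-th moment at the price \<open>\<gamma> powr (1 - q)\<close>. This is the
  pointwise form of the Huber bias.\<close>

lemma huber_score_residual_le:
  assumes "\<gamma> > 0" "q \<ge> 1"
  shows "\<bar>huber_score \<gamma> u - u\<bar> \<le> \<gamma> powr (1 - q) * \<bar>u\<bar> powr q"
proof (cases "\<bar>u\<bar> \<le> \<gamma>")
  case True
  then show ?thesis using assms by (simp add: huber_score_def)
next
  case False
  then have u: "\<bar>u\<bar> > \<gamma>" "\<bar>u\<bar> > 0" using assms by auto
  have "\<bar>huber_score \<gamma> u - u\<bar> \<le> \<bar>u\<bar>" using False assms by (auto simp: huber_score_def)
  also have "\<bar>u\<bar> = \<bar>u\<bar> powr (1 - q) * \<bar>u\<bar> powr q" using u by (simp add: powr_add[symmetric])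
  also have "\<dots> \<le> \<gamma> powr (1 - q) * \<bar>u\<bar> powr q"
    using u assms by (intro mult_right_mono powr_mono2') auto
  finally show ?thesis .
qed

text \<open>Interpolation: the clipped value is at most \<gamma> and at most
  \<open>\<bar>u\<bar>\<close>, so 2 - q of its two powers go to \<gamma> and q of them to
  u.\<close>

lemma huber_score_sq_le:
  assumes g: "\<gamma> > 0" and q: "0 \<le> q" "q \<le> 2"
  shows "(huber_score \<gamma> u)\<^sup>2 \<le> \<gamma> powr (2 - q) * \<bar>u\<bar> powr q"
proof (cases "u = 0")
  case True
  then show ?thesis using g by (simp add: huber_score_def)
next
  case False
  define a where "a = \<bar>huber_score \<gamma> u\<bar>"
  have a: "a > 0" "a \<le> \<gamma>" "a \<le> \<bar>u\<bar>" using False g by (auto simp: a_def huber_score_def)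
  have "(huber_score \<gamma> u)\<^sup>2 = a powr 2" using a by (simp add: a_def powr_numeral)
  also have "\<dots> = a powr (2 - q) * a powr q" by (simp add: powr_add[symmetric])
  also have "\<dots> \<le> \<gamma> powr (2 - q) * \<bar>u\<bar> powr q" using a q by (intro mult_mono powr_mono2) auto
  finally show ?thesis .
qed

text \<open>The two losses are separated additively so that each can be integrated by itself: loud
  noise (c = 0) costs the full square, and capping costs at most the fourth power over the squared
  level, as the square is below that quotient beyond the level.\<close>

lemma min_sq_ge:
  fixes u \<tau> c :: real
  assumes "\<tau> > 0" "c = 0 \<or> c = 1"
  shows "u\<^sup>2 - u\<^sup>2 * (1 - c) - u ^ 4 / \<tau>\<^sup>2 \<le> (min \<bar>u\<bar> \<tau>)\<^sup>2 * c"
proof -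
  have "u\<^sup>2 - u ^ 4 / \<tau>\<^sup>2 \<le> (min \<bar>u\<bar> \<tau>)\<^sup>2"
  proof (cases "\<bar>u\<bar> \<le> \<tau>")
    case True then show ?thesis by (simp add: min_absorb1)
  next
    case False
    then have "\<tau>\<^sup>2 \<le> u\<^sup>2" using assms(1) by (metis abs_le_square_iff abs_of_pos less_imp_le not_le)
    then have "u\<^sup>2 * \<tau>\<^sup>2 \<le> u\<^sup>2 * u\<^sup>2" by (intro mult_left_mono) auto
    then have "u\<^sup>2 \<le> u ^ 4 / \<tau>\<^sup>2" using assms(1) by (simp add: field_simps power4_eq_xxxx power2_eq_square)
    then show ?thesis using zero_le_power2[of "min \<bar>u\<bar> \<tau>"] by linarith
  qed
  then show ?thesis using assms by auto
qed

lemma (in eigen_system) qform_scaleR: "l > 0 \<Longrightarrow> qform l (c *\<^sub>R k) = c\<^sup>2 * qform l k"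
  using sums_unique2[OF qform_sums[of l "c *\<^sub>R k"]] sums_mult[OF qform_sums[of l k], of "c\<^sup>2"]
  by (simp add: power_mult_distrib mult_ac)

context regression
begin

text \<open>The device through which the noise moment is used: a nonnegative function of the
  covariate times any weight dominated by the q-th power of the noise.\<close>

lemma noise_weighted:
  fixes f :: "L2 \<Rightarrow> real" and w :: "'w \<Rightarrow> real"
  assumes [measurable]: "f \<in> borel_measurable borel" "w \<in> borel_measurable M"
    and f: "\<And>x. f x \<ge> 0" "integrable M (\<lambda>\<omega>. f (X i \<omega>))"
    and w: "\<And>\<omega>. 0 \<le> w \<omega>" "\<And>\<omega>. w \<omega> \<le> c * \<bar>\<epsilon> i \<omega>\<bar> powr q" and c: "c \<ge> 0"
  shows "integrable M (\<lambda>\<omega>. f (X i \<omega>) * w \<omega>)"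
    "expectation (\<lambda>\<omega>. f (X i \<omega>) * w \<omega>) \<le> c * v * expectation (\<lambda>\<omega>. f (X i \<omega>))"
proof -
  have "(\<integral>\<^sup>+\<omega>. ennreal (f (X i \<omega>) * w \<omega>) \<partial>M) \<le>
    (\<integral>\<^sup>+\<omega>. ennreal c * (ennreal (f (X i \<omega>)) * ennreal (\<bar>\<epsilon> i \<omega>\<bar> powr q)) \<partial>M)"
  proof (rule nn_integral_mono)
    fix \<omega>
    have "f (X i \<omega>) * w \<omega> \<le> f (X i \<omega>) * (c * \<bar>\<epsilon> i \<omega>\<bar> powr q)" using f w by (intro mult_left_mono) auto
    then show "ennreal (f (X i \<omega>) * w \<omega>) \<le> ennreal c * (ennreal (f (X i \<omega>)) * ennreal (\<bar>\<epsilon> i \<omega>\<bar> powr q))"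
      using f c by (simp add: ennreal_mult[symmetric] ennreal_leI mult_ac)
  qed
  also have "\<dots> = ennreal c * (\<integral>\<^sup>+\<omega>. ennreal (f (X i \<omega>)) * ennreal (\<bar>\<epsilon> i \<omega>\<bar> powr q) \<partial>M)"
    by (rule nn_integral_cmult) measurable
  also have "\<dots> \<le> ennreal c * (ennreal v * (\<integral>\<^sup>+\<omega>. ennreal (f (X i \<omega>)) \<partial>M))"
    by (intro mult_left_mono noise[of "\<lambda>x. ennreal (f x)"]) auto
  also have "(\<integral>\<^sup>+\<omega>. ennreal (f (X i \<omega>)) \<partial>M) = ennreal (expectation (\<lambda>\<omega>. f (X i \<omega>)))"
    using f by (intro nn_integral_eq_integral) auto
  also have "ennreal c * (ennreal v * ennreal (expectation (\<lambda>\<omega>. f (X i \<omega>)))) =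
     ennreal (c * v * expectation (\<lambda>\<omega>. f (X i \<omega>)))"
    using c v f by (simp add: ennreal_mult[symmetric] integral_nonneg_AE mult_ac)
  finally have "(\<integral>\<^sup>+\<omega>. ennreal (f (X i \<omega>) * w \<omega>) \<partial>M) \<le> ennreal (c * v * expectation (\<lambda>\<omega>. f (X i \<omega>)))" .
  then show "integrable M (\<lambda>\<omega>. f (X i \<omega>) * w \<omega>)"
    "expectation (\<lambda>\<omega>. f (X i \<omega>) * w \<omega>) \<le> c * v * expectation (\<lambda>\<omega>. f (X i \<omega>))"
    by (rule integrable_and_le_from_nn[rotated 2]; use f w c v in \<open>auto intro!: mult_nonneg_nonneg integral_nonneg_AE\<close>)+
qed

subsection \<open>Restricted curvature of the empirical loss\<close>

text \<open>With this truncation level the fourth moments cost at most a quarter of the quadratic form on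
  the net points, whose squared norm is at most 6.\<close>

definition trunc :: real where "trunc = sqrt (24 * K)"

lemma trunc: "trunc > 0" "trunc\<^sup>2 = 24 * K" using K by (auto simp: trunc_def)

lemma calm_meas [measurable]: "random_variable borel (calm \<gamma> i)"
  unfolding calm_def by measurable

lemma calm_range: "0 \<le> calm \<gamma> i \<omega> \<and> calm \<gamma> i \<omega> \<le> 1" "calm \<gamma> i \<omega> = 0 \<or> calm \<gamma> i \<omega> = 1"
  by (auto simp: calm_def)

definition capped :: "real \<Rightarrow> real \<Rightarrow> L2 \<Rightarrow> nat \<Rightarrow> 'w \<Rightarrow> real" where
  "capped l \<gamma> k i \<omega> = (min \<bar>z l i \<omega> \<bullet> k\<bar> trunc)\<^sup>2 * calm \<gamma> i \<omega>"

lemma capped_range: "0 \<le> capped l \<gamma> k i \<omega> \<and> capped l \<gamma> k i \<omega> \<le> 24 * K"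
proof -
  have "(min \<bar>u\<bar> trunc)\<^sup>2 \<le> 24 * K" for u :: real
    unfolding trunc(2)[symmetric] using trunc(1) by (intro power_mono) auto
  then show ?thesis using K by (auto simp: capped_def calm_def)
qed

lemma capped_indep:
  assumes l: "l > 0"
  shows "indep_vars (\<lambda>_. borel) (capped l \<gamma> k) UNIV"
  unfolding capped_def[abs_def] calm_def z_def
  by (rule indep_image) (use l in measurable)

text \<open>Half of the quadratic form survives: one quarter is lost to loud noise, one quarter to
  capping. The second uses that the form is at most 6 on the directions considered.\<close>

lemma capped_mean:
  assumes l: "l > 0" and g: "\<gamma> > 0" "(\<gamma> / 2) powr q \<ge> 4 * v" and k: "(norm k)\<^sup>2 \<le> 6"
  shows "expectation (capped l \<gamma> k i) \<ge> qform l k / 2"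
proof -
  have [measurable]: "random_variable borel (z l i)" by (rule z_meas[OF l])
  define f where "f x = (x \<bullet> reg_isqrt l k)\<^sup>2" for x
  have fX: "f (X i \<omega>) = (z l i \<omega> \<bullet> k)\<^sup>2" for \<omega> by (simp add: f_def z_inner[OF l])
  define c where "c = (\<gamma> / 2) powr (- q)"
  have c0: "c \<ge> 0" by (simp add: c_def)
  \<comment> \<open>Markov's inequality in pointwise form at level \<gamma> / 2; the threshold on
    \<gamma> then makes \<open>c * v\<close> at most 1/4.\<close>
  have cle: "1 - calm \<gamma> i \<omega> \<le> c * \<bar>\<epsilon> i \<omega>\<bar> powr q" for \<omega>
  proof (cases "\<bar>\<epsilon> i \<omega>\<bar> \<le> \<gamma> / 2")
    case False
    then have "(\<gamma> / 2) powr q \<le> \<bar>\<epsilon> i \<omega>\<bar> powr q" using g q by (intro powr_mono2) auto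
    then have "c * (\<gamma> / 2) powr q \<le> c * \<bar>\<epsilon> i \<omega>\<bar> powr q" by (intro mult_left_mono) (auto simp: c_def)
    moreover have "c * (\<gamma> / 2) powr q = 1" using g by (simp add: c_def powr_add[symmetric])
    ultimately show ?thesis by (simp add: calm_def)
  qed (simp add: calm_def c_def)
  have fm: "f \<in> borel_measurable borel" "\<And>x. f x \<ge> 0" unfolding f_def by auto
  have fi: "integrable M (\<lambda>\<omega>. f (X i \<omega>))" unfolding fX by (rule z_second[OF l])
  note w = noise_weighted[of f "\<lambda>\<omega>. 1 - calm \<gamma> i \<omega>" i c, OF fm(1) _ fm(2) fi _ cle c0]
  have w: "integrable M (\<lambda>\<omega>. f (X i \<omega>) * (1 - calm \<gamma> i \<omega>))"
     "expectation (\<lambda>\<omega>. f (X i \<omega>) * (1 - calm \<gamma> i \<omega>)) \<le> c * v * expectation (\<lambda>\<omega>. f (X i \<omega>))"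
    by (rule w; use calm_range in simp)+
  have "c * (4 * v) \<le> c * (\<gamma> / 2) powr q" using g by (intro mult_left_mono) (auto simp: c_def)
  also have "\<dots> = 1" using g by (simp add: c_def powr_add[symmetric])
  finally have cv: "c * v \<le> 1 / 4" by simp
  have q0: "qform l k \<ge> 0" by (rule qform_nonneg[OF l])
  have "c * v * qform l k \<le> 1 / 4 * qform l k" by (intro mult_right_mono cv q0)
  then have 1: "expectation (\<lambda>\<omega>. f (X i \<omega>) * (1 - calm \<gamma> i \<omega>)) \<le> qform l k / 4"
    using w(2) z_second(2)[OF l, of i k] by (simp add: fX)
  have "expectation (\<lambda>\<omega>. (z l i \<omega> \<bullet> k) ^ 4) / trunc\<^sup>2 \<le> K * (qform l k)\<^sup>2 / trunc\<^sup>2"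
    by (intro divide_right_mono z_fourth[OF l]) simp
  also have "\<dots> = (qform l k)\<^sup>2 / 24" using K by (simp add: trunc)
  also have "\<dots> \<le> 6 * qform l k / 24"
    using mult_right_mono[of "qform l k" 6 "qform l k"] q0 qform_le[OF l, of k] k by (simp add: power2_eq_square)
  finally have 2: "expectation (\<lambda>\<omega>. (z l i \<omega> \<bullet> k) ^ 4) / trunc\<^sup>2 \<le> qform l k / 4" by simp
  have [measurable]: "random_variable borel (capped l \<gamma> k i)" unfolding capped_def[abs_def] by measurable
  have "qform l k / 2 \<le> expectation (\<lambda>\<omega>. (z l i \<omega> \<bullet> k)\<^sup>2) - expectation (\<lambda>\<omega>. f (X i \<omega>) * (1 - calm \<gamma> i \<omega>))
     - expectation (\<lambda>\<omega>. (z l i \<omega> \<bullet> k) ^ 4) / trunc\<^sup>2"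
    using 1 2 z_second(2)[OF l, of i k] by simp
  also have "\<dots> = expectation (\<lambda>\<omega>. (z l i \<omega> \<bullet> k)\<^sup>2 - f (X i \<omega>) * (1 - calm \<gamma> i \<omega>) - (z l i \<omega> \<bullet> k) ^ 4 / trunc\<^sup>2)"
    using w(1) z_second(1)[OF l, of i k] z_fourth(1)[OF l, of i k] by simp
  also have "\<dots> \<le> expectation (capped l \<gamma> k i)"
  proof (rule integral_mono)
    show "integrable M (\<lambda>\<omega>. (z l i \<omega> \<bullet> k)\<^sup>2 - f (X i \<omega>) * (1 - calm \<gamma> i \<omega>) - (z l i \<omega> \<bullet> k) ^ 4 / trunc\<^sup>2)"
      using w(1) z_second(1)[OF l, of i k] z_fourth(1)[OF l, of i k] by simp
    show "integrable M (capped l \<gamma> k i)"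
      by (rule integrable_const_bound[where B = "24 * K"])
        (use capped_range in auto)
    show "(z l i \<omega> \<bullet> k)\<^sup>2 - f (X i \<omega>) * (1 - calm \<gamma> i \<omega>) - (z l i \<omega> \<bullet> k) ^ 4 / trunc\<^sup>2 \<le> capped l \<gamma> k i \<omega>" for \<omega>
      unfolding fX capped_def by (rule min_sq_ge[OF trunc(1) calm_range(2)])
  qed
  finally show ?thesis .
qed

text \<open>The summand \<open>2 * (1 - qform l k)\<close> is the contribution of the penalty in whitened coordinates.\<close>

definition curved :: "real \<Rightarrow> real \<Rightarrow> nat \<Rightarrow> 'w \<Rightarrow> bool" where
  "curved l \<gamma> n \<omega> \<longleftrightarrow>
    (\<forall>k. norm k = 1 \<longrightarrow> (1 / real n) * (\<Sum>i<n. capped l \<gamma> k i \<omega>) + 2 * (1 - qform l k) \<ge> 1/16)"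

text \<open>Once l reaches the top eigenvalue all weights are at most 1/2 and the penalty alone
  supplies the curvature. This case is kept apart because the effective dimension may then be too
  small to dominate a logarithm of the confidence level.\<close>

lemma curved_if_strong_penalty:
  assumes l: "l > 0" "l \<ge> s 0"
  shows "curved l \<gamma> n \<omega>"
  unfolding curved_def
proof (intro allI impI)
  fix k :: L2 assume k: "norm k = 1"
  have "weight l 0 \<le> 1 / 2" using l s_pos[of 0] by (simp add: weight_def field_simps)
  then have "qform l k \<le> 1 / 2" using qform_le_weight0[OF l(1), of k] k by simp
  moreover have "0 \<le> (1 / real n) * (\<Sum>i<n. capped l \<gamma> k i \<omega>)"
    using capped_range by (intro mult_nonneg_nonneg sum_nonneg) auto
  moreover have "1 / 16 \<le> a + 2 * (1 - b)" if "b \<le> 1 / 2" "0 \<le> a" for a b :: real using that by simp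
  ultimately show "1 / 16 \<le> (1 / real n) * (\<Sum>i<n. capped l \<gamma> k i \<omega>) + 2 * (1 - qform l k)" by blast
qed

text \<open>Hoeffding with deviation 1/32 and range \<open>24 * K\<close> gives the exponent
  \<open>n / (512 * (24 * K)\<^sup>2)\<close> for one direction; the union over the net adds the
  other summand. Only the Gram deviation is left as a condition, since it is bounded differently in
  the two parts.\<close>

lemma curvature_event:
  assumes l: "l > 0" and g: "\<gamma> > 0" "(\<gamma> / 2) powr q \<ge> 4 * v" and n: "n \<ge> 1"
  obtains A where "A \<in> events" "prob A \<le> exp (65536 * (eff_dim s l)\<^sup>2 - real n / (512 * (24 * K)\<^sup>2))"
    and "\<And>\<omega>. \<omega> \<in> space M - A \<Longrightarrow> norm (gram_dev l n \<omega>) \<le> 1 / 512 \<Longrightarrow> curved l \<gamma> n \<omega>"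
proof -
  have [measurable]: "random_variable borel (z l i)" for i by (rule z_meas[OF l])
  have [measurable]: "random_variable borel (capped l \<gamma> k i)" for k i unfolding capped_def by measurable
  obtain W where W: "finite W" "real (card W) \<le> exp (65536 * (eff_dim s l)\<^sup>2)"
    "\<And>k'. k' \<in> W \<Longrightarrow> (norm k')\<^sup>2 \<le> 6"
    "\<And>k. norm k \<le> 1 \<Longrightarrow> \<exists>k'\<in>W. qform l (k - k') \<le> 1/32 \<and> (norm (k - k'))\<^sup>2 \<le> 2"
    using finite_net[OF l] by blast
  define bad where "bad k = {\<omega> \<in> space M. (1 / real n) * (\<Sum>i<n. capped l \<gamma> k i \<omega>) \<le> qform l k / 2 - 1/32}" for k
  have bad_ev: "bad k \<in> events" for k unfolding bad_def by measurable
  define E where "E = exp (- real n / (512 * (24 * K)\<^sup>2))"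
  have bad_p: "prob (bad k) \<le> E" if "k \<in> W" for k
  proof -
    have "prob (bad k) \<le> exp (- 2 * real n * (1/32)\<^sup>2 / (24 * K)\<^sup>2)"
      unfolding bad_def
      by (rule hoeffding_lower[OF capped_indep[OF l] capped_range _ capped_mean[OF l g W(3)[OF that]] n])
        (use K in auto)
    then show ?thesis by (simp add: E_def power2_eq_square)
  qed
  show ?thesis
  proof (rule that)
    show "(\<Union>k\<in>W. bad k) \<in> events" using W(1) bad_ev by auto
    have "prob (\<Union>k\<in>W. bad k) \<le> (\<Sum>k\<in>W. prob (bad k))"
      by (rule finite_measure_subadditive_finite) (use W(1) bad_ev in auto)
    also have "\<dots> \<le> real (card W) * E" using bad_p by (rule sum_bounded_above)
    also have "\<dots> \<le> exp (65536 * (eff_dim s l)\<^sup>2) * E"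
      by (intro mult_right_mono W) (simp add: E_def)
    also have "\<dots> = exp (65536 * (eff_dim s l)\<^sup>2 - real n / (512 * (24 * K)\<^sup>2))"
      by (simp add: E_def exp_add[symmetric])
    finally show "prob (\<Union>k\<in>W. bad k) \<le> exp (65536 * (eff_dim s l)\<^sup>2 - real n / (512 * (24 * K)\<^sup>2))" .
    fix \<omega> assume w: "\<omega> \<in> space M - (\<Union>k\<in>W. bad k)" and dev: "norm (gram_dev l n \<omega>) \<le> 1 / 512"
    show "curved l \<gamma> n \<omega>"
      unfolding curved_def capped_def
    proof (intro allI impI)
      fix k :: L2 assume k: "norm k = 1"
      show "1 / 16 \<le> (1 / real n) * (\<Sum>i<n. (min \<bar>z l i \<omega> \<bullet> k\<bar> trunc)\<^sup>2 * calm \<gamma> i \<omega>) + 2 * (1 - qform l k)"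
      proof (rule curvature_from_net[OF l calm_range(1) W(4) _ _ _ k])
        show "qform l k' / 2 - 1 / 32 \<le> (1 / real n) * (\<Sum>i<n. (min \<bar>z l i \<omega> \<bullet> k'\<bar> trunc)\<^sup>2 * calm \<gamma> i \<omega>)"
          if "k' \<in> W" for k'
          using w that by (auto simp: bad_def capped_def)
        show "(1 / real n) * (\<Sum>i<n. (z l i \<omega> \<bullet> k)\<^sup>2) \<le> qform l k + (norm k)\<^sup>2 / 512" for k
          using gram_upper[OF l n dev] by simp
      qed (use trunc in auto)
    qed
  qed
qed

subsection \<open>Localisation of the estimator\<close>

text \<open>The negative of the gradient of the objective at f0, so that it stands with a plus sign
  on the right of the basic inequality.\<close>

definition gradient :: "real \<Rightarrow> real \<Rightarrow> nat \<Rightarrow> L2 \<Rightarrow> 'w \<Rightarrow> L2" where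
  "gradient l \<gamma> n f0 \<omega> = (1 / real n) *\<^sub>R (\<Sum>i<n. huber_score \<gamma> (\<epsilon> i \<omega>) *\<^sub>R X i \<omega>) - (2 * l) *\<^sub>R f0"

text \<open>Were the estimator farther away than R, the segment point at whitened distance exactly R
  would have curvature at least R squared over 16, against at most 2 R times the whitened gradient
  norm. The bound on \<open>trunc * R\<close> keeps the capped move inside the free half of the
  quadratic range.\<close>

lemma localisation:
  assumes l: "l > 0" and curved: "curved l \<gamma> n \<omega>"
    and R: "32 * norm (reg_isqrt l (gradient l \<gamma> n f0 \<omega>)) < R" "trunc * R \<le> \<gamma> / 2"
    and est: "huber_estimator n \<gamma> l (\<lambda>i. X i \<omega>) y fh"
    and y: "\<And>i. y i = f0 \<bullet> X i \<omega> + \<epsilon> i \<omega>"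
  shows "norm (reg_sqrt l (fh - f0)) \<le> R"
proof (rule ccontr)
  assume "\<not> norm (reg_sqrt l (fh - f0)) \<le> R"
  define \<rho> where "\<rho> = norm (reg_sqrt l (fh - f0))"
  have R0: "R > 0" using R(1) norm_ge_zero[of "reg_isqrt l (gradient l \<gamma> n f0 \<omega>)"] by linarith
  have \<rho>: "\<rho> > R" using \<open>\<not> norm (reg_sqrt l (fh - f0)) \<le> R\<close> by (simp add: \<rho>_def)
  \<comment> \<open>This factor contracts the whitened error to norm exactly R, so that the cap of
    \<open>X i \<bullet> h\<close> scales to the fixed level \<open>trunc\<close> on the unit
    sphere.\<close>
  define t where "t = R / \<rho>"
  have t: "0 < t" "t < 1" using \<rho> R0 by (auto simp: t_def)
  define h where "h = t *\<^sub>R (fh - f0)"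
  define k where "k = (1 / R) *\<^sub>R reg_sqrt l h"
  have Bh: "reg_sqrt l h = R *\<^sub>R k" using R0 by (simp add: k_def)
  have nBh: "norm (reg_sqrt l h) = R"
  proof -
    have "norm (reg_sqrt l h) = \<bar>t\<bar> * \<rho>"
      by (simp only: h_def reg_sqrt_eqs(3)[OF l] norm_scaleR \<rho>_def)
    then show ?thesis using \<rho> R0 by (simp add: t_def)
  qed
  have nk: "norm k = 1" using nBh R0 by (simp add: k_def)
  have Dh: "x \<bullet> h = R * (reg_isqrt l x \<bullet> k)" for x
  proof -
    have "x \<bullet> h = x \<bullet> reg_isqrt l (R *\<^sub>R k)" unfolding Bh[symmetric] by (simp add: reg_isqrt_sqrt[OF l])
    also have "\<dots> = reg_isqrt l x \<bullet> (R *\<^sub>R k)" by (rule reg_isqrt_eqs(4)[OF l, symmetric])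
    finally show ?thesis by simp
  qed
  have lh: "l * (norm h)\<^sup>2 = R\<^sup>2 * (1 - qform l k)"
    using reg_sqrt_norm_split[OF l, of h] unfolding nBh Bh by (simp add: qform_scaleR[OF l] nk algebra_simps)
  have "(1 / real n) * (\<Sum>i<n. (min \<bar>X i \<omega> \<bullet> h\<bar> (trunc * R))\<^sup>2 * (if \<bar>\<epsilon> i \<omega>\<bar> \<le> \<gamma> / 2 then 1 else 0)) + 2 * l * (norm h)\<^sup>2
    \<le> 2 * (gradient l \<gamma> n f0 \<omega> \<bullet> h)"
    unfolding gradient_def
    by (rule huber_estimator_basic_ineq[OF _ R(2) _ _ _ est, where t = t])
      (use R0 trunc l t y h_def in auto)
  also have "(\<lambda>i. (min \<bar>X i \<omega> \<bullet> h\<bar> (trunc * R))\<^sup>2 * (if \<bar>\<epsilon> i \<omega>\<bar> \<le> \<gamma> / 2 then 1 else 0)) = (\<lambda>i. R\<^sup>2 * capped l \<gamma> k i \<omega>)"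
  proof
    fix i
    have "min \<bar>X i \<omega> \<bullet> h\<bar> (trunc * R) = R * min \<bar>z l i \<omega> \<bullet> k\<bar> trunc"
      using R0 by (simp add: Dh z_def[symmetric] abs_mult min_mult_distrib_left mult.commute[of trunc])
    then show "(min \<bar>X i \<omega> \<bullet> h\<bar> (trunc * R))\<^sup>2 * (if \<bar>\<epsilon> i \<omega>\<bar> \<le> \<gamma> / 2 then 1 else 0) = R\<^sup>2 * capped l \<gamma> k i \<omega>"
      by (simp add: capped_def calm_def power_mult_distrib)
  qed
  finally have A: "R\<^sup>2 * ((1 / real n) * (\<Sum>i<n. capped l \<gamma> k i \<omega>) + 2 * (1 - qform l k)) \<le> 2 * (gradient l \<gamma> n f0 \<omega> \<bullet> h)"
    using lh by (simp add: sum_distrib_left[symmetric] algebra_simps)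
  have B: "R\<^sup>2 * (1/16) \<le> R\<^sup>2 * ((1 / real n) * (\<Sum>i<n. capped l \<gamma> k i \<omega>) + 2 * (1 - qform l k))"
    using curved nk unfolding curved_def by (intro mult_left_mono) auto
  have C: "gradient l \<gamma> n f0 \<omega> \<bullet> h \<le> R * (norm (reg_isqrt l (gradient l \<gamma> n f0 \<omega>)))"
    unfolding Dh using R0 norm_cauchy_schwarz[of "reg_isqrt l (gradient l \<gamma> n f0 \<omega>)" k] nk
    by (intro mult_left_mono) auto
  \<comment> \<open>Cancelling R leaves R at most 32 times the whitened gradient norm, which is the
    source of the factor 32.\<close>
  have "R * (R * (1/16)) \<le> R * (2 * norm (reg_isqrt l (gradient l \<gamma> n f0 \<omega>)))"
    using order_trans[OF B A] C unfolding power2_eq_square by linarith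
  then have "R * (1/16) \<le> 2 * norm (reg_isqrt l (gradient l \<gamma> n f0 \<omega>))"
    using R0 by (simp only: mult_le_cancel_left_pos)
  then show False using R(1) by linarith
qed

subsection \<open>Size of the whitened gradient\<close>

definition wscore :: "real \<Rightarrow> real \<Rightarrow> nat \<Rightarrow> 'w \<Rightarrow> L2" where
  "wscore l \<gamma> i \<omega> = huber_score \<gamma> (\<epsilon> i \<omega>) *\<^sub>R z l i \<omega>"

lemma wscore_meas: "l > 0 \<Longrightarrow> random_variable borel (wscore l \<gamma> i)"
  unfolding wscore_def using z_meas[of l i] by measurable

lemma wscore_indep: "l > 0 \<Longrightarrow> indep_vars (\<lambda>_. borel) (wscore l \<gamma>) UNIV"
  unfolding wscore_def[abs_def] z_def
  by (rule indep_image) measurable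

lemma reg_isqrt_gradient:
  assumes l: "l > 0"
  shows "reg_isqrt l (gradient l \<gamma> n f0 \<omega>) =
    (1 / real n) *\<^sub>R (\<Sum>i<n. wscore l \<gamma> i \<omega>) - (2 * l) *\<^sub>R reg_isqrt l f0"
proof -
  have "linear (reg_isqrt l)" by (rule linearI) (simp_all add: reg_isqrt_eqs[OF l])
  then show ?thesis
    by (simp add: gradient_def reg_isqrt_eqs[OF l] linear_sum wscore_def z_def)
qed

lemma wscore_second:
  assumes l: "l > 0" and g: "\<gamma> > 0"
  shows "integrable M (\<lambda>\<omega>. (norm (wscore l \<gamma> i \<omega>))\<^sup>2)"
    "expectation (\<lambda>\<omega>. (norm (wscore l \<gamma> i \<omega>))\<^sup>2) \<le> v * \<gamma> powr (2 - q) * eff_dim s l"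
proof -
  define f where "f x = (norm (reg_isqrt l x))\<^sup>2" for x
  have [measurable]: "f \<in> borel_measurable borel" unfolding f_def using l by measurable
  have fX: "f (X i \<omega>) = (norm (z l i \<omega>))\<^sup>2" for \<omega> by (simp add: f_def z_def)
  have eq: "(norm (wscore l \<gamma> i \<omega>))\<^sup>2 = f (X i \<omega>) * (huber_score \<gamma> (\<epsilon> i \<omega>))\<^sup>2" for \<omega>
    by (simp add: wscore_def fX power_mult_distrib)
  have fm: "f \<in> borel_measurable borel" "\<And>x. f x \<ge> 0" by (measurable, simp add: f_def)
  have fi: "integrable M (\<lambda>\<omega>. f (X i \<omega>))" unfolding fX by (rule z_norm_second[OF l])
  have le: "(huber_score \<gamma> (\<epsilon> i \<omega>))\<^sup>2 \<le> \<gamma> powr (2 - q) * \<bar>\<epsilon> i \<omega>\<bar> powr q" for \<omega>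
    using q by (intro huber_score_sq_le[OF g]) auto
  note w = noise_weighted[of f "\<lambda>\<omega>. (huber_score \<gamma> (\<epsilon> i \<omega>))\<^sup>2" i, OF fm(1) _ fm(2) fi _ le]
  have w: "integrable M (\<lambda>\<omega>. f (X i \<omega>) * (huber_score \<gamma> (\<epsilon> i \<omega>))\<^sup>2)"
    "expectation (\<lambda>\<omega>. f (X i \<omega>) * (huber_score \<gamma> (\<epsilon> i \<omega>))\<^sup>2) \<le> \<gamma> powr (2 - q) * v * expectation (\<lambda>\<omega>. f (X i \<omega>))"
    by (rule w; simp)+
  then show "integrable M (\<lambda>\<omega>. (norm (wscore l \<gamma> i \<omega>))\<^sup>2)" unfolding eq by simp
  have "\<gamma> powr (2 - q) * v * expectation (\<lambda>\<omega>. f (X i \<omega>)) \<le> \<gamma> powr (2 - q) * v * eff_dim s l"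
    unfolding fX using z_norm_second(2)[OF l, of i] v by (intro mult_left_mono) auto
  then show "expectation (\<lambda>\<omega>. (norm (wscore l \<gamma> i \<omega>))\<^sup>2) \<le> v * \<gamma> powr (2 - q) * eff_dim s l"
    unfolding eq using w(2) by (simp add: mult_ac)
qed

lemma wscore_integrable: "l > 0 \<Longrightarrow> \<gamma> > 0 \<Longrightarrow> integrable M (wscore l \<gamma> i)"
  by (rule integrable_norm_from_square[OF wscore_meas wscore_second(1)])

text \<open>The bias vector m is tested against itself, so only the single direction m is involved
  and no factor of the effective dimension appears. In one direction the mean absolute value of the
  whitened covariate is at most the norm of m, because \<open>qform\<close> is at most the squared
  norm.\<close>

lemma wscore_mean:
  assumes l: "l > 0" and g: "\<gamma> > 0"
  shows "norm (expectation (wscore l \<gamma> i)) \<le> v * \<gamma> powr (1 - q)"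
proof -
  define m where "m = expectation (wscore l \<gamma> i)"
  define f where "f x = \<bar>x \<bullet> reg_isqrt l m\<bar>" for x
  have fX: "f (X i \<omega>) = \<bar>z l i \<omega> \<bullet> m\<bar>" for \<omega> by (simp add: f_def z_inner[OF l])
  have [measurable]: "random_variable borel (z l i)" by (rule z_meas[OF l])
  have "integrable M (\<lambda>\<omega>. z l i \<omega> \<bullet> m)"
    by (rule integrable_norm_from_square) (use z_second(1)[OF l] in auto)
  then have intf: "integrable M (\<lambda>\<omega>. f (X i \<omega>))" by (simp add: fX)
  have Ef: "expectation (\<lambda>\<omega>. f (X i \<omega>)) \<le> norm m"
  proof (cases "m = 0")
    case True then show ?thesis by (simp add: fX)
  next
    case False
    then have c: "norm m > 0" by simp
    \<comment> \<open>The inequality between arithmetic and geometric means, scaled so that both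
      terms contribute at most half of \<open>norm m\<close> after integration.\<close>
    have "\<bar>u\<bar> \<le> (norm m + u\<^sup>2 / norm m) / 2" for u :: real
      using zero_le_power2[of "\<bar>u\<bar> - norm m"] c by (simp add: power2_diff field_simps power2_eq_square)
    then have "expectation (\<lambda>\<omega>. f (X i \<omega>)) \<le> expectation (\<lambda>\<omega>. (norm m + (z l i \<omega> \<bullet> m)\<^sup>2 / norm m) / 2)"
      using intf z_second(1)[OF l, of i m] unfolding fX by (intro integral_mono) auto
    also have "\<dots> = (norm m + qform l m / norm m) / 2"
      using z_second[OF l, of i m] by (simp add: prob_space)
    also have "\<dots> \<le> (norm m + (norm m)\<^sup>2 / norm m) / 2"
      using qform_le[OF l, of m] by (intro divide_right_mono add_left_mono) auto
    finally show ?thesis using c by (simp add: power2_eq_square)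
  qed
  have w: "integrable M (\<lambda>\<omega>. f (X i \<omega>) * \<bar>huber_score \<gamma> (\<epsilon> i \<omega>) - \<epsilon> i \<omega>\<bar>)"
    "expectation (\<lambda>\<omega>. f (X i \<omega>) * \<bar>huber_score \<gamma> (\<epsilon> i \<omega>) - \<epsilon> i \<omega>\<bar>) \<le>
      \<gamma> powr (1 - q) * v * expectation (\<lambda>\<omega>. f (X i \<omega>))"
    using q intf by (intro noise_weighted[where c = "\<gamma> powr (1 - q)"];
        simp add: huber_score_residual_le[OF g] f_def)+
  have nm: "integrable M (\<lambda>\<omega>. (z l i \<omega> \<bullet> m) * \<epsilon> i \<omega>)" "expectation (\<lambda>\<omega>. (z l i \<omega> \<bullet> m) * \<epsilon> i \<omega>) = 0"
    using noise_mean[of i "reg_isqrt l m"] by (simp_all add: z_inner[OF l])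
  \<comment> \<open>Splitting off the raw noise isolates a mean-zero part; the rest is the clipping
    residual.\<close>
  have ws: "wscore l \<gamma> i \<omega> \<bullet> m = (z l i \<omega> \<bullet> m) * \<epsilon> i \<omega> + (z l i \<omega> \<bullet> m) * (huber_score \<gamma> (\<epsilon> i \<omega>) - \<epsilon> i \<omega>)" for \<omega>
    by (simp add: wscore_def algebra_simps)
  have wi: "integrable M (\<lambda>\<omega>. wscore l \<gamma> i \<omega> \<bullet> m)" using wscore_integrable[OF l g] by simp
  have ri: "integrable M (\<lambda>\<omega>. (z l i \<omega> \<bullet> m) * (huber_score \<gamma> (\<epsilon> i \<omega>) - \<epsilon> i \<omega>))"
    using Bochner_Integration.integrable_diff[OF wi nm(1)] by (simp add: ws)
  have "(norm m)\<^sup>2 = expectation (\<lambda>\<omega>. wscore l \<gamma> i \<omega> \<bullet> m)"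
    using wscore_integrable[OF l g, of i] by (simp add: power2_norm_eq_inner m_def)
  also have "\<dots> = expectation (\<lambda>\<omega>. (z l i \<omega> \<bullet> m) * (huber_score \<gamma> (\<epsilon> i \<omega>) - \<epsilon> i \<omega>))"
    unfolding ws using nm ri by simp
  also have "\<dots> \<le> expectation (\<lambda>\<omega>. f (X i \<omega>) * \<bar>huber_score \<gamma> (\<epsilon> i \<omega>) - \<epsilon> i \<omega>\<bar>)"
    by (rule integral_mono[OF ri w(1)]) (metis fX abs_ge_self abs_mult)
  also have "\<dots> \<le> \<gamma> powr (1 - q) * v * norm m"
    by (rule order_trans[OF w(2) mult_left_mono[OF Ef]]) (use v in simp)
  finally have "norm m * norm m \<le> (v * \<gamma> powr (1 - q)) * norm m" by (simp add: power2_eq_square mult_ac)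
  then show ?thesis
    unfolding m_def[symmetric] using v by (cases "norm m = 0") (auto simp: mult_le_cancel_right)
qed

text \<open>Chebyshev is applied to the centred scores, and the level is raised by the bias bound to
  make up for the centring.\<close>

lemma wscore_chebyshev:
  assumes l: "l > 0" and g: "\<gamma> > 0" and n: "n \<ge> 1" and x: "x > 0"
  shows "prob {\<omega> \<in> space M. norm ((1 / real n) *\<^sub>R (\<Sum>i<n. wscore l \<gamma> i \<omega>)) \<ge> v * \<gamma> powr (1 - q) + x}
    \<le> v * \<gamma> powr (2 - q) * eff_dim s l / (real n * x\<^sup>2)"
proof -
  have [measurable]: "random_variable borel (wscore l \<gamma> i)" for i by (rule wscore_meas[OF l])
  define Y where "Y i \<omega> = wscore l \<gamma> i \<omega> - expectation (wscore l \<gamma> i)" for i \<omega>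
  have Ym [measurable]: "random_variable borel (Y i)" for i unfolding Y_def by measurable
  have ind: "indep_vars (\<lambda>_. borel) Y UNIV"
    unfolding Y_def[abs_def]
    by (rule indep_vars_compose2[OF wscore_indep[OF l], where Y = "\<lambda>i x. x - expectation (wscore l \<gamma> i)"]) simp
  note c = expectation_centered_sq[OF wscore_meas[OF l] wscore_second(1)[OF l g], folded Y_def]
  have "norm ((1 / real n) *\<^sub>R (\<Sum>i<n. Y i \<omega>)) \<ge> x"
    if "norm ((1 / real n) *\<^sub>R (\<Sum>i<n. wscore l \<gamma> i \<omega>)) \<ge> v * \<gamma> powr (1 - q) + x" for \<omega>
  proof -
    have "norm (\<Sum>i<n. expectation (wscore l \<gamma> i)) \<le> real n * (v * \<gamma> powr (1 - q))"
      using sum_norm_bound[of "{..<n}" "\<lambda>i. expectation (wscore l \<gamma> i)" "v * \<gamma> powr (1 - q)"] wscore_mean[OF l g] by simp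
    then have "norm ((1 / real n) *\<^sub>R (\<Sum>i<n. expectation (wscore l \<gamma> i))) \<le> v * \<gamma> powr (1 - q)"
      using n by (simp add: field_simps)
    moreover have "(1 / real n) *\<^sub>R (\<Sum>i<n. wscore l \<gamma> i \<omega>) =
       (1 / real n) *\<^sub>R (\<Sum>i<n. Y i \<omega>) + (1 / real n) *\<^sub>R (\<Sum>i<n. expectation (wscore l \<gamma> i))"
      by (simp add: Y_def sum_subtractf scaleR_diff_right)
    ultimately show ?thesis using that norm_triangle_ineq by (smt (verit))
  qed
  then have "prob {\<omega> \<in> space M. norm ((1 / real n) *\<^sub>R (\<Sum>i<n. wscore l \<gamma> i \<omega>)) \<ge> v * \<gamma> powr (1 - q) + x}
    \<le> prob {\<omega> \<in> space M. norm ((1 / real n) *\<^sub>R (\<Sum>i<n. Y i \<omega>)) \<ge> x}"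
    by (intro finite_measure_mono) auto
  also have "\<dots> \<le> v * \<gamma> powr (2 - q) * eff_dim s l / (real n * x\<^sup>2)"
  proof (rule chebyshev_sum[OF ind c(1) _ _ x n])
    show "expectation (Y i) = 0" for i
      unfolding Y_def using wscore_integrable[OF l g, of i] by (simp add: prob_space)
    show "expectation (\<lambda>\<omega>. (norm (Y i \<omega>))\<^sup>2) \<le> v * \<gamma> powr (2 - q) * eff_dim s l" for i
      using c(2) wscore_second(2)[OF l g, of i] by (rule order_trans)
  qed
  finally show ?thesis .
qed

end

section \<open>Exponential bounds under sub-Gaussian scores\<close>

lemma exp_minus_le:
  fixes x :: real
  assumes "x \<ge> 0"
  shows "exp x - 1 - x \<le> x\<^sup>2 * exp x"
proof -
  have "(1 - x) * exp x \<le> exp (- x) * exp x"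
    using exp_ge_add_one_self[of "- x"] by (intro mult_right_mono) auto
  then have 1: "exp x - 1 \<le> x * exp x" by (simp add: exp_add[symmetric] algebra_simps)
  then have "x * (exp x - 1) \<le> x * (x * exp x)" using assms by (intro mult_left_mono)
  then show ?thesis using 1 by (simp add: power2_eq_square algebra_simps)
qed

lemma sq_le_exp:
  fixes x c :: real
  assumes "x \<ge> 0" "c > 0"
  shows "x\<^sup>2 \<le> 8 / c\<^sup>2 * exp (c * x / 2)"
proof -
  have "(c * x / 2)\<^sup>2 / 2 \<le> exp (c * x / 2)"
    using exp_lower_Taylor_quadratic[of "c * x / 2"] assms by (smt (verit) divide_nonneg_nonneg mult_nonneg_nonneg)
  then show ?thesis using assms by (simp add: field_simps power2_eq_square)
qed

text \<open>The square inside the exponential is absorbed by a sum of two-sided exponentials with slopes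
  proportional to \<open>m\<close>, where \<open>m \<le> \<bar>x\<bar> < m + 1\<close>; this needs no integration of tail bounds.\<close>

lemma exp_square_le_suminf:
  fixes x b c :: real
  assumes b: "b > 0" and c: "c > 0"
  shows "ennreal (exp (c * x\<^sup>2)) \<le>
    (\<Sum>m. ennreal (exp (c * (real m + 1)\<^sup>2 - b * (real m)\<^sup>2)) * (ennreal (exp (b * real m * x)) + ennreal (exp (- b * real m * x))))"
    (is "_ \<le> suminf ?f")
proof -
  define m where "m = nat \<lfloor>\<bar>x\<bar>\<rfloor>"
  have m: "real m \<le> \<bar>x\<bar>" "\<bar>x\<bar> \<le> real m + 1" unfolding m_def by linarith+
  have "x\<^sup>2 \<le> (real m + 1)\<^sup>2" using m by (simp add: abs_le_square_iff[symmetric])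
  then have 1: "c * x\<^sup>2 \<le> c * (real m + 1)\<^sup>2" using c by simp
  have "real m * real m \<le> real m * \<bar>x\<bar>" using m by (intro mult_left_mono) auto
  then have 2: "b * (real m)\<^sup>2 \<le> b * real m * \<bar>x\<bar>" using b by (simp add: power2_eq_square)
  have "exp (c * x\<^sup>2) \<le> exp (c * (real m + 1)\<^sup>2 - b * (real m)\<^sup>2) * exp (b * real m * \<bar>x\<bar>)"
    using 1 2 by (simp add: exp_add[symmetric])
  also have "\<dots> \<le> exp (c * (real m + 1)\<^sup>2 - b * (real m)\<^sup>2) * (exp (b * real m * x) + exp (- b * real m * x))"
    by (intro mult_left_mono) (auto simp: abs_if intro: add_increasing add_increasing2)
  finally have "ennreal (exp (c * x\<^sup>2)) \<le> ?f m"
    by (simp add: ennreal_mult[symmetric] ennreal_plus[symmetric] ennreal_leI del: ennreal_plus)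
  also have "\<dots> \<le> suminf ?f" using sum_le_suminf[of ?f "{m}"] by simp
  finally show ?thesis .
qed

text \<open>The constants are balanced: at slope \<open>b * m\<close> with
  \<open>b = 1 / (2 * C)\<close> the moment generating function returns half of the gain
  \<open>b * m\<^sup>2\<close>, and \<open>c = 1 / (16 * C)\<close> is a quarter of what remains. A
  geometric series is left.\<close>

lemma (in prob_space) subgaussian_exp_square:
  fixes Y :: "'a \<Rightarrow> real"
  assumes [measurable]: "random_variable borel Y" and C: "C > 0"
    and mgf: "\<And>t. (\<integral>\<^sup>+\<omega>. ennreal (exp (t * Y \<omega>)) \<partial>M) \<le> ennreal (exp (C * t\<^sup>2))"
  defines "c \<equiv> 1 / (16 * C)"
  shows "(\<integral>\<^sup>+\<omega>. ennreal (exp (c * (Y \<omega>)\<^sup>2)) \<partial>M) \<le> ennreal (2 * exp (2 * c) / (1 - exp (- 2 * c)))"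
proof -
  define b where "b = 1 / (2 * C)"
  have c: "c > 0" and b: "b > 0" using C by (auto simp: c_def b_def)
  have "(\<integral>\<^sup>+\<omega>. ennreal (exp (c * (Y \<omega>)\<^sup>2)) \<partial>M) \<le>
    (\<integral>\<^sup>+\<omega>. (\<Sum>m. ennreal (exp (c * (real m + 1)\<^sup>2 - b * (real m)\<^sup>2)) *
      (ennreal (exp (b * real m * Y \<omega>)) + ennreal (exp (- b * real m * Y \<omega>)))) \<partial>M)"
    by (intro nn_integral_mono exp_square_le_suminf b c)
  also have "\<dots> = (\<Sum>m. \<integral>\<^sup>+\<omega>. ennreal (exp (c * (real m + 1)\<^sup>2 - b * (real m)\<^sup>2)) *
      (ennreal (exp (b * real m * Y \<omega>)) + ennreal (exp (- b * real m * Y \<omega>))) \<partial>M)"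
    by (rule nn_integral_suminf) measurable
  also have "\<dots> \<le> (\<Sum>m. ennreal (2 * exp (2 * c) * exp (- 2 * c) ^ m))"
  proof (rule suminf_le)
    fix m :: nat
    have "(\<integral>\<^sup>+\<omega>. ennreal (exp (c * (real m + 1)\<^sup>2 - b * (real m)\<^sup>2)) *
      (ennreal (exp (b * real m * Y \<omega>)) + ennreal (exp (- b * real m * Y \<omega>))) \<partial>M) =
      ennreal (exp (c * (real m + 1)\<^sup>2 - b * (real m)\<^sup>2)) *
      ((\<integral>\<^sup>+\<omega>. ennreal (exp (b * real m * Y \<omega>)) \<partial>M) + (\<integral>\<^sup>+\<omega>. ennreal (exp (- b * real m * Y \<omega>)) \<partial>M))"
      by (subst nn_integral_cmult) (auto simp: nn_integral_add)
    also have "\<dots> \<le> ennreal (exp (c * (real m + 1)\<^sup>2 - b * (real m)\<^sup>2)) *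
      (ennreal (exp (C * (b * real m)\<^sup>2)) + ennreal (exp (C * (- b * real m)\<^sup>2)))"
      by (intro mult_left_mono add_mono mgf) auto
    also have "\<dots> = ennreal (2 * exp (c * (real m + 1)\<^sup>2 - b * (real m)\<^sup>2 + C * (b * real m)\<^sup>2))"
      by (simp add: ennreal_mult[symmetric] ennreal_plus[symmetric] exp_add exp_diff mult_ac del: ennreal_plus)
    also have "\<dots> \<le> ennreal (2 * exp (2 * c) * exp (- 2 * c) ^ m)"
    proof (rule ennreal_leI)
      have 1: "- b * (real m)\<^sup>2 + C * (b * real m)\<^sup>2 = - (4 * c) * (real m)\<^sup>2"
        using C by (simp add: b_def c_def power2_eq_square field_simps)
      have "(real m + 1)\<^sup>2 \<le> 2 * (real m)\<^sup>2 + 2" using power2_add_le[of "real m" 1] by simp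
      then have 2: "c * (real m + 1)\<^sup>2 \<le> c * (2 * (real m)\<^sup>2 + 2)" using c by (intro mult_left_mono) auto
      have "real m \<le> (real m)\<^sup>2" by (cases m) (auto simp: power2_eq_square)
      then have 3: "c * real m \<le> c * (real m)\<^sup>2" using c by simp
      have "c * (real m + 1)\<^sup>2 - b * (real m)\<^sup>2 + C * (b * real m)\<^sup>2 \<le> 2 * c + real m * (- 2 * c)"
        using 1 2 3 by (simp add: algebra_simps)
      then have "exp (c * (real m + 1)\<^sup>2 - b * (real m)\<^sup>2 + C * (b * real m)\<^sup>2) \<le> exp (2 * c) * exp (real m * (- 2 * c))"
        by (simp only: exp_add[symmetric] exp_le_cancel_iff)
      then show "2 * exp (c * (real m + 1)\<^sup>2 - b * (real m)\<^sup>2 + C * (b * real m)\<^sup>2) \<le> 2 * exp (2 * c) * exp (- 2 * c) ^ m"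
        by (simp only: exp_of_nat_mult)
    qed
    finally show "(\<integral>\<^sup>+\<omega>. ennreal (exp (c * (real m + 1)\<^sup>2 - b * (real m)\<^sup>2)) *
      (ennreal (exp (b * real m * Y \<omega>)) + ennreal (exp (- b * real m * Y \<omega>))) \<partial>M) \<le> ennreal (2 * exp (2 * c) * exp (- 2 * c) ^ m)" .
  qed auto
  also have "\<dots> = ennreal (2 * exp (2 * c) / (1 - exp (- 2 * c)))"
  proof -
    have "(\<lambda>m. 2 * exp (2 * c) * exp (- 2 * c) ^ m) sums (2 * exp (2 * c) * (1 / (1 - exp (- 2 * c))))"
      using c by (intro sums_mult geometric_sums) auto
    then show ?thesis by (subst suminf_ennreal2) (auto simp: sums_iff)
  qed
  finally show ?thesis .
qed

text \<open>Sub-Gaussianity of the scores in the form used below: a uniform exponential moment of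
  their squares, which is convex in the square and so passes to the whitened norm.\<close>

locale subgaussian_regression = regression +
  fixes c B :: real
  assumes c: "c > 0"
    and exp_score: "\<And>i j. (\<integral>\<^sup>+\<omega>. ennreal (exp (c * (score i j \<omega>)\<^sup>2)) \<partial>M) \<le> ennreal B"
    and B: "B \<ge> 0"
begin

lemma exp_z_norm:
  assumes l: "l > 0"
  shows "integrable M (\<lambda>\<omega>. exp (c * ((norm (z l i \<omega>))\<^sup>2 / eff_dim s l)))"
    "expectation (\<lambda>\<omega>. exp (c * ((norm (z l i \<omega>))\<^sup>2 / eff_dim s l))) \<le> B"
proof -
  have [measurable]: "random_variable borel (z l i)" by (rule z_meas[OF l])
  have "(\<integral>\<^sup>+\<omega>. ennreal (exp (c * ((norm (z l i \<omega>))\<^sup>2 / eff_dim s l))) \<partial>M) \<le> ennreal B"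
  proof (rule z_convex_moment[where g = "\<lambda>u. exp (c * u)" and g' = "\<lambda>w. c * exp (c * w)", OF l])
    fix u w :: real
    have "exp (c * w) * (1 + c * (u - w)) \<le> exp (c * w) * exp (c * (u - w))"
      by (intro mult_left_mono) auto
    then show "exp (c * w) + c * exp (c * w) * (u - w) \<le> exp (c * u)"
      by (simp add: exp_add[symmetric] algebra_simps)
  qed (use exp_score B in auto)
  then show "integrable M (\<lambda>\<omega>. exp (c * ((norm (z l i \<omega>))\<^sup>2 / eff_dim s l)))"
    "expectation (\<lambda>\<omega>. exp (c * ((norm (z l i \<omega>))\<^sup>2 / eff_dim s l))) \<le> B"
    by (rule integrable_and_le_from_nn[rotated 2]; use B in simp)+
qed

text \<open>\<open>8 / c\<^sup>2\<close> is the constant of \<open>sq_le_exp\<close>, and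
  \<open>exp c * B\<close> bounds the exponential moment of one plus the normalised squared norm of
  z.\<close>

definition gram_const :: real where "gram_const = 8 / c\<^sup>2 * exp c * B"

text \<open>\<open>2 / c\<close> absorbs the normalised squared norm into an exponential of slope c
  / 2; \<open>exp (c / 2)\<close> is the price for replacing the norm by its square in the
  tilt.\<close>

definition score_const :: real where "score_const = 2 / c * exp (c / 2) * B"

lemma gram_dev_exp:
  assumes l: "l > 0" and n: "n \<ge> 1" "1 / sqrt (real n) \<le> c / 2"
  shows "prob {\<omega> \<in> space M. norm (gram_dev l n \<omega>) \<ge> y} \<le> 2 * exp (gram_const - sqrt (real n) * y / eff_dim s l)"
proof -
  define N where "N = eff_dim s l"
  have N: "N > 0" unfolding N_def by (rule eff_dim_pos[OF l])
  \<comment> \<open>At this scale n times the second-order term of Pinelis' bound is a constant,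
    while the threshold still grows like \<open>sqrt n * y / N\<close>.\<close>
  define u where "u = 1 / sqrt (real n)"
  have u: "u > 0" "u \<le> c / 2" using n by (auto simp: u_def)
  have [measurable]: "random_variable borel (gram l i)" for i
    using gram_indep[OF l] by (auto simp: indep_vars_def)
  have [measurable]: "random_variable borel (z l i)" for i by (rule z_meas[OF l])
  define Y where "Y i \<omega> = (u / N) *\<^sub>R gram l i \<omega>" for i \<omega>
  have [measurable]: "random_variable borel (Y i)" for i unfolding Y_def by measurable
  \<comment> \<open>The added 1 covers the centring: the expected tensor square has norm at most
    N.\<close>
  define \<beta> where "\<beta> i \<omega> = (norm (z l i \<omega>))\<^sup>2 / N + 1" for i \<omega>
  have \<beta>0: "\<beta> i \<omega> \<ge> 0" for i \<omega> using N by (simp add: \<beta>_def)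
  have Ec: "integrable M (\<lambda>\<omega>. exp (c * \<beta> i \<omega>))" "expectation (\<lambda>\<omega>. exp (c * \<beta> i \<omega>)) \<le> exp c * B" for i
  proof -
    have eq: "exp (c * \<beta> i \<omega>) = exp c * exp (c * ((norm (z l i \<omega>))\<^sup>2 / eff_dim s l))" for \<omega>
      by (simp add: \<beta>_def N_def exp_add[symmetric] algebra_simps)
    show "integrable M (\<lambda>\<omega>. exp (c * \<beta> i \<omega>))" "expectation (\<lambda>\<omega>. exp (c * \<beta> i \<omega>)) \<le> exp c * B"
      unfolding eq using exp_z_norm[OF l, of i] by (auto intro: mult_left_mono)
  qed
  have nY: "norm (Y i \<omega>) \<le> u * \<beta> i \<omega>" for i \<omega>
  proof -
    have "norm (expectation (\<lambda>\<omega>. tens e (z l i \<omega>))) \<le> expectation (\<lambda>\<omega>. norm (tens e (z l i \<omega>)))"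
      by (rule integral_norm_bound)
    also have "\<dots> \<le> N" unfolding N_def norm_tens[OF onb] by (rule z_norm_second[OF l])
    finally have "norm (gram l i \<omega>) \<le> (norm (z l i \<omega>))\<^sup>2 + N"
      using norm_triangle_ineq4[of "tens e (z l i \<omega>)" "expectation (\<lambda>\<omega>. tens e (z l i \<omega>))"]
      by (simp add: gram_def norm_tens[OF onb])
    then have "u / N * norm (gram l i \<omega>) \<le> u / N * ((norm (z l i \<omega>))\<^sup>2 + N)"
      using u N by (intro mult_left_mono) auto
    then show ?thesis using u N by (simp add: Y_def \<beta>_def field_simps)
  qed
  have nY2: "norm (Y i \<omega>) \<le> c * \<beta> i \<omega> / 2" for i \<omega>
    using nY[of i \<omega>] mult_right_mono[OF u(2) \<beta>0[of i \<omega>]] by simp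
  have ind: "indep_vars (\<lambda>_. borel) Y UNIV"
    unfolding Y_def[abs_def] by (rule indep_vars_compose2[OF gram_indep[OF l]]) simp
  have ei: "integrable M (\<lambda>\<omega>. exp (norm (Y i \<omega>)))" for i
  proof (rule Bochner_Integration.integrable_bound[OF Ec(1)[of i]])
    have "exp (norm (Y i \<omega>)) \<le> exp (c * \<beta> i \<omega>)" for \<omega>
      using nY2[of i \<omega>] norm_ge_zero[of "Y i \<omega>"] unfolding exp_le_cancel_iff by linarith
    then show "AE \<omega> in M. norm (exp (norm (Y i \<omega>))) \<le> norm (exp (c * \<beta> i \<omega>))" by simp
  qed simp
  have Yi: "integrable M (\<lambda>\<omega>. norm (Y i \<omega>))" for i
  proof (rule Bochner_Integration.integrable_bound[OF ei[of i]])
    have "x \<le> exp x" for x :: real using exp_ge_add_one_self[of x] by linarith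
    then show "AE \<omega> in M. norm (norm (Y i \<omega>)) \<le> norm (exp (norm (Y i \<omega>)))" by simp
  qed simp
  have rho: "expectation (\<lambda>\<omega>. exp (norm (Y i \<omega>)) - 1 - norm (Y i \<omega>)) \<le> u\<^sup>2 * gram_const" for i
  proof -
    have "exp (norm (Y i \<omega>)) - 1 - norm (Y i \<omega>) \<le> u\<^sup>2 * (8 / c\<^sup>2) * exp (c * \<beta> i \<omega>)" for \<omega>
    proof -
      have "exp (norm (Y i \<omega>)) - 1 - norm (Y i \<omega>) \<le> (norm (Y i \<omega>))\<^sup>2 * exp (norm (Y i \<omega>))"
        by (rule exp_minus_le) simp
      also have "\<dots> \<le> (u * \<beta> i \<omega>)\<^sup>2 * exp (c * \<beta> i \<omega> / 2)"
        using nY nY2 by (intro mult_mono power_mono) auto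
      also have "\<dots> \<le> (u\<^sup>2 * (8 / c\<^sup>2 * exp (c * \<beta> i \<omega> / 2))) * exp (c * \<beta> i \<omega> / 2)"
        unfolding power_mult_distrib using sq_le_exp[OF \<beta>0 c] by (intro mult_right_mono mult_left_mono) auto
      also have "\<dots> = u\<^sup>2 * (8 / c\<^sup>2) * exp (c * \<beta> i \<omega>)"
        using exp_add[of "c * \<beta> i \<omega> / 2" "c * \<beta> i \<omega> / 2"] by simp
      finally show ?thesis .
    qed
    then have "expectation (\<lambda>\<omega>. exp (norm (Y i \<omega>)) - 1 - norm (Y i \<omega>)) \<le> expectation (\<lambda>\<omega>. u\<^sup>2 * (8 / c\<^sup>2) * exp (c * \<beta> i \<omega>))"
      using ei Yi Ec by (intro integral_mono) auto
    also have "\<dots> \<le> u\<^sup>2 * (8 / c\<^sup>2) * (exp c * B)"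
      using Ec[of i] by (simp only: integral_mult_right_zero) (intro mult_left_mono, auto)
    finally show ?thesis by (simp add: gram_const_def mult_ac)
  qed
  have mean: "norm (expectation (Y i)) \<le> 0" for i
    unfolding Y_def[abs_def] using gram_mean[OF l, of i] by simp
  have "{\<omega> \<in> space M. norm (gram_dev l n \<omega>) \<ge> y} = {\<omega> \<in> space M. norm (\<Sum>i<n. Y i \<omega>) \<ge> sqrt (real n) * y / N}"
  proof -
    have "norm (\<Sum>i<n. Y i \<omega>) = sqrt (real n) / N * norm (gram_dev l n \<omega>)" for \<omega>
    proof -
      have "(\<Sum>i<n. Y i \<omega>) = (u / N) *\<^sub>R (\<Sum>i<n. gram l i \<omega>)" by (simp add: Y_def scaleR_sum_right)
      also have "\<dots> = (u / N * real n) *\<^sub>R gram_dev l n \<omega>" using n by (simp add: gram_dev_def)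
      also have "u / N * real n = sqrt (real n) / N" using n N by (simp add: u_def field_simps)
      finally show ?thesis using N by simp
    qed
    moreover have "sqrt (real n) * y / N \<le> sqrt (real n) / N * a \<longleftrightarrow> y \<le> a" for a
      using n N by (simp add: divide_le_cancel)
    ultimately show ?thesis by simp
  qed
  also have "prob \<dots> \<le> 2 * exp (real n * (u\<^sup>2 * gram_const + 0) - sqrt (real n) * y / N)"
    by (rule pinelis_tail[OF ind ei rho mean])
  also have "real n * (u\<^sup>2 * gram_const + 0) = gram_const" using n by (simp add: u_def power_divide)
  finally show ?thesis by (simp add: N_def)
qed

text \<open>The tilt t is left free, to be tuned to the rate. What matters is that the variance
  factor \<open>v * \<gamma> powr (2 - q)\<close> survives in the exponent; bounding the clipped
  noise by \<gamma> throughout would replace it by the square of \<gamma>.\<close>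

lemma wscore_exp:
  assumes l: "l > 0" and g: "\<gamma> > 0" and n: "n \<ge> 1" and t: "t > 0" "t * \<gamma> * sqrt (eff_dim s l) \<le> c / 2"
  shows "prob {\<omega> \<in> space M. norm ((1 / real n) *\<^sub>R (\<Sum>i<n. wscore l \<gamma> i \<omega>)) \<ge> v * \<gamma> powr (1 - q) + \<xi>}
    \<le> 2 * exp (real n * t\<^sup>2 * (v * \<gamma> powr (2 - q) * eff_dim s l) * score_const - real n * t * \<xi>)"
proof -
  define N where "N = eff_dim s l"
  have N: "N > 0" unfolding N_def by (rule eff_dim_pos[OF l])
  have [measurable]: "random_variable borel (z l i)" for i by (rule z_meas[OF l])
  have [measurable]: "random_variable borel (wscore l \<gamma> i)" for i by (rule wscore_meas[OF l])
  define Y where "Y i \<omega> = t *\<^sub>R wscore l \<gamma> i \<omega>" for i \<omega>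
  have [measurable]: "random_variable borel (Y i)" for i unfolding Y_def by measurable
  define \<beta> where "\<beta> i \<omega> = (norm (z l i \<omega>))\<^sup>2 / N" for i \<omega>
  have \<beta>0: "\<beta> i \<omega> \<ge> 0" for i \<omega> using N by (simp add: \<beta>_def)
  have Ec: "integrable M (\<lambda>\<omega>. exp (c * \<beta> i \<omega>))" "expectation (\<lambda>\<omega>. exp (c * \<beta> i \<omega>)) \<le> B" for i
    unfolding \<beta>_def N_def by (rule exp_z_norm[OF l])+
  have zb: "t * \<gamma> * norm (z l i \<omega>) \<le> c / 2 + c * \<beta> i \<omega> / 2" for i \<omega>
  proof -
    have nz: "norm (z l i \<omega>) = sqrt N * sqrt (\<beta> i \<omega>)" using N by (simp add: \<beta>_def real_sqrt_divide)
    have "sqrt (\<beta> i \<omega>) \<le> 1 + \<beta> i \<omega>"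
    proof (rule real_le_lsqrt)
      show "0 \<le> 1 + \<beta> i \<omega>" using \<beta>0[of i \<omega>] by simp
      show "\<beta> i \<omega> \<le> (1 + \<beta> i \<omega>)\<^sup>2" using \<beta>0[of i \<omega>] by (simp add: power2_eq_square algebra_simps)
    qed
    then have "(t * \<gamma> * sqrt N) * sqrt (\<beta> i \<omega>) \<le> c / 2 * (1 + \<beta> i \<omega>)"
      using t c \<beta>0[of i \<omega>] unfolding N_def by (intro mult_mono) auto
    then show ?thesis by (simp add: nz algebra_simps)
  qed
  have nY: "norm (Y i \<omega>) = t * (\<bar>huber_score \<gamma> (\<epsilon> i \<omega>)\<bar> * norm (z l i \<omega>))" for i \<omega>
    using t by (simp add: Y_def wscore_def abs_mult)
  have nYg: "norm (Y i \<omega>) \<le> t * \<gamma> * norm (z l i \<omega>)" for i \<omega>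
    unfolding nY mult.assoc using t g abs_huber_score_le[of \<gamma> "\<epsilon> i \<omega>"]
    by (intro mult_left_mono mult_right_mono) auto
  have ind: "indep_vars (\<lambda>_. borel) Y UNIV"
    unfolding Y_def[abs_def] by (rule indep_vars_compose2[OF wscore_indep[OF l]]) simp
  have ei: "integrable M (\<lambda>\<omega>. exp (norm (Y i \<omega>)))" for i
  proof (rule Bochner_Integration.integrable_bound)
    show "integrable M (\<lambda>\<omega>. exp (c / 2) * exp (c * \<beta> i \<omega>))" using Ec by simp
    have "exp (norm (Y i \<omega>)) \<le> exp (c / 2) * exp (c * \<beta> i \<omega>)" for \<omega>
      using nYg[of i \<omega>] zb[of i \<omega>] \<beta>0[of i \<omega>] c mult_nonneg_nonneg[of c "\<beta> i \<omega>"]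
      unfolding exp_add[symmetric] exp_le_cancel_iff by linarith
    then show "AE \<omega> in M. norm (exp (norm (Y i \<omega>))) \<le> norm (exp (c / 2) * exp (c * \<beta> i \<omega>))" by simp
  qed simp
  have Yi: "integrable M (\<lambda>\<omega>. norm (Y i \<omega>))" for i
    unfolding Y_def using wscore_integrable[OF l g, of i] by simp
  \<comment> \<open>A function of the covariate alone, so that the noise moment can be integrated
    against it.\<close>
  define f where "f x = (norm (reg_isqrt l x))\<^sup>2 * exp (t * \<gamma> * norm (reg_isqrt l x))" for x
  have [measurable]: "reg_isqrt l \<in> borel_measurable borel" by (rule reg_isqrt_meas[OF l])
  have fm1: "f \<in> borel_measurable borel" unfolding f_def by measurable
  have fm2: "\<And>x. f x \<ge> 0" unfolding f_def by simp
  note fm = fm1 fm2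
  have fX: "f (X i \<omega>) = (norm (z l i \<omega>))\<^sup>2 * exp (t * \<gamma> * norm (z l i \<omega>))" for i \<omega>
    by (simp add: f_def z_def)
  have fle: "f (X i \<omega>) \<le> N * (2 / c * exp (c / 2)) * exp (c * \<beta> i \<omega>)" for i \<omega>
  proof -
    have "\<beta> i \<omega> \<le> 2 / c * exp (c * \<beta> i \<omega> / 2)"
    proof -
      have "c * \<beta> i \<omega> / 2 \<le> exp (c * \<beta> i \<omega> / 2)" using exp_ge_add_one_self[of "c * \<beta> i \<omega> / 2"] by linarith
      then show ?thesis using c by (simp add: field_simps)
    qed
    moreover have "exp (t * \<gamma> * norm (z l i \<omega>)) \<le> exp (c / 2) * exp (c * \<beta> i \<omega> / 2)"
      using zb[of i \<omega>] by (simp add: exp_add[symmetric])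
    ultimately have "\<beta> i \<omega> * exp (t * \<gamma> * norm (z l i \<omega>)) \<le>
       (2 / c * exp (c * \<beta> i \<omega> / 2)) * (exp (c / 2) * exp (c * \<beta> i \<omega> / 2))"
      using c by (intro mult_mono) auto
    also have "\<dots> = 2 / c * exp (c / 2) * exp (c * \<beta> i \<omega>)"
      using exp_add[of "c * \<beta> i \<omega> / 2" "c * \<beta> i \<omega> / 2"] by simp
    finally have "N * (\<beta> i \<omega> * exp (t * \<gamma> * norm (z l i \<omega>))) \<le> N * (2 / c * exp (c / 2) * exp (c * \<beta> i \<omega>))"
      using N by (intro mult_left_mono) auto
    moreover have "f (X i \<omega>) = N * (\<beta> i \<omega> * exp (t * \<gamma> * norm (z l i \<omega>)))" using N by (simp add: fX \<beta>_def)
    ultimately show ?thesis by (simp add: mult.assoc)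
  qed
  have fi: "integrable M (\<lambda>\<omega>. f (X i \<omega>))" for i
  proof (rule Bochner_Integration.integrable_bound)
    show "integrable M (\<lambda>\<omega>. N * (2 / c * exp (c / 2)) * exp (c * \<beta> i \<omega>))" using Ec by simp
    show "(\<lambda>\<omega>. f (X i \<omega>)) \<in> borel_measurable M" using fm by measurable
    have "norm (f (X i \<omega>)) \<le> norm (N * (2 / c * exp (c / 2)) * exp (c * \<beta> i \<omega>))" for \<omega>
      using fle[of i \<omega>] fm(2)[of "X i \<omega>"] unfolding real_norm_def by linarith
    then show "AE \<omega> in M. norm (f (X i \<omega>)) \<le> norm (N * (2 / c * exp (c / 2)) * exp (c * \<beta> i \<omega>))" by simp
  qed
  have Ef: "expectation (\<lambda>\<omega>. f (X i \<omega>)) \<le> N * score_const" for i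
  proof -
    have "expectation (\<lambda>\<omega>. f (X i \<omega>)) \<le> expectation (\<lambda>\<omega>. N * (2 / c * exp (c / 2)) * exp (c * \<beta> i \<omega>))"
      using fi fle Ec by (intro integral_mono) auto
    also have "\<dots> \<le> N * (2 / c * exp (c / 2)) * B"
      using Ec[of i] N c by (simp only: integral_mult_right_zero) (intro mult_left_mono, auto)
    finally show ?thesis by (simp add: score_const_def mult_ac)
  qed
  have le: "(huber_score \<gamma> (\<epsilon> i \<omega>))\<^sup>2 \<le> \<gamma> powr (2 - q) * \<bar>\<epsilon> i \<omega>\<bar> powr q" for i \<omega>
    using q by (intro huber_score_sq_le[OF g]) auto
  have w: "integrable M (\<lambda>\<omega>. f (X i \<omega>) * (huber_score \<gamma> (\<epsilon> i \<omega>))\<^sup>2)"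
    "expectation (\<lambda>\<omega>. f (X i \<omega>) * (huber_score \<gamma> (\<epsilon> i \<omega>))\<^sup>2) \<le> \<gamma> powr (2 - q) * v * expectation (\<lambda>\<omega>. f (X i \<omega>))" for i
    by (rule noise_weighted[of f "\<lambda>\<omega>. (huber_score \<gamma> (\<epsilon> i \<omega>))\<^sup>2" i, OF fm(1) _ fm(2) fi _ le]; simp)+
  have rho: "expectation (\<lambda>\<omega>. exp (norm (Y i \<omega>)) - 1 - norm (Y i \<omega>)) \<le> t\<^sup>2 * (v * \<gamma> powr (2 - q) * N) * score_const" for i
  proof -
    have "exp (norm (Y i \<omega>)) - 1 - norm (Y i \<omega>) \<le> t\<^sup>2 * (f (X i \<omega>) * (huber_score \<gamma> (\<epsilon> i \<omega>))\<^sup>2)" for \<omega>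
    proof -
      have "exp (norm (Y i \<omega>)) - 1 - norm (Y i \<omega>) \<le> (norm (Y i \<omega>))\<^sup>2 * exp (norm (Y i \<omega>))"
        by (rule exp_minus_le) simp
      \<comment> \<open>Only inside the exponential is the clipped noise replaced by \<gamma>; its
        square in front is kept for the noise moment.\<close>
      also have "\<dots> \<le> (norm (Y i \<omega>))\<^sup>2 * exp (t * \<gamma> * norm (z l i \<omega>))"
        using nYg by (intro mult_left_mono) auto
      also have "\<dots> = t\<^sup>2 * (f (X i \<omega>) * (huber_score \<gamma> (\<epsilon> i \<omega>))\<^sup>2)"
        by (simp add: nY fX power_mult_distrib mult_ac)
      finally show ?thesis .
    qed
    then have "expectation (\<lambda>\<omega>. exp (norm (Y i \<omega>)) - 1 - norm (Y i \<omega>)) \<le>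
        expectation (\<lambda>\<omega>. t\<^sup>2 * (f (X i \<omega>) * (huber_score \<gamma> (\<epsilon> i \<omega>))\<^sup>2))"
      using ei Yi w(1) by (intro integral_mono) auto
    also have "\<dots> \<le> t\<^sup>2 * (\<gamma> powr (2 - q) * v * (N * score_const))"
    proof -
      have "\<gamma> powr (2 - q) * v * expectation (\<lambda>\<omega>. f (X i \<omega>)) \<le> \<gamma> powr (2 - q) * v * (N * score_const)"
        using Ef[of i] v by (intro mult_left_mono) auto
      then show ?thesis
        using w(2)[of i] by (simp only: integral_mult_right_zero) (intro mult_left_mono, auto)
    qed
    finally show ?thesis by (simp add: mult_ac)
  qed
  have mean: "norm (expectation (Y i)) \<le> t * (v * \<gamma> powr (1 - q))" for i
    unfolding Y_def[abs_def] using wscore_mean[OF l g, of i] t by simp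
  have "{\<omega> \<in> space M. norm ((1 / real n) *\<^sub>R (\<Sum>i<n. wscore l \<gamma> i \<omega>)) \<ge> v * \<gamma> powr (1 - q) + \<xi>} =
    {\<omega> \<in> space M. norm (\<Sum>i<n. Y i \<omega>) \<ge> real n * t * (v * \<gamma> powr (1 - q) + \<xi>)}"
  proof -
    have eq: "norm (\<Sum>i<n. Y i \<omega>) = real n * t * norm ((1 / real n) *\<^sub>R (\<Sum>i<n. wscore l \<gamma> i \<omega>))" for \<omega>
      using n t unfolding Y_def scaleR_sum_right[symmetric] by simp
    have p: "real n * t > 0" using n t by simp
    show ?thesis unfolding eq mult_le_cancel_left_pos[OF p] ..
  qed
  also have "prob \<dots> \<le> 2 * exp (real n * (t\<^sup>2 * (v * \<gamma> powr (2 - q) * N) * score_const + t * (v * \<gamma> powr (1 - q)))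
     - real n * t * (v * \<gamma> powr (1 - q) + \<xi>))"
    by (rule pinelis_tail[OF ind ei rho mean])
  finally show ?thesis by (simp add: N_def algebra_simps)
qed

end

section \<open>From the sampling model to moment conditions\<close>

lemma (in prob_space) gen_subalgebra_sigma_finite:
  assumes "random_variable borel X"
  shows "sigma_finite_subalgebra M (gen_subalgebra M X)"
proof -
  have "subalgebra M (gen_subalgebra M X)"
    using assms by (auto simp: subalgebra_def gen_subalgebra_def sets_vimage_algebra2 measurable_def)
  then have "finite_measure_subalgebra M (gen_subalgebra M X)" by unfold_locales
  then show ?thesis by (rule finite_measure_subalgebra_is_sigma_finite)
qed

lemma measurable_gen_subalgebra:
  assumes "F \<in> measurable borel N"
  shows "(\<lambda>\<omega>. F (X \<omega>)) \<in> measurable (gen_subalgebra M X) N"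
  unfolding gen_subalgebra_def
  by (rule measurable_compose[OF measurable_vimage_algebra1 assms]) simp

lemma (in prob_space) cond_moment_nn_integral:
  assumes X: "random_variable borel X" and [measurable]: "random_variable borel \<epsilon>"
    and cond: "cond_moment_le M X \<epsilon> q v" and F: "F \<in> borel_measurable borel"
  shows "(\<integral>\<^sup>+\<omega>. F (X \<omega>) * ennreal (\<bar>\<epsilon> \<omega>\<bar> powr q) \<partial>M) \<le> ennreal v * (\<integral>\<^sup>+\<omega>. F (X \<omega>) \<partial>M)"
proof -
  interpret sigma_finite_subalgebra M "gen_subalgebra M X" by (rule gen_subalgebra_sigma_finite[OF X])
  have [measurable]: "(\<lambda>\<omega>. F (X \<omega>)) \<in> borel_measurable M" by (rule measurable_compose[OF X F])
  have "(\<integral>\<^sup>+\<omega>. F (X \<omega>) * ennreal (\<bar>\<epsilon> \<omega>\<bar> powr q) \<partial>M) =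
     (\<integral>\<^sup>+\<omega>. F (X \<omega>) * nn_cond_exp M (gen_subalgebra M X) (\<lambda>\<omega>. ennreal (\<bar>\<epsilon> \<omega>\<bar> powr q)) \<omega> \<partial>M)"
    by (rule nn_cond_exp_intg[symmetric]) (use F in \<open>auto intro: measurable_gen_subalgebra\<close>)
  also have "\<dots> \<le> (\<integral>\<^sup>+\<omega>. ennreal v * F (X \<omega>) \<partial>M)"
  proof (rule nn_integral_mono_AE)
    show "AE \<omega> in M. F (X \<omega>) * nn_cond_exp M (gen_subalgebra M X) (\<lambda>\<omega>. ennreal (\<bar>\<epsilon> \<omega>\<bar> powr q)) \<omega> \<le> ennreal v * F (X \<omega>)"
      using cond unfolding cond_moment_le_def
      by eventually_elim (simp add: mult.commute[of "ennreal v"] mult_left_mono)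
  qed
  also have "\<dots> = ennreal v * (\<integral>\<^sup>+\<omega>. F (X \<omega>) \<partial>M)" by (rule nn_integral_cmult) measurable
  finally show ?thesis .
qed

lemma le_one_plus_powr:
  fixes x q :: real
  assumes "x \<ge> 0" "q \<ge> 1"
  shows "x \<le> 1 + x powr q"
proof (cases "x \<le> 1")
  case False
  then have "x powr 1 \<le> x powr q" using assms by (intro powr_mono) auto
  then show ?thesis using False by simp
qed (simp add: add_increasing2)

text \<open>Integrability of the product has to come first, before the conditional mean can be used.
  It follows from bounding the noise by 1 plus its q-th power and applying the conditional moment
  bound with the weight \<open>\<bar>X \<omega> \<bullet> k\<bar>\<close>.\<close>

lemma (in prob_space) cond_mean_zero_inner:
  assumes X: "random_variable borel X" and e [measurable]: "random_variable borel \<epsilon>"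
    and mean: "AE \<omega> in M. real_cond_exp M (gen_subalgebra M X) \<epsilon> \<omega> = 0"
    and cond: "cond_moment_le M X \<epsilon> q v" and q: "q \<ge> 1" and int: "integrable M X"
  shows "integrable M (\<lambda>\<omega>. (X \<omega> \<bullet> k) * \<epsilon> \<omega>)" "expectation (\<lambda>\<omega>. (X \<omega> \<bullet> k) * \<epsilon> \<omega>) = 0"
proof -
  interpret sigma_finite_subalgebra M "gen_subalgebra M X" by (rule gen_subalgebra_sigma_finite[OF X])
  note [measurable] = X
  define F where "F x = ennreal \<bar>x \<bullet> k\<bar>" for x :: L2
  have Xk: "integrable M (\<lambda>\<omega>. \<bar>X \<omega> \<bullet> k\<bar>)" using int by auto
  have fin: "(\<integral>\<^sup>+\<omega>. F (X \<omega>) \<partial>M) < \<infinity>"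
    using Xk unfolding F_def by (simp add: nn_integral_eq_integral)
  have "(\<integral>\<^sup>+\<omega>. norm ((X \<omega> \<bullet> k) * \<epsilon> \<omega>) \<partial>M) \<le> (\<integral>\<^sup>+\<omega>. F (X \<omega>) + F (X \<omega>) * ennreal (\<bar>\<epsilon> \<omega>\<bar> powr q) \<partial>M)"
  proof (rule nn_integral_mono)
    fix \<omega>
    have "\<bar>X \<omega> \<bullet> k\<bar> * \<bar>\<epsilon> \<omega>\<bar> \<le> \<bar>X \<omega> \<bullet> k\<bar> * (1 + \<bar>\<epsilon> \<omega>\<bar> powr q)"
      by (intro mult_left_mono le_one_plus_powr q) auto
    then have "ennreal (norm ((X \<omega> \<bullet> k) * \<epsilon> \<omega>)) \<le> ennreal (\<bar>X \<omega> \<bullet> k\<bar> + \<bar>X \<omega> \<bullet> k\<bar> * \<bar>\<epsilon> \<omega>\<bar> powr q)"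
      by (intro ennreal_leI) (simp add: abs_mult distrib_left)
    also have "\<dots> = F (X \<omega>) + F (X \<omega>) * ennreal (\<bar>\<epsilon> \<omega>\<bar> powr q)"
      by (simp add: F_def ennreal_mult ennreal_plus)
    finally show "ennreal (norm ((X \<omega> \<bullet> k) * \<epsilon> \<omega>)) \<le> F (X \<omega>) + F (X \<omega>) * ennreal (\<bar>\<epsilon> \<omega>\<bar> powr q)" .
  qed
  also have "\<dots> = (\<integral>\<^sup>+\<omega>. F (X \<omega>) \<partial>M) + (\<integral>\<^sup>+\<omega>. F (X \<omega>) * ennreal (\<bar>\<epsilon> \<omega>\<bar> powr q) \<partial>M)"
    by (rule nn_integral_add) (auto simp: F_def)
  also have "\<dots> \<le> (\<integral>\<^sup>+\<omega>. F (X \<omega>) \<partial>M) + ennreal v * (\<integral>\<^sup>+\<omega>. F (X \<omega>) \<partial>M)"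
    by (intro add_left_mono cond_moment_nn_integral[OF X e cond]) (simp add: F_def)
  also have "\<dots> < \<infinity>" using fin by (simp add: ennreal_mult_less_top)
  finally show i: "integrable M (\<lambda>\<omega>. (X \<omega> \<bullet> k) * \<epsilon> \<omega>)"
    by (intro integrableI_bounded) auto
  have "expectation (\<lambda>\<omega>. (X \<omega> \<bullet> k) * \<epsilon> \<omega>) = expectation (\<lambda>\<omega>. (X \<omega> \<bullet> k) * real_cond_exp M (gen_subalgebra M X) \<epsilon> \<omega>)"
    by (rule real_cond_exp_intg(2)[symmetric, OF i]) (auto intro: measurable_gen_subalgebra[where F = "\<lambda>x. x \<bullet> k"])
  also have "\<dots> = expectation (\<lambda>\<omega>. 0)"
  proof (rule integral_cong_AE)
    show "AE \<omega> in M. (X \<omega> \<bullet> k) * real_cond_exp M (gen_subalgebra M X) \<epsilon> \<omega> = 0"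
      using mean by eventually_elim simp
  qed measurable
  finally show "expectation (\<lambda>\<omega>. (X \<omega> \<bullet> k) * \<epsilon> \<omega>) = 0" by simp
qed

lemma (in prob_space) cov_op_inner:
  assumes [measurable]: "random_variable borel X" and sq: "integrable M (\<lambda>\<omega>. (norm (X \<omega>))\<^sup>2)"
  shows "cov_op M X f \<bullet> f = expectation (\<lambda>\<omega>. (X \<omega> \<bullet> f)\<^sup>2)"
proof -
  have "integrable M (\<lambda>\<omega>. rank_one (X \<omega>) f)"
  proof (rule Bochner_Integration.integrable_bound)
    show "integrable M (\<lambda>\<omega>. norm f * (norm (X \<omega>))\<^sup>2)" using sq by simp
    show "(\<lambda>\<omega>. rank_one (X \<omega>) f) \<in> borel_measurable M" unfolding rank_one_def by measurable
    have "norm (rank_one x f) \<le> norm f * (norm x)\<^sup>2" for x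
      using mult_right_mono[OF Cauchy_Schwarz_ineq2[of x f], of "norm x"]
      by (simp add: rank_one_def power2_eq_square mult_ac)
    then show "AE \<omega> in M. norm (rank_one (X \<omega>) f) \<le> norm (norm f * (norm (X \<omega>))\<^sup>2)" by simp
  qed
  then have "cov_op M X f \<bullet> f = expectation (\<lambda>\<omega>. rank_one (X \<omega>) f \<bullet> f)"
    unfolding cov_op_def by (simp add: integral_inner_left)
  then show ?thesis by (simp add: rank_one_def power2_eq_square)
qed

lemma (in prob_space) iid_copies_marginals:
  fixes X :: "'a \<Rightarrow> L2" and y :: "'a \<Rightarrow> real"
  assumes "iid_copies M (\<lambda>\<omega>. (X \<omega>, y \<omega>)) (\<lambda>i \<omega>. (Xs i \<omega>, ys i \<omega>))"
  shows "random_variable borel X" "random_variable borel (Xs i)" "random_variable borel (ys i)"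
    "distr M borel (Xs i) = distr M borel X"
proof -
  have m: "(\<lambda>\<omega>. (X \<omega>, y \<omega>)) \<in> borel_measurable M" "(\<lambda>\<omega>. (Xs i \<omega>, ys i \<omega>)) \<in> borel_measurable M"
    using assms by (auto simp: iid_copies_def indep_vars_def)
  have f: "fst \<in> borel_measurable (borel :: (L2 \<times> real) measure)" "snd \<in> borel_measurable (borel :: (L2 \<times> real) measure)"
    by (simp_all add: borel_prod[symmetric])
  show X: "random_variable borel X" and Xs: "random_variable borel (Xs i)" and "random_variable borel (ys i)"
    using measurable_compose[OF m(1) f(1)] measurable_compose[OF m(2) f(1)] measurable_compose[OF m(2) f(2)] by simp_all
  have "distr M borel (\<lambda>\<omega>. (Xs i \<omega>, ys i \<omega>)) = distr M borel (\<lambda>\<omega>. (X \<omega>, y \<omega>))"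
    using assms by (auto simp: iid_copies_def)
  then have "distr (distr M borel (\<lambda>\<omega>. (Xs i \<omega>, ys i \<omega>))) borel fst = distr (distr M borel (\<lambda>\<omega>. (X \<omega>, y \<omega>))) borel fst"
    by simp
  then show "distr M borel (Xs i) = distr M borel X"
    by (simp add: distr_distr[OF f(1) m(1)] distr_distr[OF f(1) m(2)] comp_def)
qed

lemma integral_eq_if_distr_eq:
  fixes g :: "'b::topological_space \<Rightarrow> real"
  assumes d: "distr M borel U = distr M borel V" and [measurable]: "U \<in> borel_measurable M" "V \<in> borel_measurable M"
    "g \<in> borel_measurable borel"
  shows "(\<integral>\<omega>. g (U \<omega>) \<partial>M) = (\<integral>\<omega>. g (V \<omega>) \<partial>M)"
    "integrable M (\<lambda>\<omega>. g (U \<omega>)) \<longleftrightarrow> integrable M (\<lambda>\<omega>. g (V \<omega>))"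
    "(\<integral>\<^sup>+\<omega>. ennreal (g (U \<omega>)) \<partial>M) = (\<integral>\<^sup>+\<omega>. ennreal (g (V \<omega>)) \<partial>M)"
proof -
  show "(\<integral>\<omega>. g (U \<omega>) \<partial>M) = (\<integral>\<omega>. g (V \<omega>) \<partial>M)"
    using integral_distr[of U M borel g] integral_distr[of V M borel g] d by simp
  show "integrable M (\<lambda>\<omega>. g (U \<omega>)) \<longleftrightarrow> integrable M (\<lambda>\<omega>. g (V \<omega>))"
    using integrable_distr_eq[of U M borel g] integrable_distr_eq[of V M borel g] d by simp
  show "(\<integral>\<^sup>+\<omega>. ennreal (g (U \<omega>)) \<partial>M) = (\<integral>\<^sup>+\<omega>. ennreal (g (V \<omega>)) \<partial>M)"
    using nn_integral_distr[of U M borel "\<lambda>x. ennreal (g x)"] nn_integral_distr[of V M borel "\<lambda>x. ennreal (g x)"] d by simp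
qed

text \<open>Each eigenvalue is the variance of a coordinate of X, so by Parseval the partial sums of
  eigenvalues are at most the expected squared norm.\<close>

lemma spectral_decomposition_eigen_system:
  fixes M :: "'w measure" and X :: "'w \<Rightarrow> L2"
  assumes "prob_space M" and X [measurable]: "X \<in> borel_measurable M"
    and sq: "integrable M (\<lambda>\<omega>. (norm (X \<omega>))\<^sup>2)"
    and spec: "spectral_decomposition (cov_op M X) s e"
  shows "eigen_system s e"
    "(\<lambda>j. s j * (f \<bullet> e j)\<^sup>2) sums (\<integral>\<omega>. (X \<omega> \<bullet> f)\<^sup>2 \<partial>M)"
proof -
  interpret prob_space M by fact
  have e: "orthonormal_basis e" and dec: "decseq s" and pos: "\<And>j. s j > 0"
    and sums: "\<And>f. (\<lambda>j. s j *\<^sub>R rank_one (e j) f) sums cov_op M X f"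
    using spec by (auto simp: spectral_decomposition_def)
  show second: "(\<lambda>j. s j * (f \<bullet> e j)\<^sup>2) sums (\<integral>\<omega>. (X \<omega> \<bullet> f)\<^sup>2 \<partial>M)" for f
    using bounded_linear.sums[OF bounded_linear_inner_left sums, of f f]
    unfolding cov_op_inner[OF X sq] by (simp add: rank_one_def power2_eq_square inner_commute[of f] mult.assoc)
  have sj: "(\<integral>\<omega>. (X \<omega> \<bullet> e j)\<^sup>2 \<partial>M) = s j" for j
  proof -
    have "(\<lambda>k. s k * (e j \<bullet> e k)\<^sup>2) = (\<lambda>k. if k = j then s k else 0)"
      by (auto simp: orthonormal_basisD[OF e])
    then show ?thesis using second[of "e j"] sums_If_finite[of "\<lambda>k. k = j" s] by (simp add: sums_unique2)
  qed
  \<comment> \<open>A non-integrable function has integral 0 by convention, while this integral is a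
    positive eigenvalue.\<close>
  have int: "integrable M (\<lambda>\<omega>. (X \<omega> \<bullet> e j)\<^sup>2)" for j
    by (rule ccontr) (use sj[of j] pos[of j] in \<open>simp add: not_integrable_integral_eq\<close>)
  have "summable s"
  proof (rule summableI_nonneg_bounded)
    show "0 \<le> s n" for n using pos[of n] by simp
    fix n
    have "(\<Sum>j<n. s j) = expectation (\<lambda>\<omega>. \<Sum>j<n. (X \<omega> \<bullet> e j)\<^sup>2)"
      using int by (simp add: sj)
    also have "\<dots> \<le> expectation (\<lambda>\<omega>. (norm (X \<omega>))\<^sup>2)"
    proof (rule integral_mono)
      show "(\<Sum>j<n. (X \<omega> \<bullet> e j)\<^sup>2) \<le> (norm (X \<omega>))\<^sup>2" for \<omega>
        using parseval[OF e, of "X \<omega>"] sum_le_suminf[of "\<lambda>j. (X \<omega> \<bullet> e j)\<^sup>2" "{..<n}"] by (simp add: sums_iff)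
    qed (use int sq in auto)
    finally show "(\<Sum>j<n. s j) \<le> expectation (\<lambda>\<omega>. (norm (X \<omega>))\<^sup>2)" .
  qed
  then show "eigen_system s e" using e dec pos by unfold_locales auto
qed

text \<open>K is the fourth power of the moment constant. The noise is taken as the residual of the
  model, which agrees with the given noise on the sample space and makes the model equation hold at
  every point of the type.\<close>

lemma model_regression:
  fixes M :: "'w measure" and X :: "'w \<Rightarrow> L2" and y :: "'w \<Rightarrow> real"
    and Xs :: "nat \<Rightarrow> 'w \<Rightarrow> L2" and ys \<epsilon> :: "nat \<Rightarrow> 'w \<Rightarrow> real"
  assumes ps: "prob_space M"
    and iid: "iid_copies M (\<lambda>\<omega>. (X \<omega>, y \<omega>)) (\<lambda>i \<omega>. (Xs i \<omega>, ys i \<omega>))"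
    and model: "\<And>i \<omega>. \<omega> \<in> space M \<Longrightarrow> ys i \<omega> = f0 \<bullet> Xs i \<omega> + \<epsilon> i \<omega>"
    and spec: "spectral_decomposition (cov_op M X) s e"
    and mom: "moment_condition M X"
    and noise: "\<And>i. noise_condition M (Xs i) (\<epsilon> i) \<kappa> v"
    and vc: "vc > 0" "\<kappa> \<le> 1 \<Longrightarrow> vc = v" "\<And>i. \<kappa> > 1 \<Longrightarrow> cond_moment_le M (Xs i) (\<epsilon> i) 2 vc"
  obtains K where "regression M s e Xs (\<lambda>i \<omega>. ys i \<omega> - f0 \<bullet> Xs i \<omega>) (1 + min \<kappa> 1) vc K"
proof -
  interpret prob_space M by fact
  note m [measurable] = iid_copies_marginals(1,2,3)[OF iid] and d = iid_copies_marginals(4)[OF iid]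
  have X4: "integrable M (\<lambda>\<omega>. (norm (X \<omega>)) ^ 4)" using mom by (simp add: moment_condition_def)
  have X2: "integrable M (\<lambda>\<omega>. (norm (X \<omega>))\<^sup>2)"
  proof (rule Bochner_Integration.integrable_bound)
    show "integrable M (\<lambda>\<omega>. 1 + (norm (X \<omega>)) ^ 4)" using X4 by simp
    have "x\<^sup>2 \<le> 1 + x ^ 4" for x :: real
    proof -
      have "0 \<le> x ^ 4" by simp
      moreover have "2 * x\<^sup>2 \<le> x ^ 4 + 1" using zero_le_power2[of "x\<^sup>2 - 1"] by (simp add: power2_diff)
      ultimately show ?thesis by linarith
    qed
    then show "AE \<omega> in M. norm ((norm (X \<omega>))\<^sup>2) \<le> norm (1 + (norm (X \<omega>)) ^ 4)" by simp
  qed simp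
  note es = spectral_decomposition_eigen_system[OF ps m(1) X2 spec]
  obtain C where C: "C > 0" "\<And>f. root 4 (\<integral>\<omega>. (X \<omega> \<bullet> f) ^ 4 \<partial>M) \<le> C * sqrt (\<integral>\<omega>. (X \<omega> \<bullet> f)\<^sup>2 \<partial>M)"
    using mom by (auto simp: moment_condition_def)
  define q where "q = 1 + min \<kappa> 1"
  have \<kappa>: "\<kappa> > 0" using noise[of 0] by (simp add: noise_condition_def)
  then have q: "1 < q" "q \<le> 2" by (auto simp: q_def)
  have cond: "cond_moment_le M (Xs i) (\<epsilon> i) q vc" for i
  proof (cases "\<kappa> \<le> 1")
    case True
    then show ?thesis using noise[of i] vc(2) by (simp add: noise_condition_def q_def)
  next
    case False
    then show ?thesis using vc(3)[of i] by (simp add: q_def)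
  qed
  have mean: "AE \<omega> in M. real_cond_exp M (gen_subalgebra M (Xs i)) (\<epsilon> i) \<omega> = 0" for i
    using noise[of i] by (simp add: noise_condition_def)
  have em [measurable]: "random_variable borel (\<epsilon> i)" for i
  proof -
    have "(\<lambda>\<omega>. ys i \<omega> - f0 \<bullet> Xs i \<omega>) \<in> borel_measurable M" by measurable
    then show ?thesis by (rule measurable_cong[THEN iffD1, rotated]) (simp add: model)
  qed
  have eq: "ys i \<omega> - f0 \<bullet> Xs i \<omega> = \<epsilon> i \<omega>" if "\<omega> \<in> space M" for i \<omega> using model[OF that] by simp
  have Xs2: "integrable M (\<lambda>\<omega>. (norm (Xs i \<omega>))\<^sup>2)" for i
    using integral_eq_if_distr_eq(2)[OF d m(2) m(1), where g = "\<lambda>x. (norm x)\<^sup>2"] X2 by simp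
  have Xsi: "integrable M (Xs i)" for i by (rule integrable_norm_from_square) (use Xs2 in auto)
  have X4f: "integrable M (\<lambda>\<omega>. (X \<omega> \<bullet> f) ^ 4)" for f
  proof (rule Bochner_Integration.integrable_bound)
    show "integrable M (\<lambda>\<omega>. (norm f) ^ 4 * (norm (X \<omega>)) ^ 4)" using X4 by simp
    have "norm ((x \<bullet> f) ^ 4) \<le> norm ((norm f) ^ 4 * (norm x) ^ 4)" for x
    proof -
      have "\<bar>x \<bullet> f\<bar> ^ 4 \<le> (norm f * norm x) ^ 4"
        using Cauchy_Schwarz_ineq2[of x f] by (intro power_mono) (auto simp: mult.commute)
      then show ?thesis by (simp add: power_abs power_mult_distrib)
    qed
    then show "AE \<omega> in M. norm ((X \<omega> \<bullet> f) ^ 4) \<le> norm ((norm f) ^ 4 * (norm (X \<omega>)) ^ 4)" by simp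
  qed simp
  have X4le: "(\<integral>\<omega>. (X \<omega> \<bullet> f) ^ 4 \<partial>M) \<le> C ^ 4 * (\<integral>\<omega>. (X \<omega> \<bullet> f)\<^sup>2 \<partial>M)\<^sup>2" for f
  proof -
    define a b where "a = (\<integral>\<omega>. (X \<omega> \<bullet> f) ^ 4 \<partial>M)" and "b = (\<integral>\<omega>. (X \<omega> \<bullet> f)\<^sup>2 \<partial>M)"
    have ab: "a \<ge> 0" "b \<ge> 0" by (auto simp: a_def b_def)
    have "a = root 4 a ^ 4" using ab by simp
    also have "\<dots> \<le> (C * sqrt b) ^ 4" using C(2)[of f] ab by (intro power_mono) (auto simp: a_def b_def)
    also have "\<dots> = C ^ 4 * ((sqrt b)\<^sup>2)\<^sup>2" by (simp add: power_mult_distrib)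
    also have "(sqrt b)\<^sup>2 = b" using ab by simp
    finally show ?thesis by (simp add: a_def b_def)
  qed
  have "regression M s e Xs (\<lambda>i \<omega>. ys i \<omega> - f0 \<bullet> Xs i \<omega>) q vc (C ^ 4)"
  proof (intro regression.intro regression_axioms.intro)
    show "prob_space M" by fact
    show "eigen_system s e" by (rule es)
    have "(\<lambda>(x, w). (x, w - f0 \<bullet> x)) \<in> borel_measurable (borel :: (L2 \<times> real) measure)"
      unfolding borel_prod[symmetric] by measurable
    moreover have "indep_vars (\<lambda>_. borel) (\<lambda>i \<omega>. (Xs i \<omega>, ys i \<omega>)) UNIV"
      using iid by (simp add: iid_copies_def)
    ultimately show "indep_vars (\<lambda>_. borel) (\<lambda>i \<omega>. (Xs i \<omega>, ys i \<omega> - f0 \<bullet> Xs i \<omega>)) UNIV"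
      using indep_vars_compose2[of "\<lambda>_. borel" "\<lambda>i \<omega>. (Xs i \<omega>, ys i \<omega>)" UNIV "\<lambda>_ (x, w). (x, w - f0 \<bullet> x)" "\<lambda>_. borel"]
      by simp
    show "1 < q" "q \<le> 2" "vc > 0" "C ^ 4 > 0" using q vc C by auto
    show "integrable M (\<lambda>\<omega>. (norm (Xs i \<omega>))\<^sup>2)" for i by (rule Xs2)
    note second = integral_eq_if_distr_eq(1)[OF d m(2) m(1)]
    show "(\<lambda>j. s j * (f \<bullet> e j)\<^sup>2) sums expectation (\<lambda>\<omega>. (Xs i \<omega> \<bullet> f)\<^sup>2)" for i f
      using es(2)[of f] second[where g = "\<lambda>x. (x \<bullet> f)\<^sup>2"] by simp
    show "integrable M (\<lambda>\<omega>. (Xs i \<omega> \<bullet> f) ^ 4)" for i f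
      using integral_eq_if_distr_eq(2)[OF d m(2) m(1), where g = "\<lambda>x. (x \<bullet> f) ^ 4"] X4f by simp
    show "expectation (\<lambda>\<omega>. (Xs i \<omega> \<bullet> f) ^ 4) \<le> C ^ 4 * (expectation (\<lambda>\<omega>. (Xs i \<omega> \<bullet> f)\<^sup>2))\<^sup>2" for i f
      using X4le[of f] second[where g = "\<lambda>x. (x \<bullet> f)\<^sup>2"] second[where g = "\<lambda>x. (x \<bullet> f) ^ 4"] by simp
    show "(\<integral>\<^sup>+\<omega>. F (Xs i \<omega>) * ennreal (\<bar>ys i \<omega> - f0 \<bullet> Xs i \<omega>\<bar> powr q) \<partial>M) \<le> ennreal vc * (\<integral>\<^sup>+\<omega>. F (Xs i \<omega>) \<partial>M)"
      if "F \<in> borel_measurable borel" for i F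
      using cond_moment_nn_integral[OF m(2) em cond that] by (simp add: eq cong: nn_integral_cong)
    show "integrable M (\<lambda>\<omega>. (Xs i \<omega> \<bullet> k) * (ys i \<omega> - f0 \<bullet> Xs i \<omega>))" for i k
      using cond_mean_zero_inner(1)[OF m(2) em mean cond _ Xsi] q
      by (subst Bochner_Integration.integrable_cong[OF refl, of _ _ "\<lambda>\<omega>. (Xs i \<omega> \<bullet> k) * \<epsilon> i \<omega>"]) (auto simp: eq)
    show "expectation (\<lambda>\<omega>. (Xs i \<omega> \<bullet> k) * (ys i \<omega> - f0 \<bullet> Xs i \<omega>)) = 0" for i k
      using cond_mean_zero_inner(2)[OF m(2) em mean cond _ Xsi] q
      by (subst Bochner_Integration.integral_cong[OF refl, of _ _ "\<lambda>\<omega>. (Xs i \<omega> \<bullet> k) * \<epsilon> i \<omega>"]) (auto simp: eq)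
  qed
  then show ?thesis unfolding q_def by (rule that)
qed

text \<open>Bridges eventual bounds and bounds for all n: each of the finitely many remaining
  variables is tight, since \<open>a n > 0\<close> makes its exceedance sets shrink to the empty
  set, and their constants are added up.\<close>

lemma bigO_probI:
  fixes Z :: "nat \<Rightarrow> 'w \<Rightarrow> real"
  assumes "prob_space M" and Z: "\<And>n. n \<ge> 1 \<Longrightarrow> Z n \<in> borel_measurable M"
    and a: "\<And>n. n \<ge> 1 \<Longrightarrow> a n > 0"
    and ev: "\<And>\<delta>. 0 < \<delta> \<Longrightarrow> \<delta> < 1 \<Longrightarrow>
      \<exists>C. \<forall>\<^sub>F n in sequentially. measure M {\<omega> \<in> space M. \<bar>Z n \<omega>\<bar> > C * a n} < \<delta>"
  shows "bigO_prob M Z a"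
  unfolding bigO_prob_def
proof (intro conjI ballI allI impI)
  interpret prob_space M by fact
  show "Z n \<in> borel_measurable M" if "n \<ge> 1" for n by (rule Z[OF that])
  fix \<delta> :: real assume \<delta>: "\<delta> \<in> {0<..<1}"
  have single: "\<exists>C. prob {\<omega> \<in> space M. \<bar>Z n \<omega>\<bar> > C * a n} < \<delta>" if n: "n \<ge> 1" for n
  proof -
    have [measurable]: "Z n \<in> borel_measurable M" by (rule Z[OF n])
    have "(\<lambda>k. prob {\<omega> \<in> space M. \<bar>Z n \<omega>\<bar> > real k * a n}) \<longlonglongrightarrow> prob (\<Inter>k. {\<omega> \<in> space M. \<bar>Z n \<omega>\<bar> > real k * a n})"
    proof (rule finite_Lim_measure_decseq)
      show "decseq (\<lambda>k. {\<omega> \<in> space M. \<bar>Z n \<omega>\<bar> > real k * a n})"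
        unfolding decseq_def
      proof (intro allI impI subsetI)
        fix j k :: nat and \<omega> assume "j \<le> k" and w: "\<omega> \<in> {\<omega> \<in> space M. \<bar>Z n \<omega>\<bar> > real k * a n}"
        then have "real j * a n \<le> real k * a n" using a[OF n] by simp
        with w show "\<omega> \<in> {\<omega> \<in> space M. \<bar>Z n \<omega>\<bar> > real j * a n}" by auto
      qed
    qed auto
    also have "(\<Inter>k. {\<omega> \<in> space M. \<bar>Z n \<omega>\<bar> > real k * a n}) = {}"
      using reals_Archimedean3[OF a[OF n]] by (auto simp: not_less) (meson less_le_not_le)
    finally have "\<forall>\<^sub>F k in sequentially. prob {\<omega> \<in> space M. \<bar>Z n \<omega>\<bar> > real k * a n} < \<delta>"
      using \<delta> by (intro order_tendstoD) auto
    then show ?thesis by (auto simp: eventually_sequentially)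
  qed
  obtain C0 n0 where C0: "\<And>n. n \<ge> n0 \<Longrightarrow> prob {\<omega> \<in> space M. \<bar>Z n \<omega>\<bar> > C0 * a n} < \<delta>"
    using ev[of \<delta>] \<delta> by (auto simp: eventually_sequentially)
  obtain D where D: "\<And>n. n \<ge> 1 \<Longrightarrow> prob {\<omega> \<in> space M. \<bar>Z n \<omega>\<bar> > D n * a n} < \<delta>"
    using single by metis
  define C where "C = \<bar>C0\<bar> + (\<Sum>i<n0. \<bar>D i\<bar>) + 1"
  have mono: "prob {\<omega> \<in> space M. \<bar>Z n \<omega>\<bar> > C * a n} \<le> prob {\<omega> \<in> space M. \<bar>Z n \<omega>\<bar> > c * a n}"
    if n: "n \<ge> 1" and c: "c \<le> C" for n c
  proof (rule finite_measure_mono)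
    have [measurable]: "Z n \<in> borel_measurable M" by (rule Z[OF n])
    show "{\<omega> \<in> space M. \<bar>Z n \<omega>\<bar> > c * a n} \<in> events" by measurable
    have "c * a n \<le> C * a n" using c a[OF n] by (intro mult_right_mono) auto
    then show "{\<omega> \<in> space M. \<bar>Z n \<omega>\<bar> > C * a n} \<subseteq> {\<omega> \<in> space M. \<bar>Z n \<omega>\<bar> > c * a n}" by auto
  qed
  show "\<exists>C>0. \<forall>n\<ge>1. prob {\<omega> \<in> space M. \<bar>Z n \<omega>\<bar> > C * a n} < \<delta>"
  proof (intro exI[of _ C] conjI allI impI)
    have s0: "(\<Sum>i<n0. \<bar>D i\<bar>) \<ge> 0" by (intro sum_nonneg) auto
    then show "C > 0" unfolding C_def by linarith
    fix n :: nat assume n: "n \<ge> 1"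
    show "prob {\<omega> \<in> space M. \<bar>Z n \<omega>\<bar> > C * a n} < \<delta>"
    proof (cases "n \<ge> n0")
      case True
      have "C0 \<le> C" using s0 unfolding C_def by linarith
      from mono[OF n this] C0[OF True] show ?thesis by linarith
    next
      case False
      then have "\<bar>D n\<bar> \<le> (\<Sum>i<n0. \<bar>D i\<bar>)" by (intro member_le_sum) auto
      then have "D n \<le> C" unfolding C_def by linarith
      from mono[OF n this] D[OF n] show ?thesis by linarith
    qed
  qed
qed

section \<open>Rates of convergence\<close>

context regression
begin

text \<open>Shared by both rates: the error exceeds the radius only on one of three events, for
  curvature, Gram deviation and score sum. The level x is free, and a strong penalty makes the first
  event empty.\<close>

lemma error_event:
  assumes l: "l > 0" and g: "\<gamma> > 0" "(\<gamma> / 2) powr q \<ge> 4 * v" and n: "n \<ge> 1"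
    and bias: "2 * l * norm (reg_isqrt l f0) \<le> b"
    and R: "trunc * (32 * (v * \<gamma> powr (1 - q) + x + b)) \<le> \<gamma> / 2"
    and est: "\<And>\<omega>. \<omega> \<in> space M \<Longrightarrow> huber_estimator n \<gamma> l (\<lambda>i. X i \<omega>) (\<lambda>i. ys i \<omega>) (fh \<omega>)"
    and ys: "\<And>i \<omega>. ys i \<omega> = f0 \<bullet> X i \<omega> + \<epsilon> i \<omega>"
  obtains A where "A \<in> events" "prob A \<le> exp (65536 * (eff_dim s l)\<^sup>2 - real n / (512 * (24 * K)\<^sup>2))"
    and "l \<ge> s 0 \<Longrightarrow> prob A = 0"
    and "prob {\<omega> \<in> space M. norm (reg_sqrt l (fh \<omega> - f0)) > 32 * (v * \<gamma> powr (1 - q) + x + b)} \<le>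
      prob A + prob {\<omega> \<in> space M. norm (gram_dev l n \<omega>) \<ge> 1 / 512} +
      prob {\<omega> \<in> space M. norm ((1 / real n) *\<^sub>R (\<Sum>i<n. wscore l \<gamma> i \<omega>)) \<ge> v * \<gamma> powr (1 - q) + x}"
proof -
  have gm: "random_variable borel (gram l i)" for i using gram_indep[OF l] by (auto simp: indep_vars_def)
  have "random_variable borel (gram_dev l n)" unfolding gram_dev_def[abs_def] using gm by measurable
  then have G: "{\<omega> \<in> space M. norm (gram_dev l n \<omega>) \<ge> 1 / 512} \<in> events" by measurable
  have [measurable]: "random_variable borel (wscore l \<gamma> i)" for i by (rule wscore_meas[OF l])
  have S: "{\<omega> \<in> space M. norm ((1 / real n) *\<^sub>R (\<Sum>i<n. wscore l \<gamma> i \<omega>)) \<ge> v * \<gamma> powr (1 - q) + x} \<in> events"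
    by measurable
  obtain A where A: "A \<in> events" "prob A \<le> exp (65536 * (eff_dim s l)\<^sup>2 - real n / (512 * (24 * K)\<^sup>2))"
      "l \<ge> s 0 \<Longrightarrow> prob A = 0"
      "\<And>\<omega>. \<omega> \<in> space M - A \<Longrightarrow> norm (gram_dev l n \<omega>) \<le> 1 / 512 \<Longrightarrow> curved l \<gamma> n \<omega>"
  proof (cases "l \<ge> s 0")
    case True
    show ?thesis by (rule that[of "{}"]) (use curved_if_strong_penalty[OF l True] in auto)
  next
    case False
    obtain A where "A \<in> events" "prob A \<le> exp (65536 * (eff_dim s l)\<^sup>2 - real n / (512 * (24 * K)\<^sup>2))"
      "\<And>\<omega>. \<omega> \<in> space M - A \<Longrightarrow> norm (gram_dev l n \<omega>) \<le> 1 / 512 \<Longrightarrow> curved l \<gamma> n \<omega>"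
      using curvature_event[OF l g n] by blast
    with False show ?thesis by (intro that[of A]) auto
  qed
  have sub: "{\<omega> \<in> space M. norm (reg_sqrt l (fh \<omega> - f0)) > 32 * (v * \<gamma> powr (1 - q) + x + b)} \<subseteq>
    A \<union> {\<omega> \<in> space M. norm (gram_dev l n \<omega>) \<ge> 1 / 512} \<union>
    {\<omega> \<in> space M. norm ((1 / real n) *\<^sub>R (\<Sum>i<n. wscore l \<gamma> i \<omega>)) \<ge> v * \<gamma> powr (1 - q) + x}"
  proof (rule subsetI, rule ccontr)
    fix \<omega> assume w: "\<omega> \<in> {\<omega> \<in> space M. norm (reg_sqrt l (fh \<omega> - f0)) > 32 * (v * \<gamma> powr (1 - q) + x + b)}"
      and "\<omega> \<notin> A \<union> {\<omega> \<in> space M. norm (gram_dev l n \<omega>) \<ge> 1 / 512} \<union>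
        {\<omega> \<in> space M. norm ((1 / real n) *\<^sub>R (\<Sum>i<n. wscore l \<gamma> i \<omega>)) \<ge> v * \<gamma> powr (1 - q) + x}"
    then have ws: "\<omega> \<in> space M" and cu: "curved l \<gamma> n \<omega>"
      and sc: "norm ((1 / real n) *\<^sub>R (\<Sum>i<n. wscore l \<gamma> i \<omega>)) < v * \<gamma> powr (1 - q) + x"
      using A(4)[of \<omega>] by auto
    have 1: "norm (reg_isqrt l (gradient l \<gamma> n f0 \<omega>)) \<le>
       norm ((1 / real n) *\<^sub>R (\<Sum>i<n. wscore l \<gamma> i \<omega>)) + norm ((2 * l) *\<^sub>R reg_isqrt l f0)"
      unfolding reg_isqrt_gradient[OF l] by (rule norm_triangle_ineq4)
    have "norm ((2 * l) *\<^sub>R reg_isqrt l f0) \<le> b" using bias l by simp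
    moreover have "32 * a < 32 * (w + b)" if "a \<le> u + t" "u < w" "t \<le> b" for a u t w :: real
      using that by simp
    ultimately have "32 * norm (reg_isqrt l (gradient l \<gamma> n f0 \<omega>)) < 32 * (v * \<gamma> powr (1 - q) + x + b)"
      using 1 sc by blast
    from localisation[OF l cu this R est[OF ws] ys] w show False by auto
  qed
  show ?thesis
    by (rule that[OF A(1-3) union_bound3[OF A(1) G S sub]])
qed

lemma huber_rate_eq:
  assumes "q = 1 + min \<kappa> 1"
  shows "huber_rate r \<kappa> v s n l \<gamma> =
    sqrt (v * \<gamma> powr (2 - q) * (eff_dim s l / real n)) + l powr (min r (1/2) + 1/2) + v * \<gamma> powr (1 - q)"
  unfolding huber_rate_def Let_def assms by simp

lemma threshold_powr:
  assumes "\<gamma> \<ge> 2 * (4 * v) powr (1 / q)"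
  shows "(\<gamma> / 2) powr q \<ge> 4 * v"
proof -
  have "((4 * v) powr (1 / q)) powr q \<le> (\<gamma> / 2) powr q" using assms q by (intro powr_mono2) auto
  then show ?thesis using q v by (simp add: powr_powr)
qed

text \<open>w is 1 for the rate in probability and the squared logarithm for the high-probability
  rate.\<close>

lemma eff_dim_sq_limit:
  assumes lam: "\<And>n. n \<ge> 1 \<Longrightarrow> lam n > 0" and w: "\<And>n. w n \<ge> 0"
    and lim: "(\<lambda>n. eff_dim s (lam n) / (real n * lam n) * w n) \<longlonglongrightarrow> 0"
  shows "(\<lambda>n. (eff_dim s (lam n))\<^sup>2 / real n * w n) \<longlonglongrightarrow> 0"
proof (rule tendsto_sandwich[of "\<lambda>_. 0" _ _ "\<lambda>n. suminf s * (eff_dim s (lam n) / (real n * lam n) * w n)"])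
  show "(\<lambda>n. suminf s * (eff_dim s (lam n) / (real n * lam n) * w n)) \<longlonglongrightarrow> 0"
    using tendsto_mult[OF tendsto_const[of "suminf s"] lim] by simp
  show "\<forall>\<^sub>F n in sequentially. 0 \<le> (eff_dim s (lam n))\<^sup>2 / real n * w n"
    using w by (intro always_eventually) simp
  show "\<forall>\<^sub>F n in sequentially. (eff_dim s (lam n))\<^sup>2 / real n * w n \<le> suminf s * (eff_dim s (lam n) / (real n * lam n) * w n)"
    using eventually_ge_at_top[of 1]
  proof eventually_elim
    case (elim n)
    note l = lam[OF elim]
    have "eff_dim s (lam n) * eff_dim s (lam n) \<le> eff_dim s (lam n) * (suminf s / lam n)"
      using eff_dim_le_trace[OF l] eff_dim_pos[OF l] by (intro mult_left_mono) auto
    then have "(eff_dim s (lam n))\<^sup>2 / real n \<le> (eff_dim s (lam n) * (suminf s / lam n)) / real n"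
      by (intro divide_right_mono) (auto simp: power2_eq_square)
    then have "(eff_dim s (lam n))\<^sup>2 / real n * w n \<le> (eff_dim s (lam n) * (suminf s / lam n)) / real n * w n"
      using w by (rule mult_right_mono)
    then show ?case by (simp add: mult_ac)
  qed
qed simp

lemma noise_level_le:
  assumes g: "\<gamma> > 0" "(\<gamma> / 2) powr q \<ge> 4 * v"
  shows "v * \<gamma> powr (2 - q) \<le> \<gamma>\<^sup>2"
proof -
  have "(\<gamma> / 2) powr q \<le> \<gamma> powr q" using g q by (intro powr_mono2) auto
  then have "v \<le> \<gamma> powr q" using g v by linarith
  then have "v * \<gamma> powr (2 - q) \<le> \<gamma> powr q * \<gamma> powr (2 - q)" by (intro mult_right_mono) auto
  also have "\<dots> = \<gamma> powr 2" by (simp add: powr_add[symmetric])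
  also have "\<dots> = \<gamma>\<^sup>2" using g by (simp add: powr_numeral)
  finally show ?thesis .
qed

lemma error_measurable:
  assumes l: "l > 0" and g: "\<gamma> > 0" and ys: "\<And>i \<omega>. ys i \<omega> = f0 \<bullet> X i \<omega> + \<epsilon> i \<omega>"
    and est: "\<And>\<omega>. \<omega> \<in> space M \<Longrightarrow> huber_estimator n \<gamma> l (\<lambda>i. X i \<omega>) (\<lambda>i. ys i \<omega>) (fh \<omega>)"
  shows "random_variable borel (\<lambda>\<omega>. norm (reg_sqrt l (fh \<omega> - f0)))"
proof -
  have ysm: "random_variable borel (ys i)" for i unfolding ys by measurable
  have [measurable]: "fh \<in> borel_measurable M"
    by (rule borel_measurable_huber_estimator[OF X_meas ysm less_imp_le[OF g] l est])
  have [measurable]: "reg_sqrt l \<in> borel_measurable borel" by (rule borel_measurable_reg_sqrt[OF l])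
  show ?thesis by measurable
qed

section \<open>The rate in probability\<close>

theorem rate_in_probability:
  assumes src: "source_condition s e r f0" and q\<kappa>: "q = 1 + min \<kappa> 1"
    and ys: "\<And>i \<omega>. ys i \<omega> = f0 \<bullet> X i \<omega> + \<epsilon> i \<omega>"
  shows "\<exists>C1>0. \<forall>lam gam fhat.
        (\<forall>n\<ge>1. lam n > 0 \<and> gam n > 0) \<longrightarrow>
        (\<forall>n\<ge>1. \<forall>\<omega>\<in>space M.
           huber_estimator n (gam n) (lam n) (\<lambda>i. X i \<omega>) (\<lambda>i. ys i \<omega>) (fhat n \<omega>)) \<longrightarrow>
        (\<forall>\<^sub>F n in sequentially. gam n \<ge> 2 * (4 * v) powr (1 / (1 + min \<kappa> 1))) \<longrightarrow>
        (\<forall>\<^sub>F n in sequentially. gam n \<ge> C1 * huber_rate r \<kappa> v s n (lam n) (gam n)) \<longrightarrow>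
        (\<lambda>n. eff_dim s (lam n) / (real n * lam n)) \<longlonglongrightarrow> 0 \<longrightarrow>
        bigO_prob M (\<lambda>n \<omega>. norm (reg_sqrt (lam n) (fhat n \<omega> - f0)))
          (\<lambda>n. huber_rate r \<kappa> v s n (lam n) (gam n))"
proof -
  obtain Cb where Cb: "Cb > 0" "\<And>l. l > 0 \<Longrightarrow> l * norm (reg_isqrt l f0) \<le> Cb * l powr (min r (1/2) + 1/2)"
    using source_bias[OF src] by blast
  \<comment> \<open>The radius condition asks that \<open>64 * trunc\<close> times the gradient
    bound be at most \<gamma>. Half of the budget goes to the two biases, hence 128; the other half
    is left to the random part, which is eventually small enough for every fixed D.\<close>
  define C1 where "C1 = 128 * trunc * (1 + 2 * Cb)"
  have C1: "C1 > 0" using trunc Cb by (simp add: C1_def)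
  show ?thesis
  proof (intro exI[of _ C1] conjI C1 allI impI)
    fix lam gam :: "nat \<Rightarrow> real" and fhat :: "nat \<Rightarrow> 'w \<Rightarrow> L2"
    assume pos: "\<forall>n\<ge>1. lam n > 0 \<and> gam n > 0"
      and est: "\<forall>n\<ge>1. \<forall>\<omega>\<in>space M.
           huber_estimator n (gam n) (lam n) (\<lambda>i. X i \<omega>) (\<lambda>i. ys i \<omega>) (fhat n \<omega>)"
      and g1: "\<forall>\<^sub>F n in sequentially. gam n \<ge> 2 * (4 * v) powr (1 / (1 + min \<kappa> 1))"
      and g2: "\<forall>\<^sub>F n in sequentially. gam n \<ge> C1 * huber_rate r \<kappa> v s n (lam n) (gam n)"
      and lim: "(\<lambda>n. eff_dim s (lam n) / (real n * lam n)) \<longlonglongrightarrow> 0"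
    define \<nu> where "\<nu> n = (eff_dim s (lam n))\<^sup>2 / real n" for n
    have \<nu>: "\<nu> \<longlonglongrightarrow> 0"
      using eff_dim_sq_limit[of lam "\<lambda>_. 1"] pos lim by (simp add: \<nu>_def[abs_def])
    define c3 where "c3 = 1 / (512 * (24 * K)\<^sup>2)"
    have c3: "c3 > 0" using K by (simp add: c3_def)
    show "bigO_prob M (\<lambda>n \<omega>. norm (reg_sqrt (lam n) (fhat n \<omega> - f0)))
          (\<lambda>n. huber_rate r \<kappa> v s n (lam n) (gam n))"
    proof (rule bigO_probI[OF prob_space_axioms])
      fix n :: nat assume n: "n \<ge> 1"
      have p: "lam n > 0" "gam n > 0" using pos n by auto
      show "(\<lambda>\<omega>. norm (reg_sqrt (lam n) (fhat n \<omega> - f0))) \<in> borel_measurable M"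
        by (rule error_measurable[where n = n, OF p ys]) (use est n in auto)
      have "sqrt (v * gam n powr (2 - q) * (eff_dim s (lam n) / real n)) \<ge> 0"
        using v eff_dim_pos[OF p(1)] by simp
      moreover have "v * gam n powr (1 - q) > 0" using v p by simp
      moreover have "lam n powr (min r (1/2) + 1/2) \<ge> 0" by simp
      ultimately show "huber_rate r \<kappa> v s n (lam n) (gam n) > 0"
        unfolding huber_rate_eq[OF q\<kappa>] by linarith
    next
      fix \<delta> :: real assume \<delta>: "0 < \<delta>" "\<delta> < 1"
      \<comment> \<open>Chebyshev at deviation \<open>D * a\<close> fails with probability at most
        \<open>1 / D\<^sup>2 = \<delta> / 4\<close>; the other two events get \<delta> / 8
        each.\<close>
      define D where "D = sqrt (4 / \<delta>)"
      have D: "D > 0" "D\<^sup>2 = 4 / \<delta>" using \<delta> by (auto simp: D_def)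
      \<comment> \<open>262144 is the square of 512, from the Gram deviation level 1 / 512.\<close>
      have ev1: "\<forall>\<^sub>F n in sequentially. K * 262144 * \<nu> n < \<delta> / 8"
        using \<delta> by (intro order_tendstoD(2)[OF tendsto_mult_right_zero[OF \<nu>]]) simp
      have ev2: "\<forall>\<^sub>F n in sequentially. 65536 * \<nu> n < c3 / 2"
        using c3 by (intro order_tendstoD(2)[OF tendsto_mult_right_zero[OF \<nu>]]) simp
      have ev3: "\<forall>\<^sub>F n in sequentially. exp (- (c3 / 2) * real n) < \<delta> / 8"
      proof (rule order_tendstoD(2))
        show "(\<lambda>n. exp (- (c3 / 2) * real n)) \<longlonglongrightarrow> 0" using c3 by real_asymp
      qed (use \<delta> in simp)
      have ev4: "\<forall>\<^sub>F n in sequentially. (128 * trunc * D)\<^sup>2 * sqrt (\<nu> n) < 1"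
        by (intro order_tendstoD(2)[OF tendsto_mult_right_zero]) (use tendsto_real_sqrt[OF \<nu>] in auto)
      define C where "C = 32 * (1 + D + 2 * Cb)"
      show "\<exists>C. \<forall>\<^sub>F n in sequentially.
         prob {\<omega> \<in> space M. \<bar>norm (reg_sqrt (lam n) (fhat n \<omega> - f0))\<bar> > C * huber_rate r \<kappa> v s n (lam n) (gam n)} < \<delta>"
      proof (rule exI[of _ C])
        show "\<forall>\<^sub>F n in sequentially.
         prob {\<omega> \<in> space M. \<bar>norm (reg_sqrt (lam n) (fhat n \<omega> - f0))\<bar> > C * huber_rate r \<kappa> v s n (lam n) (gam n)} < \<delta>"
          using g1 g2 ev1 ev2 ev3 ev4 eventually_ge_at_top[of 1]
        proof eventually_elim
          case (elim n)
          have n: "n \<ge> 1" by fact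
          define l \<gamma> N where "l = lam n" and "\<gamma> = gam n" and "N = eff_dim s l"
          have l: "l > 0" and g: "\<gamma> > 0" using pos n by (auto simp: l_def \<gamma>_def)
          have N: "N > 0" unfolding N_def by (rule eff_dim_pos[OF l])
          have gq: "(\<gamma> / 2) powr q \<ge> 4 * v"
            by (rule threshold_powr) (use elim(1) in \<open>simp add: q\<kappa> \<gamma>_def\<close>)
          define m a p where "m = v * \<gamma> powr (1 - q)" and "a = sqrt (v * \<gamma> powr (2 - q) * (N / real n))"
            and "p = l powr (min r (1/2) + 1/2)"
          have map: "m > 0" "a > 0" "p \<ge> 0" using v g N n by (auto simp: m_def a_def p_def)
          have rate: "huber_rate r \<kappa> v s n (lam n) (gam n) = a + p + m"
            unfolding huber_rate_eq[OF q\<kappa>] by (simp add: a_def p_def m_def l_def \<gamma>_def N_def)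
          have asq: "a\<^sup>2 = v * \<gamma> powr (2 - q) * (N / real n)" using v g N n by (simp add: a_def)
          have \<nu>n: "\<nu> n = N\<^sup>2 / real n" by (simp add: \<nu>_def N_def l_def)
          have Nn: "N / real n \<le> sqrt (\<nu> n)"
          proof (rule real_le_rsqrt)
            have "1 / (real n)\<^sup>2 \<le> 1 / real n" using n by (simp add: power2_eq_square field_simps)
            then have "N\<^sup>2 * (1 / (real n)\<^sup>2) \<le> N\<^sup>2 * (1 / real n)" by (rule mult_left_mono) simp
            then show "(N / real n)\<^sup>2 \<le> \<nu> n" by (simp add: \<nu>n power_divide)
          qed
          have big: "128 * trunc * D * a \<le> \<gamma>"
          proof (rule power2_le_imp_le)
            have "(128 * trunc * D * a)\<^sup>2 = (128 * trunc * D)\<^sup>2 * (v * \<gamma> powr (2 - q) * (N / real n))"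
              by (simp only: power_mult_distrib asq)
            also have "\<dots> \<le> (128 * trunc * D)\<^sup>2 * (\<gamma>\<^sup>2 * sqrt (\<nu> n))"
              using noise_level_le[OF g gq] Nn N v n by (intro mult_left_mono mult_mono) auto
            also have "\<dots> = \<gamma>\<^sup>2 * ((128 * trunc * D)\<^sup>2 * sqrt (\<nu> n))" by simp
            also have "\<dots> \<le> \<gamma>\<^sup>2 * 1" using elim(6) by (intro mult_left_mono) auto
            finally show "(128 * trunc * D * a)\<^sup>2 \<le> \<gamma>\<^sup>2" by simp
          qed (use g in simp)
          have small: "128 * trunc * (1 + 2 * Cb) * (a + p + m) \<le> \<gamma>"
            using elim(2) unfolding rate by (simp add: C1_def \<gamma>_def)
          have "m + 2 * Cb * p \<le> (1 + 2 * Cb) * (a + p + m)"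
            using map Cb by (simp add: algebra_simps)
          then have "128 * trunc * (m + 2 * Cb * p) \<le> 128 * trunc * ((1 + 2 * Cb) * (a + p + m))"
            using trunc by (intro mult_left_mono) auto
          then have R: "trunc * (32 * (m + D * a + 2 * Cb * p)) \<le> \<gamma> / 2"
            using small big by (simp add: algebra_simps)
          have bias: "2 * l * norm (reg_isqrt l f0) \<le> 2 * Cb * p"
            using Cb(2)[OF l] by (simp add: p_def)
          obtain A where A: "A \<in> events" "prob A \<le> exp (65536 * N\<^sup>2 - real n / (512 * (24 * K)\<^sup>2))"
            "prob {\<omega> \<in> space M. norm (reg_sqrt l (fhat n \<omega> - f0)) > 32 * (m + D * a + 2 * Cb * p)} \<le>
              prob A + prob {\<omega> \<in> space M. norm (gram_dev l n \<omega>) \<ge> 1 / 512} +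
              prob {\<omega> \<in> space M. norm ((1 / real n) *\<^sub>R (\<Sum>i<n. wscore l \<gamma> i \<omega>)) \<ge> m + D * a}"
            by (rule error_event[OF l g gq n bias R[unfolded m_def], of ys "fhat n"])
              (use est n ys in \<open>auto simp: l_def \<gamma>_def N_def m_def\<close>)
          have "65536 * N\<^sup>2 = 65536 * \<nu> n * real n" using n by (simp add: \<nu>n)
          also have "\<dots> \<le> c3 / 2 * real n" using elim(4) by (intro mult_right_mono) auto
          finally have "65536 * N\<^sup>2 - real n / (512 * (24 * K)\<^sup>2) \<le> - (c3 / 2) * real n"
            by (simp add: c3_def)
          then have "exp (65536 * N\<^sup>2 - real n / (512 * (24 * K)\<^sup>2)) \<le> exp (- (c3 / 2) * real n)"
            by (simp only: exp_le_cancel_iff)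
          then have pA: "prob A \<le> \<delta> / 8" using A(2) elim(5) by linarith
          have pG: "prob {\<omega> \<in> space M. norm (gram_dev l n \<omega>) \<ge> 1 / 512} \<le> \<delta> / 8"
            using gram_dev_chebyshev[OF l n, of "1 / 512"] elim(3) by (simp add: \<nu>n N_def power2_eq_square)
          have pS: "prob {\<omega> \<in> space M. norm ((1 / real n) *\<^sub>R (\<Sum>i<n. wscore l \<gamma> i \<omega>)) \<ge> m + D * a} \<le> \<delta> / 4"
          proof -
            have "prob {\<omega> \<in> space M. norm ((1 / real n) *\<^sub>R (\<Sum>i<n. wscore l \<gamma> i \<omega>)) \<ge> m + D * a}
              \<le> v * \<gamma> powr (2 - q) * N / (real n * (D * a)\<^sup>2)"
              unfolding m_def N_def using D map by (intro wscore_chebyshev[OF l g n]) auto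
            also have "\<dots> = a\<^sup>2 / (D * a)\<^sup>2" using n by (simp add: asq)
            also have "\<dots> = \<delta> / 4" using map D by (simp add: power_mult_distrib)
            finally show ?thesis .
          qed
          have C_le: "32 * (m + D * a + 2 * Cb * p) \<le> C * (a + p + m)"
          proof -
            have "0 \<le> D * (p + m) + 2 * Cb * (a + m) + a + p" using D Cb map by simp
            then show ?thesis by (simp add: C_def algebra_simps)
          qed
          have [measurable]: "random_variable borel (\<lambda>\<omega>. norm (reg_sqrt l (fhat n \<omega> - f0)))"
            by (rule error_measurable[where n = n, OF l g ys]) (use est n in \<open>auto simp: l_def \<gamma>_def\<close>)
          have "prob {\<omega> \<in> space M. \<bar>norm (reg_sqrt l (fhat n \<omega> - f0))\<bar> > C * (a + p + m)} \<le>
            prob {\<omega> \<in> space M. norm (reg_sqrt l (fhat n \<omega> - f0)) > 32 * (m + D * a + 2 * Cb * p)}"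
            using C_le by (intro finite_measure_mono) auto
          also have "\<dots> < \<delta>" using A(3) pA pG pS \<delta> by linarith
          finally show ?case unfolding rate l_def .
        qed
      qed
    qed
  qed
qed

end

context subgaussian_regression
begin

section \<open>The high-probability rate\<close>

theorem rate_high_probability:
  assumes src: "source_condition s e r f0" and q\<kappa>: "q = 1 + min \<kappa> 1" and \<kappa>: "\<kappa> > 0"
    and ys: "\<And>i \<omega>. ys i \<omega> = f0 \<bullet> X i \<omega> + \<epsilon> i \<omega>" and C2: "C2 > 0"
  shows "\<exists>C1>0. \<exists>C>0. \<forall>lam gam \<delta> fhat.
        (\<forall>n\<ge>1. lam n > 0 \<and> gam n > 0 \<and> 0 < \<delta> n \<and> \<delta> n < 1) \<longrightarrow>
        (\<forall>n\<ge>1. \<forall>\<omega>\<in>space M.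
           huber_estimator n (gam n) (lam n) (\<lambda>i. X i \<omega>) (\<lambda>i. ys i \<omega>) (fhat n \<omega>)) \<longrightarrow>
        (\<forall>\<^sub>F n in sequentially. gam n \<ge> 2 * (4 * v) powr (1 / (1 + min \<kappa> 1))) \<longrightarrow>
        (\<forall>\<^sub>F n in sequentially.
           C1 * huber_rate r \<kappa> v s n (lam n) (gam n) * ln (real n / \<delta> n) \<le> gam n \<and>
           gam n \<le> C2 * real n powr (1 / (1 + \<kappa>))) \<longrightarrow>
        (\<lambda>n. eff_dim s (lam n) / (real n * lam n) * (ln (real n / \<delta> n))\<^sup>2) \<longlonglongrightarrow> 0 \<longrightarrow>
        (\<forall>\<^sub>F n in sequentially.
           measure M {\<omega> \<in> space M.
             norm (reg_sqrt (lam n) (fhat n \<omega> - f0))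
               \<le> C * huber_rate r \<kappa> v s n (lam n) (gam n) * ln (real n / \<delta> n)}
           \<ge> 1 - \<delta> n)"
proof -
  obtain Cb where Cb: "Cb > 0" "\<And>l. l > 0 \<Longrightarrow> l * norm (reg_isqrt l f0) \<le> Cb * l powr (min r (1/2) + 1/2)"
    using source_bias[OF src] by blast
  \<comment> \<open>\<theta> scales the tilt: it is small enough for the exponential moment of the
    whitened covariate to exist at that tilt, uniformly over \<gamma> below the assumed upper
    bound.\<close>
  define \<theta> where "\<theta> = min 1 (c / 2 / sqrt (C2 powr q / v))"
  have \<theta>: "\<theta> > 0" "\<theta> \<le> 1" "\<theta> * sqrt (C2 powr q / v) \<le> c / 2"
  proof -
    have h: "sqrt (C2 powr q / v) > 0" using C2 v by simp
    show "\<theta> > 0" "\<theta> \<le> 1" using h c by (auto simp: \<theta>_def)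
    have "\<theta> * sqrt (C2 powr q / v) \<le> c / 2 / sqrt (C2 powr q / v) * sqrt (C2 powr q / v)"
      using h unfolding \<theta>_def by (intro mult_right_mono) auto
    moreover have "c / 2 / w * w = c / 2" if "w > 0" for w :: real using that by simp
    ultimately show "\<theta> * sqrt (C2 powr q / v) \<le> c / 2" using h by metis
  qed
  have sc0: "score_const \<ge> 0" "gram_const \<ge> 0" using c B by (auto simp: score_const_def gram_const_def)
  \<comment> \<open>Chosen so that the deviation term in the exponent becomes
    \<open>(score_const + ln 8 + 1) * L\<close>. As L is at least 1, this pays for the variance
    term, for the factor 2 together with the share d / 4, and for one further L.\<close>
  define D where "D = (score_const + ln 8 + 1) / \<theta>"
  have D: "D > 0" using \<theta> sc0 by (simp add: D_def add_nonneg_pos)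
  define C where "C = 32 * (1 + D + 2 * Cb)"
  have C: "C > 0" using D Cb by (simp add: C_def)
  \<comment> \<open>Here the random part carries the factor L as well, so \<gamma> must dominate the
    entire radius; the factor 2 is that of \<gamma> / 2.\<close>
  define C1 where "C1 = 2 * trunc * C"
  have C1: "C1 > 0" using C trunc by (simp add: C1_def)
  show ?thesis
  proof (rule exI[of _ C1], rule conjI[OF C1], rule exI[of _ C], rule conjI[OF C], intro allI impI)
    fix lam gam \<delta> :: "nat \<Rightarrow> real" and fhat :: "nat \<Rightarrow> 'a \<Rightarrow> L2"
    assume pos: "\<forall>n\<ge>1. lam n > 0 \<and> gam n > 0 \<and> 0 < \<delta> n \<and> \<delta> n < 1"
      and est: "\<forall>n\<ge>1. \<forall>\<omega>\<in>space M.
           huber_estimator n (gam n) (lam n) (\<lambda>i. X i \<omega>) (\<lambda>i. ys i \<omega>) (fhat n \<omega>)"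
      and g1: "\<forall>\<^sub>F n in sequentially. gam n \<ge> 2 * (4 * v) powr (1 / (1 + min \<kappa> 1))"
      and g2: "\<forall>\<^sub>F n in sequentially.
           C1 * huber_rate r \<kappa> v s n (lam n) (gam n) * ln (real n / \<delta> n) \<le> gam n \<and>
           gam n \<le> C2 * real n powr (1 / (1 + \<kappa>))"
      and lim: "(\<lambda>n. eff_dim s (lam n) / (real n * lam n) * (ln (real n / \<delta> n))\<^sup>2) \<longlonglongrightarrow> 0"
    define \<eta> where "\<eta> n = (eff_dim s (lam n))\<^sup>2 / real n * (ln (real n / \<delta> n))\<^sup>2" for n
    have \<eta>: "\<eta> \<longlonglongrightarrow> 0"
      using eff_dim_sq_limit[of lam "\<lambda>n. (ln (real n / \<delta> n))\<^sup>2"] pos lim by (simp add: \<eta>_def[abs_def])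
    define c3 where "c3 = 1 / (512 * (24 * K)\<^sup>2)"
    have c3: "c3 > 0" using K by (simp add: c3_def)
    have sq0: "(\<lambda>n. sqrt (\<eta> n)) \<longlonglongrightarrow> 0" using tendsto_real_sqrt[OF \<eta>] by simp
    have ev1: "\<forall>\<^sub>F n in sequentially. 65536 * \<eta> n + 2 * sqrt (\<eta> n) < c3 / 2"
      using c3 sq0
      by (intro order_tendstoD(2)[OF tendsto_add_zero[OF tendsto_mult_right_zero[OF \<eta>] tendsto_mult_right_zero[OF sq0]]]) simp
    have ev2: "\<forall>\<^sub>F n in sequentially. 512 * (gram_const + ln 8 + 1) * sqrt (\<eta> n) < 1"
      by (intro order_tendstoD(2)[OF tendsto_mult_right_zero[OF sq0]]) simp
    have ev3: "\<forall>\<^sub>F n in sequentially. 1 / sqrt (real n) < c / 2"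
    proof (rule order_tendstoD(2))
      show "(\<lambda>n. 1 / sqrt (real n)) \<longlonglongrightarrow> 0" by real_asymp
    qed (use c in simp)
    have ev4: "\<forall>\<^sub>F n in sequentially. ln 4 / (c3 / 2) < real n"
      by (rule filterlim_at_top_dense[THEN iffD1, rule_format, OF filterlim_real_sequentially])
    show "\<forall>\<^sub>F n in sequentially.
           measure M {\<omega> \<in> space M.
             norm (reg_sqrt (lam n) (fhat n \<omega> - f0))
               \<le> C * huber_rate r \<kappa> v s n (lam n) (gam n) * ln (real n / \<delta> n)}
           \<ge> 1 - \<delta> n"
      using g1 g2 ev1 ev2 ev3 ev4 eventually_ge_at_top[of 3]
    proof eventually_elim
      case (elim n)
      have n: "n \<ge> 1" "n \<ge> 3" using elim(7) by auto
      define l \<gamma> N d where "l = lam n" and "\<gamma> = gam n" and "N = eff_dim s l" and "d = \<delta> n"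
      have l: "l > 0" and g: "\<gamma> > 0" and d: "0 < d" "d < 1" using pos n by (auto simp: l_def \<gamma>_def d_def)
      have N: "N > 0" unfolding N_def by (rule eff_dim_pos[OF l])
      have gq: "(\<gamma> / 2) powr q \<ge> 4 * v"
        by (rule threshold_powr) (use elim(1) in \<open>simp add: q\<kappa> \<gamma>_def\<close>)
      define L where "L = ln (real n / d)"
      \<comment> \<open>Taking n at least 3 makes n exceed e, so the logarithm is at least 1 for
        every confidence level.\<close>
      have L1: "L \<ge> 1"
      proof -
        have "exp 1 \<le> (3::real)" by (rule exp_le)
        also have "3 \<le> real n" using n by simp
        also have "\<dots> \<le> real n / d" using d n by (simp add: pos_le_divide_eq mult_left_le)
        finally show ?thesis unfolding L_def using d n by (simp add: ln_ge_iff)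
      qed
      have dL: "exp (- L) \<le> d"
      proof -
        have "exp (- L) = d / real n" using d n by (simp add: L_def exp_minus)
        also have "\<dots> \<le> d / 1" using n d by (intro divide_left_mono) auto
        finally show ?thesis by simp
      qed
      define m a p where "m = v * \<gamma> powr (1 - q)" and "a = sqrt (v * \<gamma> powr (2 - q) * (N / real n))"
        and "p = l powr (min r (1/2) + 1/2)"
      have map: "m > 0" "a > 0" "p \<ge> 0" using v g N n by (auto simp: m_def a_def p_def)
      have rate: "huber_rate r \<kappa> v s n (lam n) (gam n) = a + p + m"
        unfolding huber_rate_eq[OF q\<kappa>] by (simp add: a_def p_def m_def l_def \<gamma>_def N_def)
      have asq: "a\<^sup>2 = v * \<gamma> powr (2 - q) * (N / real n)" using v g N n by (simp add: a_def)
      define x where "x = D * a * L"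
      have C_le: "32 * (m + x + 2 * Cb * p) \<le> C * (a + p + m) * L"
      proof -
        have "m + x + 2 * Cb * p \<le> m * L + x + 2 * Cb * p * L"
        proof -
          have "m * 1 \<le> m * L" "2 * Cb * p * 1 \<le> 2 * Cb * p * L"
            using L1 map Cb by (intro mult_left_mono; simp)+
          then show ?thesis by simp
        qed
        also have "\<dots> \<le> (1 + D + 2 * Cb) * (a + p + m) * L"
        proof -
          have "0 \<le> (D * (p + m) + 2 * Cb * (a + m) + a + p) * L" using D Cb map L1 by simp
          then show ?thesis by (simp add: x_def algebra_simps)
        qed
        finally have "32 * (m + x + 2 * Cb * p) \<le> 32 * ((1 + D + 2 * Cb) * (a + p + m) * L)"
          by (rule mult_left_mono) simp
        then show ?thesis unfolding C_def mult.assoc .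
      qed
      have R: "trunc * (32 * (m + x + 2 * Cb * p)) \<le> \<gamma> / 2"
      proof -
        have "2 * trunc * (C * (a + p + m) * L) \<le> \<gamma>"
        proof -
          have "C1 * (a + p + m) * L \<le> \<gamma>" using elim(2) unfolding rate by (simp only: \<gamma>_def L_def d_def)
          then show ?thesis unfolding C1_def by (simp only: mult_ac)
        qed
        moreover have "trunc * (32 * (m + x + 2 * Cb * p)) \<le> trunc * (C * (a + p + m) * L)"
          using trunc C_le by (intro mult_left_mono) auto
        ultimately show ?thesis by linarith
      qed
      have bias: "2 * l * norm (reg_isqrt l f0) \<le> 2 * Cb * p"
        using Cb(2)[OF l] by (simp add: p_def)
      obtain A where A: "A \<in> events" "prob A \<le> exp (65536 * N\<^sup>2 - real n / (512 * (24 * K)\<^sup>2))"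
        "l \<ge> s 0 \<Longrightarrow> prob A = 0"
        "prob {\<omega> \<in> space M. norm (reg_sqrt l (fhat n \<omega> - f0)) > 32 * (m + x + 2 * Cb * p)} \<le>
          prob A + prob {\<omega> \<in> space M. norm (gram_dev l n \<omega>) \<ge> 1 / 512} +
          prob {\<omega> \<in> space M. norm ((1 / real n) *\<^sub>R (\<Sum>i<n. wscore l \<gamma> i \<omega>)) \<ge> m + x}"
        by (rule error_event[OF l g gq n(1) bias R[unfolded m_def], of ys "fhat n"])
          (use est n ys in \<open>auto simp: l_def \<gamma>_def N_def m_def\<close>)
      have \<eta>n: "\<eta> n = N\<^sup>2 / real n * L\<^sup>2" by (simp add: \<eta>_def N_def l_def L_def d_def)
      have sq\<eta>: "sqrt (\<eta> n) = N * L / sqrt (real n)"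
        using N L1 by (simp add: \<eta>n real_sqrt_mult real_sqrt_divide)
      have pA: "prob A \<le> d / 4"
      proof (cases "l \<ge> s 0")
        case True
        then show ?thesis using A(3) d by simp
      next
        case False
        \<comment> \<open>Below the top eigenvalue the effective dimension is at least 1/2. Hence L
          is at most \<open>2 * N * L\<close>, which is small compared with n, and the exponential
          curvature bound beats d however small d is.\<close>
        have "N \<ge> weight l 0" unfolding N_def by (rule weight_le_eff_dim[OF l])
        moreover have "weight l 0 \<ge> 1 / 2" using False l s_pos[of 0] by (simp add: weight_def field_simps)
        ultimately have N2: "1 \<le> 2 * N" by simp
        have "N\<^sup>2 * 1 \<le> N\<^sup>2 * L\<^sup>2" using L1 by (intro mult_left_mono) (auto simp: one_le_power)
        also have "\<dots> = \<eta> n * real n" using n by (simp add: \<eta>n)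
        finally have 1: "N\<^sup>2 \<le> \<eta> n * real n" by simp
        have "L \<le> 2 * N * L" using N2 L1 mult_right_mono[of 1 "2 * N" L] by simp
        also have "\<dots> = 2 * sqrt (\<eta> n) * sqrt (real n)" using n by (simp add: sq\<eta>)
        also have "\<dots> \<le> 2 * sqrt (\<eta> n) * real n"
        proof (rule mult_left_mono)
          have "sqrt (real n) * 1 \<le> sqrt (real n) * sqrt (real n)" using n by (intro mult_left_mono) auto
          then show "sqrt (real n) \<le> real n" by simp
        qed (use N L1 n in \<open>simp add: sq\<eta>\<close>)
        finally have 2: "L \<le> 2 * sqrt (\<eta> n) * real n" .
        have 3: "(65536 * \<eta> n + 2 * sqrt (\<eta> n)) * real n \<le> c3 / 2 * real n"
          using elim(3) by (intro mult_right_mono) auto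
        have 4: "ln 4 \<le> c3 / 2 * real n" using elim(6) c3 by (simp add: field_simps)
        have "65536 * N\<^sup>2 - c3 * real n \<le> - L - ln 4"
          using 1 2 3 4 by (simp add: algebra_simps)
        then have "exp (65536 * N\<^sup>2 - real n / (512 * (24 * K)\<^sup>2)) \<le> exp (- L - ln 4)"
          unfolding exp_le_cancel_iff by (simp add: c3_def)
        also have "\<dots> = exp (- L) / 4" by (simp add: exp_diff)
        finally show ?thesis using A(2) dL by linarith
      qed
      have pG: "prob {\<omega> \<in> space M. norm (gram_dev l n \<omega>) \<ge> 1 / 512} \<le> d / 4"
      proof -
        have "prob {\<omega> \<in> space M. norm (gram_dev l n \<omega>) \<ge> 1 / 512} \<le> 2 * exp (gram_const - sqrt (real n) * (1 / 512) / N)"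
          unfolding N_def by (rule gram_dev_exp[OF l n(1)]) (use elim(5) in simp)
        also have "\<dots> \<le> 2 * exp (- L - ln 8)"
        proof -
          have "(gram_const + ln 8 + 1) * (N * L / sqrt (real n)) * 512 \<le> 1" using elim(4) unfolding sq\<eta> by (simp add: mult_ac)
          then have "(gram_const + ln 8 + 1) * L \<le> sqrt (real n) * (1 / 512) / N"
            using N n by (simp add: field_simps)
          moreover have "(gram_const + ln 8) * 1 \<le> (gram_const + ln 8) * L"
            using sc0 L1 by (intro mult_left_mono) auto
          ultimately have "gram_const - sqrt (real n) * (1 / 512) / N \<le> - L - ln 8"
            by (simp add: distrib_right)
          then show ?thesis by simp
        qed
        also have "\<dots> = exp (- L) / 4" by (simp add: exp_diff)
        finally show ?thesis using dL by linarith
      qed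
      have pS: "prob {\<omega> \<in> space M. norm ((1 / real n) *\<^sub>R (\<Sum>i<n. wscore l \<gamma> i \<omega>)) \<ge> m + x} \<le> d / 4"
      proof -
        \<comment> \<open>With this tilt the variance term in the exponent is exactly the square of
          \<theta> times \<open>score_const\<close>, whatever n and \<gamma> are.\<close>
        define t where "t = \<theta> / (real n * a)"
        have t: "t > 0" using \<theta> map n by (simp add: t_def)
        \<comment> \<open>The upper bound on \<gamma> is used here: since q is at most 1 + \<kappa>,
          it keeps \<open>\<gamma> powr q\<close> of order n, as the tilt restriction
          requires.\<close>
        have gn: "\<gamma> powr q \<le> C2 powr q * real n"
        proof -
          have "\<gamma> \<le> C2 * real n powr (1 / (1 + \<kappa>))" using elim(2) by (simp add: \<gamma>_def)
          then have "\<gamma> powr q \<le> (C2 * real n powr (1 / (1 + \<kappa>))) powr q" using g q by (intro powr_mono2) auto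
          also have "\<dots> = C2 powr q * real n powr (q / (1 + \<kappa>))" using C2 by (simp add: powr_mult powr_powr)
          also have "real n powr (q / (1 + \<kappa>)) \<le> real n powr 1"
            using n \<kappa> by (intro powr_mono) (auto simp: q\<kappa>)
          finally show ?thesis using n by (simp add: mult_left_mono)
        qed
        have tN: "t * \<gamma> * sqrt N \<le> c / 2"
        proof -
          have g2: "\<gamma>\<^sup>2 = \<gamma> powr (2 - q) * \<gamma> powr q" using g by (simp add: powr_add[symmetric] powr_numeral)
          have "(t * \<gamma> * sqrt N)\<^sup>2 = \<theta>\<^sup>2 * (\<gamma>\<^sup>2 * N) / ((real n)\<^sup>2 * a\<^sup>2)"
            using N by (simp add: t_def power_mult_distrib power_divide)
          also have "\<dots> = \<theta>\<^sup>2 * (\<gamma> powr q / (v * real n))"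
            unfolding asq g2 using N n v g by (simp add: power2_eq_square field_simps)
          also have "\<dots> \<le> \<theta>\<^sup>2 * (C2 powr q / v)"
          proof (intro mult_left_mono)
            show "\<gamma> powr q / (v * real n) \<le> C2 powr q / v" using gn v n by (simp add: field_simps)
          qed simp
          also have "\<dots> = (\<theta> * sqrt (C2 powr q / v))\<^sup>2" using v by (simp add: power_mult_distrib)
          finally have "t * \<gamma> * sqrt N \<le> \<theta> * sqrt (C2 powr q / v)"
            by (rule power2_le_imp_le) (use \<theta> v in simp)
          then show ?thesis using \<theta>(3) by linarith
        qed
        have "prob {\<omega> \<in> space M. norm ((1 / real n) *\<^sub>R (\<Sum>i<n. wscore l \<gamma> i \<omega>)) \<ge> m + x}
          \<le> 2 * exp (real n * t\<^sup>2 * (v * \<gamma> powr (2 - q) * N) * score_const - real n * t * x)"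
          unfolding m_def N_def by (rule wscore_exp[OF l g n(1) t tN[unfolded N_def]])
        also have "real n * t\<^sup>2 * (v * \<gamma> powr (2 - q) * N) = \<theta>\<^sup>2"
        proof -
          have "v * \<gamma> powr (2 - q) * N = real n * a\<^sup>2" using n by (simp add: asq)
          then show ?thesis using n map by (simp add: t_def power_divide power_mult_distrib power2_eq_square)
        qed
        also have "real n * t * x = (score_const + ln 8 + 1) * L"
          using n map \<theta> by (simp add: t_def x_def D_def)
        also have "2 * exp (\<theta>\<^sup>2 * score_const - (score_const + ln 8 + 1) * L) \<le> 2 * exp (- L - ln 8)"
        proof -
          have "\<theta>\<^sup>2 * score_const \<le> 1 * score_const"
            using \<theta> sc0 by (intro mult_right_mono) (auto simp: power_le_one)
          moreover have "(score_const + ln 8) * 1 \<le> (score_const + ln 8) * L"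
            using sc0 L1 by (intro mult_left_mono) auto
          ultimately have "\<theta>\<^sup>2 * score_const - (score_const + ln 8 + 1) * L \<le> - L - ln 8"
            by (simp add: distrib_right)
          then show ?thesis by simp
        qed
        also have "\<dots> = exp (- L) / 4" by (simp add: exp_diff)
        finally show ?thesis using dL by linarith
      qed
      define Z where "Z \<omega> = norm (reg_sqrt l (fhat n \<omega> - f0))" for \<omega>
      have [measurable]: "Z \<in> borel_measurable M" unfolding Z_def[abs_def]
        by (rule error_measurable[where n = n, OF l g ys]) (use est n in \<open>auto simp: l_def \<gamma>_def\<close>)
      have "prob {\<omega> \<in> space M. Z \<omega> > 32 * (m + x + 2 * Cb * p)} \<le> d"
        using A(4) pA pG pS d unfolding Z_def by linarith
      moreover have "prob (space M - {\<omega> \<in> space M. Z \<omega> > 32 * (m + x + 2 * Cb * p)}) =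
         1 - prob {\<omega> \<in> space M. Z \<omega> > 32 * (m + x + 2 * Cb * p)}"
        by (rule prob_compl) measurable
      moreover have "prob (space M - {\<omega> \<in> space M. Z \<omega> > 32 * (m + x + 2 * Cb * p)}) \<le>
         prob {\<omega> \<in> space M. Z \<omega> \<le> C * (a + p + m) * L}"
        using C_le by (intro finite_measure_mono) auto
      ultimately have "prob {\<omega> \<in> space M. Z \<omega> \<le> C * (a + p + m) * L} \<ge> 1 - d" by linarith
      then show ?case unfolding rate Z_def l_def L_def d_def .
    qed
  qed
qed

end

section \<open>Both rates for the stated model\<close>

theorem theorem1:
  fixes M :: "'w measure"
    and X :: "'w \<Rightarrow> L2" and y :: "'w \<Rightarrow> real"
    and Xs :: "nat \<Rightarrow> 'w \<Rightarrow> L2" and ys \<epsilon> :: "nat \<Rightarrow> 'w \<Rightarrow> real"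
    and f0 :: L2 and s :: "nat \<Rightarrow> real" and e :: "nat \<Rightarrow> L2"
    and r \<kappa> v vc :: real
  assumes "prob_space M"
    and "iid_copies M (\<lambda>\<omega>. (X \<omega>, y \<omega>)) (\<lambda>i \<omega>. (Xs i \<omega>, ys i \<omega>))"
    and "(\<integral>\<omega>. X \<omega> \<partial>M) = 0"
    and "\<And>i \<omega>. \<omega> \<in> space M \<Longrightarrow> ys i \<omega> = f0 \<bullet> Xs i \<omega> + \<epsilon> i \<omega>"
    and "spectral_decomposition (cov_op M X) s e"
    and "moment_condition M X"
    and "source_condition s e r f0"
    and "eff_dim_condition s"
    and "\<And>i. noise_condition M (Xs i) (\<epsilon> i) \<kappa> v"
    and "vc > 0"
    and "\<kappa> \<le> 1 \<Longrightarrow> vc = v"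
    and "\<And>i. \<kappa> > 1 \<Longrightarrow> cond_moment_le M (Xs i) (\<epsilon> i) 2 vc"
  shows
    "(\<exists>C1>0. \<forall>lam gam fhat.
        (\<forall>n\<ge>1. lam n > 0 \<and> gam n > 0) \<longrightarrow>
        (\<forall>n\<ge>1. \<forall>\<omega>\<in>space M.
           huber_estimator n (gam n) (lam n) (\<lambda>i. Xs i \<omega>) (\<lambda>i. ys i \<omega>) (fhat n \<omega>)) \<longrightarrow>
        (\<forall>\<^sub>F n in sequentially. gam n \<ge> 2 * (4 * vc) powr (1 / (1 + min \<kappa> 1))) \<longrightarrow>
        (\<forall>\<^sub>F n in sequentially. gam n \<ge> C1 * huber_rate r \<kappa> vc s n (lam n) (gam n)) \<longrightarrow>
        (\<lambda>n. eff_dim s (lam n) / (real n * lam n)) \<longlonglongrightarrow> 0 \<longrightarrow>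
        bigO_prob M (\<lambda>n \<omega>. norm (op_fun s e (\<lambda>x. sqrt (x + lam n)) (fhat n \<omega> - f0)))
          (\<lambda>n. huber_rate r \<kappa> vc s n (lam n) (gam n)))
     \<and>
     (subgaussian_scores M X s e \<longrightarrow>
      (\<forall>C2>0. \<exists>C1>0. \<exists>C>0. \<forall>lam gam \<delta> fhat.
        (\<forall>n\<ge>1. lam n > 0 \<and> gam n > 0 \<and> 0 < \<delta> n \<and> \<delta> n < 1) \<longrightarrow>
        (\<forall>n\<ge>1. \<forall>\<omega>\<in>space M.
           huber_estimator n (gam n) (lam n) (\<lambda>i. Xs i \<omega>) (\<lambda>i. ys i \<omega>) (fhat n \<omega>)) \<longrightarrow>
        (\<forall>\<^sub>F n in sequentially. gam n \<ge> 2 * (4 * vc) powr (1 / (1 + min \<kappa> 1))) \<longrightarrow>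
        (\<forall>\<^sub>F n in sequentially. gam n \<ge> C1 * huber_rate r \<kappa> vc s n (lam n) (gam n)) \<longrightarrow>
        (\<lambda>n. eff_dim s (lam n) / (real n * lam n)) \<longlonglongrightarrow> 0 \<longrightarrow>
        (\<forall>\<^sub>F n in sequentially.
           C1 * huber_rate r \<kappa> vc s n (lam n) (gam n) * ln (real n / \<delta> n) \<le> gam n \<and>
           gam n \<le> C2 * real n powr (1 / (1 + \<kappa>))) \<longrightarrow>
        (\<lambda>n. eff_dim s (lam n) / (real n * lam n) * (ln (real n / \<delta> n))\<^sup>2) \<longlonglongrightarrow> 0 \<longrightarrow>
        (\<forall>\<^sub>F n in sequentially.
           measure M {\<omega> \<in> space M.
             norm (op_fun s e (\<lambda>x. sqrt (x + lam n)) (fhat n \<omega> - f0))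
               \<le> C * huber_rate r \<kappa> vc s n (lam n) (gam n) * ln (real n / \<delta> n)}
           \<ge> 1 - \<delta> n)))"
proof -
  interpret prob_space M by fact
  note m = iid_copies_marginals[OF assms(2)]
  obtain K where reg: "regression M s e Xs (\<lambda>i \<omega>. ys i \<omega> - f0 \<bullet> Xs i \<omega>) (1 + min \<kappa> 1) vc K"
    using model_regression[OF assms(1,2,4,5,6,9,10,11,12)] by blast
  interpret regression M s e Xs "\<lambda>i \<omega>. ys i \<omega> - f0 \<bullet> Xs i \<omega>" "1 + min \<kappa> 1" vc K by (rule reg)
  \<comment> \<open>True by definition of the residual noise, hence also outside the sample
    space.\<close>
  have ys: "ys i \<omega> = f0 \<bullet> Xs i \<omega> + (ys i \<omega> - f0 \<bullet> Xs i \<omega>)" for i \<omega> by simp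
  have \<kappa>: "\<kappa> > 0" using assms(9)[of 0] by (simp add: noise_condition_def)
  note part_i = rate_in_probability[OF assms(7) refl ys]
  {
    fix C2 :: real assume sub: "subgaussian_scores M X s e" and C2: "C2 > 0"
    obtain C where C: "C > 0" and mgf: "\<And>j t. (\<integral>\<^sup>+ \<omega>. ennreal (exp (t * (X \<omega> \<bullet> e j) / sqrt (s j))) \<partial>M) \<le> ennreal (exp (C * t\<^sup>2))"
      using sub by (auto simp: subgaussian_scores_def)
    define c where "c = 1 / (16 * C)"
    define B where "B = 2 * exp (2 * c) / (1 - exp (- 2 * c))"
    have c: "c > 0" using C by (simp add: c_def)
    interpret subgaussian_regression M s e Xs "\<lambda>i \<omega>. ys i \<omega> - f0 \<bullet> Xs i \<omega>" "1 + min \<kappa> 1" vc K c B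
    proof
      show "c > 0" by (rule c)
      show "B \<ge> 0" using c by (simp add: B_def)
      fix i j
      \<comment> \<open>The sub-Gaussian bound is given for the generic copy X; equality in law
        carries the exponential moment over to each sample point.\<close>
      have "(\<integral>\<^sup>+\<omega>. ennreal (exp (c * ((X \<omega> \<bullet> e j) / sqrt (s j))\<^sup>2)) \<partial>M) \<le> ennreal B"
        unfolding B_def c_def
        by (rule subgaussian_exp_square[OF _ C]) (use m(1) mgf[of _ j] in auto)
      then show "(\<integral>\<^sup>+\<omega>. ennreal (exp (c * (score i j \<omega>)\<^sup>2)) \<partial>M) \<le> ennreal B"
        unfolding score_def
        using integral_eq_if_distr_eq(3)[OF m(4) m(2) m(1), where g = "\<lambda>x. exp (c * ((x \<bullet> e j) / sqrt (s j))\<^sup>2)"] by simp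
    qed
    note rate_high_probability[OF assms(7) refl \<kappa> ys C2]
  }
  note part_ii = this
  show ?thesis by (intro conjI part_i impI allI, drule part_ii, assumption) blast
qed

end
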